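(* Let $X$ be a path connected, locally path connected, paracompact Hausdorff space with basepoint $x_0$, and give $\pi_1(X,x_0)$ the shape topology. Then the set of thick Spanier groups $\Pi^{Sp}(\mathscr{U},x_0)$, where $\mathscr{U}$ ranges over the open covers of $X$, forms a neighborhood base at the identity of $\pi_1(X,x_0)$.
   Context: Paths are continuous maps from $[0,1]$, $\overline{\alpha}$ is the reverse path, and $[\alpha][\beta]=[\alpha\ast\beta]$ denotes concatenation of homotopy classes rel. endpoints. For an open cover $\mathscr{U}$ of $X$, the thick Spanier group $\Pi^{Sp}(\mathscr{U},x_0)$ is the subgroup of $\pi_1(X,x_0)$ generated by all elements $[\alpha][\gamma_1][\gamma_2][\overline{\alpha}]$ where $\alpha$ is a path with $\alpha(0)=x_0$, and $\gamma_1:[0,1]\to U_1$, $\gamma_2:[0,1]\to U_2$ are paths for some $U_1,U_2\in\mathscr{U}$ with $\gamma_1(0)=\gamma_2(1)=\alpha(1)$ and $\gamma_1(1)=\gamma_2(0)$. First shape group. Consider pairs $(\mathscr{U},U_0)$ with $\mathscr{U}$ an open cover of $X$ and $x_0\in U_0\in\mathscr{U}$. $(\mathscr{V},V_0)$ refines $(\mathscr{U},U_0)$ if $\mathscr{V}$ refines $\mathscr{U}$ and $V_0\subseteq U_0$. The nerve $N(\mathscr{U})$ is the abstract simplicial complex with vertex set $\mathscr{U}$, in which $A_0,\dots,A_n$ span a simplex iff $\bigcap_i A_i\neq\emptyset$; $|N(\mathscr{U})|$ is its geometric realization, based at the vertex $U_0$. Let $\Lambda$ be the set of pairs $(\mathscr{U},U_0)$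 admitting a partition of unity $\{\phi_U\}_{U\in\mathscr{U}}$ subordinated to $\mathscr{U}$ with $\phi_{U_0}(x_0)=1$, directed by refinement. If $(\mathscr{V},V_0)$ refines $(\mathscr{U},U_0)$, any vertex assignment $V\mapsto U$ with $V\subseteq U$ and $V_0\mapsto U_0$ defines a simplicial map $N(\mathscr{V})\to N(\mathscr{U})$ whose realization is unique up to based homotopy; the induced homomorphism is $p_{\mathscr{U}\mathscr{V}\ast}:\pi_1(|N(\mathscr{V})|,V_0)\to\pi_1(|N(\mathscr{U})|,U_0)$. Set $\check{\pi}_1(X,x_0)=\varprojlim(\pi_1(|N(\mathscr{U})|,U_0),p_{\mathscr{U}\mathscr{V}\ast},\Lambda)$. A canonical map for $(\mathscr{U},U_0)$ is a continuous map $p_{\mathscr{U}}:X\to|N(\mathscr{U})|$ with $p_{\mathscr{U}}(x_0)=U_0$ and $p_{\mathscr{U}}^{-1}(St(U,N(\mathscr{U})))\subseteq U$ for all $U\in\mathscr{U}$, where $St(U,N(\mathscr{U}))$ is the open star of the vertex $U$. For $(\mathscr{U},U_0)\in\Lambda$ canonical maps exist and are unique up to based homotopy, and they are compatible with the maps $p_{\mathscr{U}\mathscr{V}\ast}$ on $\pi_1$. Define $\Psi_X:\pi_1(X,x_0)\to\check{\pi}_1(X,x_0)$ by $\Psi_X([\alpha])=([p_{\mathscr{U}}\circ\alpha])_{(\mathscr{U},U_0)\in\Lambda}$. Shape topology. Topologize $\check{\pi}_1(X,x_0)$ as a subspace of the product $\prod_{\Lambda}\pi_1(|N(\mathscr{U})|,U_0)$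 of discrete groups. The shape topology on $\pi_1(X,x_0)$ has as open sets exactly the sets $\Psi_X^{-1}(W)$ with $W$ open in $\check{\pi}_1(X,x_0)$; it is a group topology. *)

theory Defs
  imports "HOL-Analysis.Analysis" "HOL-Algebra.Product_Groups"
begin

section \<open>Covers\<close>

definition open_cover :: "'a topology \<Rightarrow> 'a set set \<Rightarrow> bool" where
  "open_cover X \<U> \<longleftrightarrow> (\<forall>U\<in>\<U>. openin X U) \<and> \<Union>\<U> = topspace X"

definition refines :: "'a set set \<Rightarrow> 'a set set \<Rightarrow> bool" where
  "refines \<V> \<U> \<longleftrightarrow> (\<forall>V\<in>\<V>. \<exists>U\<in>\<U>. V \<subseteq> U)"

text \<open>The Hausdorff property is not part of this definition.\<close>

definition paracompact_space :: "'a topology \<Rightarrow> bool" where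
  "paracompact_space X \<longleftrightarrow>
     (\<forall>\<U>. open_cover X \<U> \<longrightarrow>
        (\<exists>\<V>. open_cover X \<V> \<and> refines \<V> \<U> \<and> locally_finite_in X \<V>))"


section \<open>The fundamental group\<close>

text \<open>
  As for \<open>pathin\<close>, a path is a function on all of \<open>real\<close> of which only the restriction to
  \<open>{0..1}\<close> matters; in particular two functions that agree on \<open>{0..1}\<close> have the same class.
  The library operations on paths are tied to the class \<open>topological_space\<close>, so they are
  restated here for arbitrary types.
\<close>

definition path_join :: "(real \<Rightarrow> 'a) \<Rightarrow> (real \<Rightarrow> 'a) \<Rightarrow> real \<Rightarrow> 'a" (infixr \<open>\<star>\<close> 75) where
  "p \<star> q = (\<lambda>t. if t \<le> 1/2 then p (2 * t) else q (2 * t - 1))"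

definition path_reverse :: "(real \<Rightarrow> 'a) \<Rightarrow> real \<Rightarrow> 'a" where
  "path_reverse p = (\<lambda>t. p (1 - t))"

definition path_class :: "'a topology \<Rightarrow> (real \<Rightarrow> 'a) \<Rightarrow> (real \<Rightarrow> 'a) set" where
  "path_class X p =
     {q. homotopic_with (\<lambda>r. r 0 = p 0 \<and> r 1 = p 1) (top_of_set {0..1}) X p q}"

definition loop_at :: "'a topology \<Rightarrow> 'a \<Rightarrow> (real \<Rightarrow> 'a) \<Rightarrow> bool" where
  "loop_at X x0 p \<longleftrightarrow> pathin X p \<and> p 0 = x0 \<and> p 1 = x0"

text \<open>
  Operations on homotopy classes are defined as the union over all representatives of the class of
  the result; these classes all coincide.
\<close>

definition fundamental_group :: "'a topology \<Rightarrow> 'a \<Rightarrow> (real \<Rightarrow> 'a) set monoid" where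
  "fundamental_group X x0 =
     \<lparr>carrier = {path_class X p | p. loop_at X x0 p},
      monoid.mult = (\<lambda>c d. \<Union>p\<in>c. \<Union>q\<in>d. path_class X (p \<star> q)),
      one = path_class X (\<lambda>_. x0)\<rparr>"

definition induced_hom ::
  "'b topology \<Rightarrow> ('a \<Rightarrow> 'b) \<Rightarrow> (real \<Rightarrow> 'a) set \<Rightarrow> (real \<Rightarrow> 'b) set" where
  "induced_hom Y f c = (\<Union>p\<in>c. path_class Y (f \<circ> p))"


section \<open>Thick Spanier groups\<close>

definition thick_spanier_generators ::
  "'a topology \<Rightarrow> 'a set set \<Rightarrow> 'a \<Rightarrow> (real \<Rightarrow> 'a) set set" where
  "thick_spanier_generators X \<U> x0 =
     {path_class X (\<alpha> \<star> \<gamma>1 \<star> \<gamma>2 \<star> path_reverse \<alpha>) | \<alpha> \<gamma>1 \<gamma>2.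
        pathin X \<alpha> \<and> \<alpha> 0 = x0 \<and>
        (\<exists>U1\<in>\<U>. pathin (subtopology X U1) \<gamma>1) \<and>
        (\<exists>U2\<in>\<U>. pathin (subtopology X U2) \<gamma>2) \<and>
        \<gamma>1 0 = \<alpha> 1 \<and> \<gamma>2 1 = \<alpha> 1 \<and> \<gamma>1 1 = \<gamma>2 0}"

definition thick_spanier_group ::
  "'a topology \<Rightarrow> 'a set set \<Rightarrow> 'a \<Rightarrow> (real \<Rightarrow> 'a) set set" where
  "thick_spanier_group X \<U> x0 =
     generate (fundamental_group X x0) (thick_spanier_generators X \<U> x0)"


section \<open>Geometric realization of abstract simplicial complexes\<close>

text \<open>
  A complex is given by its set of (finite, nonempty) simplices.  Points of the realization are
  given by barycentric coordinates, and the topology is the weak one.  The type \<open>'v \<Rightarrow> real\<close>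
  carries the product topology, which induces the Euclidean topology on each closed simplex.
\<close>

definition closed_simplex :: "'v set \<Rightarrow> ('v \<Rightarrow> real) set" where
  "closed_simplex \<sigma> = {f. (\<forall>v. 0 \<le> f v) \<and> (\<forall>v. v \<notin> \<sigma> \<longrightarrow> f v = 0) \<and> (\<Sum>v\<in>\<sigma>. f v) = 1}"

definition realization :: "'v set set \<Rightarrow> ('v \<Rightarrow> real) topology" where
  "realization K = topology (\<lambda>W. W \<subseteq> (\<Union>\<sigma>\<in>K. closed_simplex \<sigma>) \<and>
     (\<forall>\<sigma>\<in>K. openin (top_of_set (closed_simplex \<sigma>)) (W \<inter> closed_simplex \<sigma>)))"

lemma openin_realization:
  "openin (realization K) W \<longleftrightarrow> W \<subseteq> (\<Union>\<sigma>\<in>K. closed_simplex \<sigma>) \<and>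
     (\<forall>\<sigma>\<in>K. openin (top_of_set (closed_simplex \<sigma>)) (W \<inter> closed_simplex \<sigma>))"
proof -
  have "istopology (\<lambda>W. W \<subseteq> (\<Union>\<sigma>\<in>K. closed_simplex \<sigma>) \<and>
     (\<forall>\<sigma>\<in>K. openin (top_of_set (closed_simplex \<sigma>)) (W \<inter> closed_simplex \<sigma>)))"
    (is "istopology ?P")
    unfolding istopology_def
  proof (intro conjI allI impI)
    fix S T assume S: "?P S" and T: "?P T"
    show "S \<inter> T \<subseteq> (\<Union>\<sigma>\<in>K. closed_simplex \<sigma>)"
      using S by blast
    show "\<forall>\<sigma>\<in>K. openin (top_of_set (closed_simplex \<sigma>)) (S \<inter> T \<inter> closed_simplex \<sigma>)"
    proof
      fix \<sigma> assume "\<sigma> \<in> K"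
      then have "openin (top_of_set (closed_simplex \<sigma>))
                   ((S \<inter> closed_simplex \<sigma>) \<inter> (T \<inter> closed_simplex \<sigma>))"
        using S T openin_Int by blast
      then show "openin (top_of_set (closed_simplex \<sigma>)) (S \<inter> T \<inter> closed_simplex \<sigma>)"
        by (simp add: Int_ac)
    qed
  next
    fix \<K> assume \<K>: "\<forall>S\<in>\<K>. ?P S"
    show "\<Union>\<K> \<subseteq> (\<Union>\<sigma>\<in>K. closed_simplex \<sigma>)"
      using \<K> by blast
    show "\<forall>\<sigma>\<in>K. openin (top_of_set (closed_simplex \<sigma>)) (\<Union>\<K> \<inter> closed_simplex \<sigma>)"
    proof
      fix \<sigma> assume "\<sigma> \<in> K"
      then have "openin (top_of_set (closed_simplex \<sigma>)) (\<Union>S\<in>\<K>. S \<inter> closed_simplex \<sigma>)"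
        using \<K> by (intro openin_clauses(3)) auto
      then show "openin (top_of_set (closed_simplex \<sigma>)) (\<Union>\<K> \<inter> closed_simplex \<sigma>)"
        by (simp add: Int_commute Int_Union)
    qed
  qed
  then show ?thesis
    by (simp add: realization_def topology_inverse')
qed

lemma topspace_realization: "topspace (realization K) = (\<Union>\<sigma>\<in>K. closed_simplex \<sigma>)"
proof -
  have "(\<Union>\<sigma>\<in>K. closed_simplex \<sigma>) \<inter> closed_simplex \<tau> = closed_simplex \<tau>" if "\<tau> \<in> K" for \<tau>
    using that by blast
  then have "openin (realization K) (\<Union>\<sigma>\<in>K. closed_simplex \<sigma>)"
    by (simp add: openin_realization openin_subtopology_self)
  moreover have "topspace (realization K) \<subseteq> (\<Union>\<sigma>\<in>K. closed_simplex \<sigma>)"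
    using openin_realization openin_topspace by blast
  ultimately show ?thesis
    using openin_subset by blast
qed

definition vertex_point :: "'v \<Rightarrow> 'v \<Rightarrow> real" where
  "vertex_point v = (\<lambda>w. if w = v then 1 else 0)"

definition open_star :: "'v set set \<Rightarrow> 'v \<Rightarrow> ('v \<Rightarrow> real) set" where
  "open_star K v = {f \<in> topspace (realization K). f v \<noteq> 0}"

text \<open>The affine extension of a vertex map; the sum is finite on points of a realization.\<close>

definition realization_map :: "('v \<Rightarrow> 'w) \<Rightarrow> ('v \<Rightarrow> real) \<Rightarrow> 'w \<Rightarrow> real" where
  "realization_map \<tau> f = (\<lambda>w. \<Sum>v | f v \<noteq> 0 \<and> \<tau> v = w. f v)"

definition nerve :: "'a set set \<Rightarrow> 'a set set set" where
  "nerve \<U> = {\<sigma>. \<sigma> \<subseteq> \<U> \<and> finite \<sigma> \<and> \<sigma> \<noteq> {} \<and> \<Inter>\<sigma> \<noteq> {}}"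


section \<open>The first shape group and the shape topology\<close>

definition subordinated_partition_of_unity ::
  "'a topology \<Rightarrow> 'a set set \<Rightarrow> ('a set \<Rightarrow> 'a \<Rightarrow> real) \<Rightarrow> bool" where
  "subordinated_partition_of_unity X \<U> \<phi> \<longleftrightarrow>
     (\<forall>U\<in>\<U>. continuous_map X (top_of_set {0..1}) (\<phi> U)) \<and>
     (\<forall>U\<in>\<U>. X closure_of {x \<in> topspace X. \<phi> U x \<noteq> 0} \<subseteq> U) \<and>
     (\<forall>x\<in>topspace X. \<exists>W. openin X W \<and> x \<in> W \<and>
        finite {U \<in> \<U>. W \<inter> X closure_of {y \<in> topspace X. \<phi> U y \<noteq> 0} \<noteq> {}}) \<and>
     (\<forall>x\<in>topspace X. (\<Sum>U | U \<in> \<U> \<and> \<phi> U x \<noteq> 0. \<phi> U x) = 1)"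

type_synonym 'a pointed_cover = "'a set set \<times> 'a set"

definition shape_index :: "'a topology \<Rightarrow> 'a \<Rightarrow> 'a pointed_cover set" where
  "shape_index X x0 = {(\<U>, U0). open_cover X \<U> \<and> U0 \<in> \<U> \<and> x0 \<in> U0 \<and>
     (\<exists>\<phi>. subordinated_partition_of_unity X \<U> \<phi> \<and> \<phi> U0 x0 = 1)}"

definition pointed_refines :: "'a pointed_cover \<Rightarrow> 'a pointed_cover \<Rightarrow> bool" where
  "pointed_refines j i \<longleftrightarrow> refines (fst j) (fst i) \<and> snd j \<subseteq> snd i"

definition nerve_space :: "'a pointed_cover \<Rightarrow> ('a set \<Rightarrow> real) topology" where
  "nerve_space i = realization (nerve (fst i))"

definition nerve_group :: "'a pointed_cover \<Rightarrow> (real \<Rightarrow> 'a set \<Rightarrow> real) set monoid" where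
  "nerve_group i = fundamental_group (nerve_space i) (vertex_point (snd i))"

definition vertex_assignment ::
  "'a pointed_cover \<Rightarrow> 'a pointed_cover \<Rightarrow> ('a set \<Rightarrow> 'a set) \<Rightarrow> bool" where
  "vertex_assignment i j \<tau> \<longleftrightarrow>
     (\<forall>V\<in>fst j. \<tau> V \<in> fst i \<and> V \<subseteq> \<tau> V) \<and> \<tau> (snd j) = snd i"

text \<open>
  The homomorphism from the group of the finer pointed cover \<open>j\<close> to that of the coarser one \<open>i\<close>.
  All vertex assignments induce the same homomorphism, so an arbitrary one is chosen; likewise for
  canonical maps below.
\<close>

definition bonding_hom ::
  "'a pointed_cover \<Rightarrow> 'a pointed_cover \<Rightarrow>
     (real \<Rightarrow> 'a set \<Rightarrow> real) set \<Rightarrow> (real \<Rightarrow> 'a set \<Rightarrow> real) set" where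
  "bonding_hom i j =
     induced_hom (nerve_space i) (realization_map (SOME \<tau>. vertex_assignment i j \<tau>))"

definition shape_group ::
  "'a topology \<Rightarrow> 'a \<Rightarrow> ('a pointed_cover \<Rightarrow> (real \<Rightarrow> 'a set \<Rightarrow> real) set) monoid" where
  "shape_group X x0 = (product_group (shape_index X x0) nerve_group)
     \<lparr>carrier := {c \<in> (\<Pi>\<^sub>E i\<in>shape_index X x0. carrier (nerve_group i)).
        \<forall>i\<in>shape_index X x0. \<forall>j\<in>shape_index X x0.
          pointed_refines j i \<longrightarrow> bonding_hom i j (c j) = c i}\<rparr>"

definition canonical_map ::
  "'a topology \<Rightarrow> 'a \<Rightarrow> 'a pointed_cover \<Rightarrow> ('a \<Rightarrow> 'a set \<Rightarrow> real) \<Rightarrow> bool" where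
  "canonical_map X x0 i p \<longleftrightarrow>
     continuous_map X (nerve_space i) p \<and> p x0 = vertex_point (snd i) \<and>
     (\<forall>U\<in>fst i. {x \<in> topspace X. p x \<in> open_star (nerve (fst i)) U} \<subseteq> U)"

definition shape_hom ::
  "'a topology \<Rightarrow> 'a \<Rightarrow>
     (real \<Rightarrow> 'a) set \<Rightarrow> 'a pointed_cover \<Rightarrow> (real \<Rightarrow> 'a set \<Rightarrow> real) set" where
  "shape_hom X x0 c =
     (\<lambda>i\<in>shape_index X x0. induced_hom (nerve_space i) (SOME p. canonical_map X x0 i p) c)"

definition shape_group_topology ::
  "'a topology \<Rightarrow> 'a \<Rightarrow> ('a pointed_cover \<Rightarrow> (real \<Rightarrow> 'a set \<Rightarrow> real) set) topology" where
  "shape_group_topology X x0 =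
     subtopology
       (product_topology (\<lambda>i. discrete_topology (carrier (nerve_group i))) (shape_index X x0))
       (carrier (shape_group X x0))"

definition shape_topology :: "'a topology \<Rightarrow> 'a \<Rightarrow> (real \<Rightarrow> 'a) set topology" where
  "shape_topology X x0 =
     pullback_topology (carrier (fundamental_group X x0)) (shape_hom X x0)
       (shape_group_topology X x0)"


section \<open>Neighborhood bases\<close>

text \<open>
  Unlike the library's \<open>neighbourhood_base_at\<close>, every member of the family is required to be a
  neighborhood of the point.  Neighborhoods need not be open.
\<close>

definition neighborhood_base :: "'a topology \<Rightarrow> 'a \<Rightarrow> 'a set set \<Rightarrow> bool" where
  "neighborhood_base T x \<B> \<longleftrightarrow>
     (\<forall>N\<in>\<B>. N \<subseteq> topspace T \<and> (\<exists>W. openin T W \<and> x \<in> W \<and> W \<subseteq> N)) \<and>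
     (\<forall>W. openin T W \<and> x \<in> W \<longrightarrow> (\<exists>N\<in>\<B>. N \<subseteq> W))"

end

theory Submission
  imports Defs
begin

text \<open>
  A canonical map \<open>p\<close> sends a point into the open star of a vertex only if the point lies in the
  corresponding member of the cover. If the members of \<open>\<V>\<close> are path connected, the paths from
  \<open>x0\<close> modulo the thick Spanier group of \<open>\<V>\<close> form a covering space of \<open>X\<close> whose sheets over the
  members of \<open>\<V>\<close> are glued consistently over the simplices of the nerve: two members that meet have
  matching sheets because a generator may use two members of the cover. A null homotopy of
  \<open>p \<circ> \<alpha>\<close> can therefore be followed sheet by sheet over a fine grid, which shows that the class of
  \<open>\<alpha>\<close> lies in the thick Spanier group. Paracompactness puts such covers, refining any given cover,
  into the index set of the shape group.

  Conversely, two stars of the barycentric subdivision that meet lie in a common open star of the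
  original complex, and loops in an open star are null homotopic. So the generators belonging to the
  preimages of these stars under \<open>p\<close> die in the fundamental group of the nerve.
\<close>

section \<open>Path homotopy in abstract topological spaces\<close>

text \<open>The covering space is never built. A path from \<open>x0\<close> stands for a point of
  it, \<open>spanier_rel\<close> for equality of points, and a path ending in a member
  \<open>V\<close> of the cover for the sheet over \<open>V\<close> through that point. Lifting a
  homotopy becomes a finite combinatorial argument about the relation \<open>linked\<close>. Two
  path connected members of a cover may meet in points that are not joined inside their
  intersection. Going from one such point to another through \<open>V\<close> and back through
  \<open>V'\<close> is exactly a pair \<open>\<gamma>1\<close>, \<open>\<gamma>2\<close> of a
  generator. This is why the thick groups, and not groups built from loops in single members, fit
  the nerve, whose edges ignore how two members meet. On the nerve the obstacle is the weak
  topology: coordinatewise continuity gives continuity once finitely many vertices are involved.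
  Compactness provides this for paths, local finiteness for canonical maps. As the shape topology
  comes from a product of discrete groups, the comparison is reduced to kernels of single
  coordinates.\<close>

definition path_homotopic :: "'a topology \<Rightarrow> (real \<Rightarrow> 'a) \<Rightarrow> (real \<Rightarrow> 'a) \<Rightarrow> bool" where
  "path_homotopic X p q \<longleftrightarrow>
     homotopic_with (\<lambda>r. r 0 = p 0 \<and> r 1 = p 1) (top_of_set {0..1}) X p q"

lemma path_class_alt: "path_class X p = {q. path_homotopic X p q}"
  by (simp add: path_class_def path_homotopic_def)

lemma path_homotopic_imp_pathin:
  assumes "path_homotopic X p q"
  shows "pathin X p" "pathin X q"
  using homotopic_with_imp_continuous_maps assms
  unfolding path_homotopic_def pathin_def by blast+

lemma path_homotopic_imp_endpoints:
  assumes "path_homotopic X p q"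
  shows "q 0 = p 0" "q 1 = p 1"
  using homotopic_with_imp_property[OF assms[unfolded path_homotopic_def]] by auto

lemma path_homotopic_refl [simp]: "path_homotopic X p p \<longleftrightarrow> pathin X p"
  by (simp add: path_homotopic_def pathin_def)

lemma path_homotopic_sym: "path_homotopic X p q \<Longrightarrow> path_homotopic X q p"
  using path_homotopic_imp_endpoints[of X p q]
  by (simp add: path_homotopic_def homotopic_with_sym)

lemma path_homotopic_trans [trans]:
  "path_homotopic X p q \<Longrightarrow> path_homotopic X q r \<Longrightarrow> path_homotopic X p r"
  using path_homotopic_imp_endpoints[of X p q]
  unfolding path_homotopic_def by (auto intro: homotopic_with_trans)

lemma path_class_eq_iff:
  assumes "pathin X p"
  shows "path_class X p = path_class X q \<longleftrightarrow> path_homotopic X p q"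
proof
  assume "path_class X p = path_class X q"
  moreover have "p \<in> path_class X p"
    using assms by (simp add: path_class_alt)
  ultimately show "path_homotopic X p q"
    by (auto simp: path_class_alt intro: path_homotopic_sym)
qed (auto simp: path_class_alt intro: path_homotopic_sym path_homotopic_trans)

lemma path_homotopic_imp_class_eq: "path_homotopic X p q \<Longrightarrow> path_class X p = path_class X q"
  by (metis path_class_eq_iff path_homotopic_imp_pathin(1))

lemma path_homotopic_homotopyI:
  fixes h :: "real \<times> real \<Rightarrow> 'a"
  assumes h: "continuous_map (prod_topology (top_of_set {0..1}) (top_of_set {0..1})) X h"
    and 0: "\<And>t. 0 \<le> t \<Longrightarrow> t \<le> 1 \<Longrightarrow> h (0, t) = p t"
    and 1: "\<And>t. 0 \<le> t \<Longrightarrow> t \<le> 1 \<Longrightarrow> h (1, t) = q t"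
    and e: "\<And>s. 0 \<le> s \<Longrightarrow> s \<le> 1 \<Longrightarrow> h (s, 0) = p 0 \<and> h (s, 1) = p 1"
  shows "path_homotopic X p q"
  unfolding path_homotopic_def
\<comment> \<open>The rule \<open>homotopic_with\<close> relaxes the equations with \<open>p\<close>
  and \<open>q\<close> from all reals to the unit interval. Its side condition, that the endpoint
  property depends only on values in the interval, is left to the closing
  \<open>force\<close>.\<close>
proof (subst homotopic_with)
  show "\<exists>h::real \<times> real \<Rightarrow> 'a. continuous_map (prod_topology (top_of_set {0..1}) (top_of_set {0..1})) X h \<and>
      (\<forall>x\<in>topspace (top_of_set {0..1}). h (0, x) = p x) \<and>
      (\<forall>x\<in>topspace (top_of_set {0..1}). h (1, x) = q x) \<and>
      (\<forall>t\<in>{0..1}. h (t, 0) = p 0 \<and> h (t, 1) = p 1)"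
    using assms by (intro exI[of _ h] conjI) auto
qed force

lemma path_homotopic_homotopyE:
  fixes X :: "'a topology"
  assumes "path_homotopic X p q"
  obtains h :: "real \<times> real \<Rightarrow> 'a" where
    "continuous_map (prod_topology (top_of_set {0..1}) (top_of_set {0..1})) X h"
    "\<And>t. h (0, t) = p t" "\<And>t. h (1, t) = q t"
    "\<And>s. 0 \<le> s \<Longrightarrow> s \<le> 1 \<Longrightarrow> h (s, 0) = p 0 \<and> h (s, 1) = p 1"
  using assms unfolding path_homotopic_def homotopic_with_def by force

text \<open>The unit interval is convex, so the straight-line homotopy from \<open>u\<close> to
  \<open>v\<close> stays inside it and is fixed at the endpoints; \<open>p\<close> carries it to
  \<open>X\<close>.\<close>

lemma path_homotopic_reparametrize:
  assumes p: "pathin X p" and u: "continuous_on {0..1} u" "u ` {0..1} \<subseteq> {0..1}"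
    and v: "continuous_on {0..1} v" "v ` {0..1} \<subseteq> {0..1}" and e: "u 0 = v 0" "u 1 = v 1"
  shows "path_homotopic X (p \<circ> u) (p \<circ> v)"
proof (rule path_homotopic_homotopyI)
  let ?w = "\<lambda>(s::real, t). (1 - s) * u t + s * v t"
  have "?w (s, t) \<in> {0..1}" if "s \<in> {0..1}" "t \<in> {0..1}" for s t
  proof -
    have "u t \<in> {0..1}" "v t \<in> {0..1}"
      using u(2) v(2) that by blast+
    then show ?thesis
      using convexD[OF convex_real_interval(5), of "u t" 0 1 "v t" "1 - s" s] that by auto
  qed
  moreover have "continuous_on ({0..1} \<times> {0..1}) ?w"
    unfolding case_prod_beta
    by (intro continuous_intros continuous_on_compose2[OF u(1)] continuous_on_compose2[OF v(1)]) auto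
  ultimately have "continuous_map (prod_topology (top_of_set {0..1}) (top_of_set {0..1}))
      (top_of_set {0..1}) ?w"
    unfolding prod_topology_subtopology_eu continuous_map_subtopology_eu by auto
  then show "continuous_map (prod_topology (top_of_set {0..1}) (top_of_set {0..1})) X (p \<circ> ?w)"
    using continuous_map_compose p unfolding pathin_def by blast
qed (use e in \<open>auto simp: algebra_simps\<close>)

lemma path_homotopic_compose:
  assumes "path_homotopic X p q" "continuous_map X Y f"
  shows "path_homotopic Y (f \<circ> p) (f \<circ> q)"
  using homotopic_with_compose_continuous_map_left[OF assms(1)[unfolded path_homotopic_def] assms(2)]
  unfolding path_homotopic_def by force

text \<open>The parameter space \<open>Z\<close> makes one gluing argument serve for whole families
  of paths. With \<open>Z\<close> the unit interval it joins two homotopies, and joining two paths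
  is then the case of constant homotopies.\<close>

lemma continuous_map_path_join:
  assumes f: "continuous_map (prod_topology Z (top_of_set {0..1})) X (\<lambda>(z, t). f z t)"
    and g: "continuous_map (prod_topology Z (top_of_set {0..1})) X (\<lambda>(z, t). g z t)"
    and fg: "\<And>z. z \<in> topspace Z \<Longrightarrow> f z 1 = g z 0"
  shows "continuous_map (prod_topology Z (top_of_set {0..1::real})) X (\<lambda>(z, t). (f z \<star> g z) t)"
proof -
  let ?ZI = "prod_topology Z (top_of_set {0..1::real})"
  have snd: "continuous_map ?ZI euclideanreal snd"
    using continuous_map_snd[of Z "top_of_set {0..1::real}"] continuous_map_in_subtopology by blast
  have lo: "continuous_map (subtopology ?ZI {x \<in> topspace ?ZI. snd x \<le> 1/2}) X (\<lambda>x. f (fst x) (2 * snd x))"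
  proof -
    have "continuous_map (subtopology ?ZI {x \<in> topspace ?ZI. snd x \<le> 1/2}) ?ZI (\<lambda>x. (fst x, 2 * snd x))"
      unfolding continuous_map_pairwise comp_def fst_conv snd_conv
    proof
      show "continuous_map (subtopology ?ZI {x \<in> topspace ?ZI. snd x \<le> 1/2}) (top_of_set {0..1}) (\<lambda>x. 2 * snd x)"
        unfolding continuous_map_in_subtopology using snd
        by (auto intro!: continuous_map_real_mult continuous_map_from_subtopology)
    qed (intro continuous_map_from_subtopology continuous_map_fst)
    from continuous_map_compose[OF this f] show ?thesis by (simp add: comp_def)
  qed
  have hi: "continuous_map (subtopology ?ZI {x \<in> topspace ?ZI. 1/2 \<le> snd x}) X (\<lambda>x. g (fst x) (2 * snd x - 1))"
  proof -
    have "continuous_map (subtopology ?ZI {x \<in> topspace ?ZI. 1/2 \<le> snd x}) ?ZI (\<lambda>x. (fst x, 2 * snd x - 1))"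
      unfolding continuous_map_pairwise comp_def fst_conv snd_conv
    proof
      show "continuous_map (subtopology ?ZI {x \<in> topspace ?ZI. 1/2 \<le> snd x}) (top_of_set {0..1}) (\<lambda>x. 2 * snd x - 1)"
        unfolding continuous_map_in_subtopology using snd
        by (auto intro!: continuous_map_diff continuous_map_real_mult continuous_map_from_subtopology)
    qed (intro continuous_map_from_subtopology continuous_map_fst)
    from continuous_map_compose[OF this g] show ?thesis by (simp add: comp_def)
  qed
  have "continuous_map ?ZI X (\<lambda>x. if snd x \<le> 1/2 then f (fst x) (2 * snd x) else g (fst x) (2 * snd x - 1))"
  proof (rule continuous_map_cases_le[OF snd _ lo hi])
    show "f (fst x) (2 * snd x) = g (fst x) (2 * snd x - 1)" if "x \<in> topspace ?ZI" "snd x = 1/2" for x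
    proof -
      have "2 * snd x = 1"
        using that by simp
      then show ?thesis
        using fg[of "fst x"] that(1) by (simp only: \<open>2 * snd x = 1\<close>) (simp add: mem_Times_iff)
    qed
  qed auto
  moreover have "(\<lambda>(z, t). (f z \<star> g z) t) =
      (\<lambda>x. if snd x \<le> 1/2 then f (fst x) (2 * snd x) else g (fst x) (2 * snd x - 1))"
    by (auto simp: path_join_def)
  ultimately show ?thesis
    by (simp only:)
qed

lemma path_homotopic_join:
  fixes X :: "'a topology"
  assumes "path_homotopic X p p'" "path_homotopic X q q'" "p 1 = q 0"
  shows "path_homotopic X (p \<star> q) (p' \<star> q')"
proof -
  obtain h :: "real \<times> real \<Rightarrow> 'a" where h: "continuous_map (prod_topology (top_of_set {0..1}) (top_of_set {0..1})) X h"
    "\<And>t. h (0, t) = p t" "\<And>t. h (1, t) = p' t"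
    "\<And>s. 0 \<le> s \<Longrightarrow> s \<le> 1 \<Longrightarrow> h (s, 0) = p 0 \<and> h (s, 1) = p 1"
    using path_homotopic_homotopyE[OF assms(1)] by metis
  obtain k :: "real \<times> real \<Rightarrow> 'a" where k: "continuous_map (prod_topology (top_of_set {0..1}) (top_of_set {0..1})) X k"
    "\<And>t. k (0, t) = q t" "\<And>t. k (1, t) = q' t"
    "\<And>s. 0 \<le> s \<Longrightarrow> s \<le> 1 \<Longrightarrow> k (s, 0) = q 0 \<and> k (s, 1) = q 1"
    using path_homotopic_homotopyE[OF assms(2)] by metis
  have "continuous_map (prod_topology (top_of_set {0..1}) (top_of_set {0..1})) X
      (\<lambda>(s, t). ((\<lambda>t. h (s, t)) \<star> (\<lambda>t. k (s, t))) t)"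
    using h k assms(3) by (intro continuous_map_path_join) auto
  then show ?thesis
    by (rule path_homotopic_homotopyI) (use h k assms in \<open>auto simp: path_join_def\<close>)
qed

lemma path_join_endpoints [simp]: "(p \<star> q) 0 = p 0" "(p \<star> q) 1 = q 1"
  by (auto simp: path_join_def)

lemma path_reverse_endpoints [simp]: "path_reverse p 0 = p 1" "path_reverse p 1 = p 0"
  by (auto simp: path_reverse_def)

lemma pathin_join: "pathin X p \<Longrightarrow> pathin X q \<Longrightarrow> p 1 = q 0 \<Longrightarrow> pathin X (p \<star> q)"
  using path_homotopic_join[of X p p q q] by simp

lemma pathin_reparametrize:
  assumes "pathin X p" "continuous_on {0..1} u" "u ` {0..1} \<subseteq> {0..1}"
  shows "pathin X (p \<circ> u)"
  using path_homotopic_reparametrize[OF assms assms(2,3)] by simp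

lemma pathin_reverse:
  assumes "pathin X p" shows "pathin X (path_reverse p)"
proof -
  have "path_reverse p = p \<circ> (\<lambda>t. 1 - t)"
    by (auto simp: path_reverse_def)
  then show ?thesis
    using pathin_reparametrize[OF assms, of "\<lambda>t. 1 - t"]
    by (simp add: continuous_on_diff image_subset_iff)
qed

lemma comp_path_join: "f \<circ> (p \<star> q) = (f \<circ> p) \<star> (f \<circ> q)"
  by (auto simp: path_join_def)

lemma comp_path_reverse: "f \<circ> path_reverse p = path_reverse (f \<circ> p)"
  by (auto simp: path_reverse_def)

lemma path_reverse_reverse [simp]: "path_reverse (path_reverse p) = p"
  by (auto simp: path_reverse_def)

lemma path_reverse_join: "p 1 = q 0 \<Longrightarrow> path_reverse (p \<star> q) = path_reverse q \<star> path_reverse p"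
  by (auto simp: path_reverse_def path_join_def fun_eq_iff field_simps)

text \<open>The groupoid laws below are all reparametrizations: each side is one path composed with
  self-maps of the unit interval that agree at the endpoints.\<close>

lemma path_homotopic_reparametrize_id:
  assumes p: "pathin X p" and u: "continuous_on {0..1} u" "u ` {0..1} \<subseteq> {0..1}"
    and e: "u 0 = 0" "u 1 = 1"
  shows "path_homotopic X (p \<circ> u) p"
  using path_homotopic_reparametrize[OF p u, of "\<lambda>t. t"] e by (auto simp: comp_def)

lemma continuous_on_path_join:
  fixes u v :: "real \<Rightarrow> real"
  assumes "continuous_on {0..1} u" "continuous_on {0..1} v" "u 1 = v 0"
  shows "continuous_on {0..1} (u \<star> v)"
  using pathin_join[of euclideanreal u v] assms by (simp add: pathin_def)

lemma path_join_image:
  assumes "u ` {0..1} \<subseteq> S" "v ` {0..1} \<subseteq> S"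
  shows "(u \<star> v) ` {0..1} \<subseteq> S"
  using assms by (auto simp: path_join_def image_subset_iff)

lemma path_homotopic_assoc:
  assumes "pathin X p" "pathin X q" "pathin X r" "p 1 = q 0" "q 1 = r 0"
  shows "path_homotopic X ((p \<star> q) \<star> r) (p \<star> (q \<star> r))"
proof -
  \<comment> \<open>The path \<open>p \<star> (q \<star> r)\<close> changes its piece at 1/2 and
    3/4, while \<open>?P\<close> does so at 1/4 and 1/2. The map \<open>?u\<close> sends the first
    three intervals affinely onto the second three.\<close>
  let ?u = "(\<lambda>t. t / 4) \<star> ((\<lambda>t. (1 + t) / 4) \<star> (\<lambda>t. (1 + t) / 2))"
  let ?P = "(p \<star> q) \<star> r"
  have P: "pathin X ?P"
    using assms by (intro pathin_join) auto
  have "path_homotopic X (?P \<circ> ?u) ?P"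
    by (rule path_homotopic_reparametrize_id[OF P])
       ((intro continuous_on_path_join continuous_intros; simp), (intro path_join_image; auto), simp_all)
  moreover have "?P \<circ> ?u = p \<star> (q \<star> r)"
  proof
    fix t :: real
    show "(?P \<circ> ?u) t = (p \<star> (q \<star> r)) t"
      by (auto simp: path_join_def diff_divide_distrib)
  qed
  ultimately show ?thesis
    using path_homotopic_sym by fastforce
qed

lemma path_homotopic_join_const:
  assumes "pathin X p"
  shows "path_homotopic X (p \<star> (\<lambda>_. p 1)) p" "path_homotopic X ((\<lambda>_. p 0) \<star> p) p"
proof -
  have "path_homotopic X (p \<circ> ((\<lambda>t. t) \<star> (\<lambda>_. 1))) p"
    by (rule path_homotopic_reparametrize_id[OF assms])
       ((intro continuous_on_path_join continuous_intros; simp), (intro path_join_image; auto), simp_all)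
  then show "path_homotopic X (p \<star> (\<lambda>_. p 1)) p"
    by (simp only: comp_path_join) (simp add: comp_def)
  have "path_homotopic X (p \<circ> ((\<lambda>_. 0) \<star> (\<lambda>t. t))) p"
    by (rule path_homotopic_reparametrize_id[OF assms])
       ((intro continuous_on_path_join continuous_intros; simp), (intro path_join_image; auto), simp_all)
  then show "path_homotopic X ((\<lambda>_. p 0) \<star> p) p"
    by (simp only: comp_path_join) (simp add: comp_def)
qed

lemma path_homotopic_join_reverse:
  assumes "pathin X p"
  shows "path_homotopic X (p \<star> path_reverse p) (\<lambda>_. p 0)"
proof -
  have "path_homotopic X (p \<circ> ((\<lambda>t. t) \<star> (\<lambda>t. 1 - t))) (p \<circ> (\<lambda>_. 0))"
  proof (rule path_homotopic_reparametrize[OF assms])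
    show "continuous_on {0..1} ((\<lambda>t::real. t) \<star> (\<lambda>t. 1 - t))"
      by (intro continuous_on_path_join continuous_intros; simp)
    show "((\<lambda>t::real. t) \<star> (\<lambda>t. 1 - t)) ` {0..1} \<subseteq> {0..1}"
      by (intro path_join_image; auto)
  qed auto
  moreover have "p \<circ> (\<lambda>t. t) = p" "p \<circ> (\<lambda>t. 1 - t) = path_reverse p" "p \<circ> (\<lambda>_::real. 0) = (\<lambda>_. p 0)"
    by (auto simp: path_reverse_def)
  ultimately show ?thesis
    unfolding comp_path_join by argo
qed

lemma path_homotopic_reverse_join:
  assumes "pathin X p"
  shows "path_homotopic X (path_reverse p \<star> p) (\<lambda>_. p 1)"
  using path_homotopic_join_reverse[OF pathin_reverse[OF assms]] by simp

lemma path_homotopic_cancel: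
  assumes "pathin X p" "pathin X q" "p 1 = q 0"
  shows "path_homotopic X ((p \<star> q) \<star> path_reverse q) p"
    and "path_homotopic X (path_reverse p \<star> (p \<star> q)) q"
proof -
  note q' = pathin_reverse[OF assms(2)] and p' = pathin_reverse[OF assms(1)]
  have "path_homotopic X ((p \<star> q) \<star> path_reverse q) (p \<star> (q \<star> path_reverse q))"
    by (rule path_homotopic_assoc) (use assms q' in auto)
  also have "path_homotopic X \<dots> (p \<star> (\<lambda>_. q 0))"
    by (rule path_homotopic_join) (use assms path_homotopic_join_reverse in auto)
  also have "path_homotopic X \<dots> p"
    using path_homotopic_join_const[OF assms(1)] assms(3) by simp
  finally show "path_homotopic X ((p \<star> q) \<star> path_reverse q) p" .
  have "path_homotopic X (path_reverse p \<star> (p \<star> q)) ((path_reverse p \<star> p) \<star> q)"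
    by (rule path_homotopic_sym, rule path_homotopic_assoc) (use assms p' in auto)
  also have "path_homotopic X \<dots> ((\<lambda>_. p 1) \<star> q)"
    by (rule path_homotopic_join) (use assms path_homotopic_reverse_join[of X p] in auto)
  also have "path_homotopic X \<dots> q"
    using path_homotopic_join_const[OF assms(2)] assms(3) by simp
  finally show "path_homotopic X (path_reverse p \<star> (p \<star> q)) q" .
qed

lemma pathin_imp_topspace: "pathin X p \<Longrightarrow> 0 \<le> t \<Longrightarrow> t \<le> 1 \<Longrightarrow> p t \<in> topspace X"
  by (auto simp: pathin_def continuous_map_def)

lemma pathin_subtopology_iff: "pathin (subtopology X U) p \<longleftrightarrow> pathin X p \<and> p ` {0..1} \<subseteq> U"
  by (auto simp: pathin_def continuous_map_in_subtopology)

section \<open>The fundamental group and induced homomorphisms\<close>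

lemma loop_at_join: "loop_at X x0 p \<Longrightarrow> loop_at X x0 q \<Longrightarrow> loop_at X x0 (p \<star> q)"
  by (auto simp: loop_at_def intro: pathin_join)

lemma loop_at_reverse: "loop_at X x0 p \<Longrightarrow> loop_at X x0 (path_reverse p)"
  by (auto simp: loop_at_def intro: pathin_reverse)

lemma loop_at_const: "x0 \<in> topspace X \<Longrightarrow> loop_at X x0 (\<lambda>_. x0)"
  by (auto simp: loop_at_def)

lemma path_class_in_fundamental_group:
  "loop_at X x0 p \<Longrightarrow> path_class X p \<in> carrier (fundamental_group X x0)"
  by (auto simp: fundamental_group_def)

lemma fundamental_group_cases:
  assumes "c \<in> carrier (fundamental_group X x0)"
  obtains p where "loop_at X x0 p" "c = path_class X p"
  using assms by (auto simp: fundamental_group_def)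

text \<open>The product is a union over all representatives; every set in it is the same class and
  the index sets are nonempty, so the union collapses. The multiplication never refers to
  \<open>x0\<close>, hence the rule also covers composable paths that are not loops.\<close>

lemma mult_fundamental_group:
  fixes X :: "'a topology"
  assumes "pathin X p" "pathin X q" "p 1 = q 0"
  shows "path_class X p \<otimes>\<^bsub>fundamental_group X x0\<^esub> path_class X q = path_class X (p \<star> q)"
proof -
  have "path_class X (p' \<star> q') = path_class X (p \<star> q)"
    if "p' \<in> path_class X p" "q' \<in> path_class X q" for p' q'
  proof (rule path_homotopic_imp_class_eq[symmetric], rule path_homotopic_join)
  qed (use that assms(3) in \<open>auto simp: path_class_alt\<close>)
  moreover have "p \<in> path_class X p" "q \<in> path_class X q"
    using assms by (auto simp: path_class_alt)
  moreover have "(\<Union>p'\<in>C. \<Union>q'\<in>D. f p' q') = E"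
    if "\<And>p' q'. p' \<in> C \<Longrightarrow> q' \<in> D \<Longrightarrow> f p' q' = E" "r \<in> C" "s \<in> D"
    for C D E r s and f :: "(real \<Rightarrow> 'a) \<Rightarrow> (real \<Rightarrow> 'a) \<Rightarrow> (real \<Rightarrow> 'a) set"
  proof -
    have "(\<Union>p'\<in>C. \<Union>q'\<in>D. f p' q') = (\<Union>p'\<in>C. \<Union>q'\<in>D. E)"
      by (intro SUP_cong refl that(1))
    also have "\<dots> = E"
      using that(2,3) by blast
    finally show ?thesis .
  qed
  ultimately show ?thesis
    unfolding fundamental_group_def monoid.simps by blast
qed

lemma one_fundamental_group: "\<one>\<^bsub>fundamental_group X x0\<^esub> = path_class X (\<lambda>_. x0)"
  by (simp add: fundamental_group_def)

lemma group_fundamental_group: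
  assumes "x0 \<in> topspace X"
  shows "group (fundamental_group X x0)"
proof (rule groupI)
  let ?G = "fundamental_group X x0"
  show "\<one>\<^bsub>?G\<^esub> \<in> carrier ?G"
    unfolding one_fundamental_group
    using assms by (intro path_class_in_fundamental_group loop_at_const)
  fix a assume "a \<in> carrier ?G"
  then obtain p where p: "loop_at X x0 p" "a = path_class X p"
    by (rule fundamental_group_cases)
  then have p': "pathin X p" "p 0 = x0" "p 1 = x0"
    by (auto simp: loop_at_def)
  show "\<one>\<^bsub>?G\<^esub> \<otimes>\<^bsub>?G\<^esub> a = a"
    using p p' assms path_homotopic_join_const(2)[of X p]
    by (simp add: one_fundamental_group mult_fundamental_group path_homotopic_imp_class_eq)
  show "\<exists>y\<in>carrier ?G. y \<otimes>\<^bsub>?G\<^esub> a = \<one>\<^bsub>?G\<^esub>"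
    using p p' path_homotopic_reverse_join[of X p]
    by (intro bexI[of _ "path_class X (path_reverse p)"])
       (auto simp: one_fundamental_group mult_fundamental_group path_homotopic_imp_class_eq pathin_reverse
         intro!: path_class_in_fundamental_group loop_at_reverse)
  fix b assume "b \<in> carrier ?G"
  then obtain q where q: "loop_at X x0 q" "b = path_class X q"
    by (rule fundamental_group_cases)
  then have q': "pathin X q" "q 0 = x0" "q 1 = x0"
    by (auto simp: loop_at_def)
  show "a \<otimes>\<^bsub>?G\<^esub> b \<in> carrier ?G"
    using p q p' q' by (auto simp: mult_fundamental_group intro!: path_class_in_fundamental_group loop_at_join)
  fix c assume "c \<in> carrier ?G"
  then obtain r where r: "loop_at X x0 r" "c = path_class X r"
    by (rule fundamental_group_cases)
  then have r': "pathin X r" "r 0 = x0" "r 1 = x0"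
    by (auto simp: loop_at_def)
  show "a \<otimes>\<^bsub>?G\<^esub> b \<otimes>\<^bsub>?G\<^esub> c = a \<otimes>\<^bsub>?G\<^esub> (b \<otimes>\<^bsub>?G\<^esub> c)"
    using p' q' r' by (simp add: p q r mult_fundamental_group pathin_join path_homotopic_imp_class_eq
        path_homotopic_assoc)
qed

lemma inv_fundamental_group:
  assumes "loop_at X x0 p"
  shows "inv\<^bsub>fundamental_group X x0\<^esub> path_class X p = path_class X (path_reverse p)"
proof -
  have p: "pathin X p" "p 0 = x0" "p 1 = x0"
    using assms by (auto simp: loop_at_def)
  interpret group "fundamental_group X x0"
    using group_fundamental_group pathin_imp_topspace[OF p(1), of 0] p by simp
  show ?thesis
    by (rule inv_equality)
       (use p assms path_homotopic_reverse_join[of X p] in \<open>auto simp: one_fundamental_group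
         mult_fundamental_group path_homotopic_imp_class_eq pathin_reverse
         intro!: path_class_in_fundamental_group loop_at_reverse\<close>)
qed

lemma induced_hom_path_class:
  assumes f: "continuous_map X Y f" and p: "pathin X p"
  shows "induced_hom Y f (path_class X p) = path_class Y (f \<circ> p)"
proof -
  have "path_class Y (f \<circ> q) = path_class Y (f \<circ> p)" if "q \<in> path_class X p" for q
    using that path_homotopic_compose[OF _ f] by (metis mem_Collect_eq path_class_alt path_homotopic_imp_class_eq)
  moreover have "p \<in> path_class X p"
    using p by (auto simp: path_class_alt)
  ultimately show ?thesis
    unfolding induced_hom_def by blast
qed

lemma induced_hom_hom:
  assumes f: "continuous_map X Y f"
  shows "induced_hom Y f \<in> hom (fundamental_group X x0) (fundamental_group Y (f x0))"
proof (rule homI)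
  fix a assume "a \<in> carrier (fundamental_group X x0)"
  then obtain p where p: "loop_at X x0 p" "a = path_class X p"
    by (rule fundamental_group_cases)
  have fp: "pathin Y (f \<circ> p)"
    using p f by (auto simp: loop_at_def intro: pathin_compose)
  then show "induced_hom Y f a \<in> carrier (fundamental_group Y (f x0))"
    using p f by (auto simp: induced_hom_path_class loop_at_def intro!: path_class_in_fundamental_group)
  fix b assume "b \<in> carrier (fundamental_group X x0)"
  then obtain q where q: "loop_at X x0 q" "b = path_class X q"
    by (rule fundamental_group_cases)
  have fq: "pathin Y (f \<circ> q)"
    using q f by (auto simp: loop_at_def intro: pathin_compose)
  have "pathin X (p \<star> q)"
    using loop_at_join[OF p(1) q(1)] by (simp add: loop_at_def)
  then show "induced_hom Y f (a \<otimes>\<^bsub>fundamental_group X x0\<^esub> b)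
      = induced_hom Y f a \<otimes>\<^bsub>fundamental_group Y (f x0)\<^esub> induced_hom Y f b"
    using p q f fp fq by (auto simp: loop_at_def mult_fundamental_group induced_hom_path_class comp_path_join)
qed

section \<open>Maps into geometric realizations\<close>

definition abstract_complex :: "'v set set \<Rightarrow> bool" where
  "abstract_complex K \<longleftrightarrow>
     (\<forall>\<sigma>\<in>K. finite \<sigma> \<and> \<sigma> \<noteq> {} \<and> (\<forall>\<tau>. \<tau> \<subseteq> \<sigma> \<and> \<tau> \<noteq> {} \<longrightarrow> \<tau> \<in> K))"

abbreviation supp :: "('v \<Rightarrow> real) \<Rightarrow> 'v set" where
  "supp f \<equiv> {v. f v \<noteq> 0}"

lemma abstract_complexD:
  assumes "abstract_complex K" "\<sigma> \<in> K"
  shows "finite \<sigma>" "\<sigma> \<noteq> {}" "\<tau> \<subseteq> \<sigma> \<Longrightarrow> \<tau> \<noteq> {} \<Longrightarrow> \<tau> \<in> K"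
  using assms unfolding abstract_complex_def by blast+

lemma abstract_complex_nerve: "abstract_complex (nerve \<U>)"
  unfolding abstract_complex_def
proof (intro ballI conjI allI impI)
  fix \<sigma> \<tau> assume \<sigma>: "\<sigma> \<in> nerve \<U>" and \<tau>: "\<tau> \<subseteq> \<sigma> \<and> \<tau> \<noteq> {}"
  then have "\<Inter>\<sigma> \<subseteq> \<Inter>\<tau>" "finite \<tau>"
    by (auto simp: nerve_def intro: finite_subset)
  then show "\<tau> \<in> nerve \<U>"
    using \<sigma> \<tau> unfolding nerve_def by blast
qed (auto simp: nerve_def)

lemma closed_simplex_supp:
  assumes "f \<in> closed_simplex \<sigma>"
  shows "supp f \<subseteq> \<sigma>"
  using assms by (auto simp: closed_simplex_def)

lemma closed_simplex_iff:
  assumes "finite \<sigma>"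
  shows "f \<in> closed_simplex \<sigma> \<longleftrightarrow> (\<forall>v. 0 \<le> f v) \<and> supp f \<subseteq> \<sigma> \<and> sum f (supp f) = 1"
proof -
  have "sum f (supp f) = sum f \<sigma>" if "supp f \<subseteq> \<sigma>"
    using that assms by (intro sum.mono_neutral_left) auto
  moreover have "supp f \<subseteq> \<sigma> \<longleftrightarrow> (\<forall>v. v \<notin> \<sigma> \<longrightarrow> f v = 0)"
    by blast
  ultimately show ?thesis
    unfolding closed_simplex_def mem_Collect_eq by metis
qed

text \<open>The support of a point is a nonempty face of any simplex containing the point, since an
  empty sum cannot be 1. Complexes are closed under nonempty faces, so each point has a canonical
  smallest simplex, and membership no longer mentions a chosen one.\<close>

lemma in_realization_iff:
  assumes "abstract_complex K"
  shows "f \<in> topspace (realization K) \<longleftrightarrow> (\<forall>v. 0 \<le> f v) \<and> supp f \<in> K \<and> sum f (supp f) = 1"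
proof
  assume "f \<in> topspace (realization K)"
  then obtain \<sigma> where \<sigma>: "\<sigma> \<in> K" "f \<in> closed_simplex \<sigma>"
    by (auto simp: topspace_realization)
  then have fin: "finite \<sigma>"
    using assms abstract_complexD(1) by blast
  with \<sigma> have f: "(\<forall>v. 0 \<le> f v) \<and> supp f \<subseteq> \<sigma> \<and> sum f (supp f) = 1"
    by (simp add: closed_simplex_iff)
  then have "supp f \<noteq> {}"
    by (metis sum.empty zero_neq_one)
  then show "(\<forall>v. 0 \<le> f v) \<and> supp f \<in> K \<and> sum f (supp f) = 1"
    using f \<sigma> assms unfolding abstract_complex_def by blast
next
  assume f: "(\<forall>v. 0 \<le> f v) \<and> supp f \<in> K \<and> sum f (supp f) = 1"
  then have "f \<in> closed_simplex (supp f)"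
    using closed_simplex_iff[OF abstract_complexD(1)[OF assms]] by blast
  then show "f \<in> topspace (realization K)"
    using f unfolding topspace_realization by blast
qed

lemma closed_simplex_iff_realization:
  assumes "abstract_complex K" "\<sigma> \<in> K"
  shows "f \<in> closed_simplex \<sigma> \<longleftrightarrow> f \<in> topspace (realization K) \<and> supp f \<subseteq> \<sigma>"
proof
  assume f: "f \<in> closed_simplex \<sigma>"
  then show "f \<in> topspace (realization K) \<and> supp f \<subseteq> \<sigma>"
    using assms closed_simplex_supp[OF f] unfolding topspace_realization by blast
next
  assume "f \<in> topspace (realization K) \<and> supp f \<subseteq> \<sigma>"
  then show "f \<in> closed_simplex \<sigma>"
    using in_realization_iff[OF assms(1)] closed_simplex_iff[OF abstract_complexD(1)[OF assms]] by blast
qed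

lemma in_closed_simplex_supp:
  assumes "abstract_complex K" "f \<in> topspace (realization K)"
  shows "f \<in> closed_simplex (supp f)"
  using assms closed_simplex_iff_realization[OF assms(1)] in_realization_iff[OF assms(1)] by blast

lemma closed_simplex_convex:
  assumes "f \<in> closed_simplex \<sigma>" "g \<in> closed_simplex \<sigma>" "0 \<le> s" "s \<le> 1"
  shows "(\<lambda>v. (1 - s) * f v + s * g v) \<in> closed_simplex \<sigma>"
proof -
  have "(\<Sum>v\<in>\<sigma>. (1 - s) * f v + s * g v) = (1 - s) * sum f \<sigma> + s * sum g \<sigma>"
    by (simp only: sum.distrib sum_distrib_left)
  then show ?thesis
    using assms by (simp add: closed_simplex_def)
qed

lemma vertex_point_in_closed_simplex:
  assumes "finite \<sigma>" "a \<in> \<sigma>" shows "vertex_point a \<in> closed_simplex \<sigma>"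
  using assms by (auto simp: closed_simplex_def vertex_point_def)

lemma continuous_on_coordinate [continuous_intros]:
  "continuous_on S (\<lambda>f :: 'v \<Rightarrow> real. f v)"
  by (rule continuous_on_subset[OF continuous_on_product_coordinates subset_UNIV])

lemma closed_finite_function_set:
  assumes "finite (S :: ('v \<Rightarrow> real) set)" shows "closed S"
proof -
  have "{f} = (\<Inter>v. {g. g v = f v})" for f :: "'v \<Rightarrow> real"
    by auto
  moreover have "closed (\<Inter>v. {g. g v = f v})" for f :: "'v \<Rightarrow> real"
    by (intro closed_INT ballI closed_Collect_eq continuous_intros)
  ultimately have "closed (\<Union>f\<in>S. {f})"
    using assms by (intro closed_UN) auto
  then show ?thesis by simp
qed

lemma closed_closed_simplex: "closed (closed_simplex \<sigma> :: ('v \<Rightarrow> real) set)"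
proof -
  have "closed_simplex \<sigma> = (\<Inter>v. {f. 0 \<le> f v}) \<inter> (\<Inter>v\<in>- \<sigma>. {f. f v = 0}) \<inter> {f. sum f \<sigma> = (1::real)}"
    by (auto simp: closed_simplex_def)
  moreover have "closed \<dots>"
    by (intro closed_Int closed_INT ballI closed_Collect_le closed_Collect_eq continuous_intros)
  ultimately show ?thesis by simp
qed

section \<open>Continuity with respect to the weak topology\<close>

lemma continuous_map_from_realization:
  assumes "\<And>\<sigma>. \<sigma> \<in> K \<Longrightarrow> continuous_map (top_of_set (closed_simplex \<sigma>)) Y g"
  shows "continuous_map (realization K) Y g"
  unfolding continuous_map_def
proof (intro conjI allI impI)
  show "g \<in> topspace (realization K) \<rightarrow> topspace Y"
    using assms unfolding topspace_realization continuous_map_def by fastforce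
  fix U assume U: "openin Y U"
  show "openin (realization K) {x \<in> topspace (realization K). g x \<in> U}"
    unfolding openin_realization
  proof (intro conjI ballI)
    fix \<sigma> assume \<sigma>: "\<sigma> \<in> K"
    have "openin (top_of_set (closed_simplex \<sigma>)) {x \<in> closed_simplex \<sigma>. g x \<in> U}"
      using openin_continuous_map_preimage[OF assms[OF \<sigma>] U] by simp
    moreover have "{x \<in> topspace (realization K). g x \<in> U} \<inter> closed_simplex \<sigma> = {x \<in> closed_simplex \<sigma>. g x \<in> U}"
      using \<sigma> by (auto simp: topspace_realization)
    ultimately show "openin (top_of_set (closed_simplex \<sigma>))
        ({x \<in> topspace (realization K). g x \<in> U} \<inter> closed_simplex \<sigma>)"
      by simp
  qed (auto simp: topspace_realization)
qed

lemma continuous_map_realization_coordinate: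
  "continuous_map (realization K) euclideanreal (\<lambda>f. f v)"
  by (rule continuous_map_from_realization) (auto intro: continuous_intros)

lemma closedin_realization:
  "closedin (realization K) C \<longleftrightarrow> C \<subseteq> topspace (realization K) \<and>
     (\<forall>\<sigma>\<in>K. closed (C \<inter> closed_simplex \<sigma>))"
proof -
  have "openin (top_of_set (closed_simplex \<sigma>)) ((topspace (realization K) - C) \<inter> closed_simplex \<sigma>)
      \<longleftrightarrow> closed (C \<inter> closed_simplex \<sigma>)" if "\<sigma> \<in> K" for \<sigma>
  proof -
    have "(topspace (realization K) - C) \<inter> closed_simplex \<sigma> = closed_simplex \<sigma> - C \<inter> closed_simplex \<sigma>"
      using that by (auto simp: topspace_realization)
    moreover have "openin (top_of_set (closed_simplex \<sigma>)) (closed_simplex \<sigma> - C \<inter> closed_simplex \<sigma>)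
        \<longleftrightarrow> closedin (top_of_set (closed_simplex \<sigma>)) (C \<inter> closed_simplex \<sigma>)"
      by (simp add: closedin_def)
    ultimately show ?thesis
      by (simp add: closed_closed_simplex closedin_closed_eq)
  qed
  moreover have "closedin (realization K) C \<longleftrightarrow> C \<subseteq> topspace (realization K) \<and>
      openin (realization K) (topspace (realization K) - C)"
    by (simp add: closedin_def)
  ultimately show ?thesis
    by (auto simp: openin_realization topspace_realization)
qed

text \<open>If all supports lie in a finite \<open>A\<close>, the values lie in finitely many closed
  simplices. The preimage of a closed \<open>C\<close> is then a finite union of preimages of the
  sets \<open>C \<inter> closed_simplex \<sigma>\<close>, which are closed already in the product
  topology, where coordinates decide continuity.\<close>

lemma continuous_map_into_realization:
  assumes K: "abstract_complex K" and A: "finite A"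
    and c: "\<And>v. v \<in> A \<Longrightarrow> continuous_map Z euclideanreal (\<lambda>z. h z v)"
    and h: "\<And>z. z \<in> topspace Z \<Longrightarrow> h z \<in> topspace (realization K) \<and> supp (h z) \<subseteq> A"
  shows "continuous_map Z (realization K) h"
  unfolding continuous_map_closedin
proof (intro conjI allI impI)
  show "h \<in> topspace Z \<rightarrow> topspace (realization K)"
    using h by blast
  fix C assume C: "closedin (realization K) C"
  have "continuous_map Z euclideanreal (\<lambda>z. h z v)" for v
  proof (cases "v \<in> A")
    case False
    then have "h z v = 0" if "z \<in> topspace Z" for z
      using h[OF that] by blast
    then show ?thesis
      by (intro continuous_map_eq[OF continuous_map_const[of Z euclideanreal 0, THEN iffD2]]) simp_all
  qed (use c in auto)
  then have eu: "continuous_map Z euclidean h"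
    unfolding euclidean_product_topology[symmetric] continuous_map_componentwise_UNIV by simp
  have "{x \<in> topspace Z. h x \<in> C} = (\<Union>\<sigma>\<in>K \<inter> Pow A. {x \<in> topspace Z. h x \<in> C \<inter> closed_simplex \<sigma>})"
  proof (intro equalityI subsetI)
    fix x assume x: "x \<in> {x \<in> topspace Z. h x \<in> C}"
    then have "h x \<in> closed_simplex (supp (h x))" "supp (h x) \<in> K" "supp (h x) \<subseteq> A"
      using h K in_closed_simplex_supp in_realization_iff by blast+
    then show "x \<in> (\<Union>\<sigma>\<in>K \<inter> Pow A. {x \<in> topspace Z. h x \<in> C \<inter> closed_simplex \<sigma>})"
      using x by blast
  qed auto
  moreover have "closedin Z (\<Union>\<sigma>\<in>K \<inter> Pow A. {x \<in> topspace Z. h x \<in> C \<inter> closed_simplex \<sigma>})"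
  proof (intro closedin_Union finite_imageI finite_Int disjI2)
    fix S assume "S \<in> (\<lambda>\<sigma>. {x \<in> topspace Z. h x \<in> C \<inter> closed_simplex \<sigma>}) ` (K \<inter> Pow A)"
    then obtain \<sigma> where "\<sigma> \<in> K" and S: "S = {x \<in> topspace Z. h x \<in> C \<inter> closed_simplex \<sigma>}"
      by blast
    then have "closedin euclidean (C \<inter> closed_simplex \<sigma>)"
      using C by (simp add: closedin_realization)
    then show "closedin Z S"
      unfolding S by (rule closedin_continuous_map_preimage[OF eu])
  qed (use A in auto)
  ultimately show "closedin Z {x \<in> topspace Z. h x \<in> C}"
    by simp
qed

text \<open>Pick one point of \<open>D\<close> for every support that occurs. A closed simplex
  contains at most one picked point for each of its faces, so every set of picked points is closed.
  The picked points thus form a closed discrete subset of a compact set and are finite in number,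
  and so are the supports.\<close>

lemma compactin_realization_finite_support:
  assumes K: "abstract_complex K" and D: "compactin (realization K) D"
  shows "finite (\<Union>f\<in>D. supp f)"
proof -
  have DK: "D \<subseteq> topspace (realization K)"
    using D compactin_subset_topspace by blast
  define g where "g s = (SOME f. f \<in> D \<and> supp f = s)" for s
  have g: "g (supp f) \<in> D \<and> supp (g (supp f)) = supp f" if "f \<in> D" for f
    unfolding g_def by (rule someI2[of _ f]) (use that in auto)
  define P where "P = (\<lambda>f. g (supp f)) ` D"
  have closed: "closedin (realization K) Q" if "Q \<subseteq> P" for Q
    unfolding closedin_realization
  proof (intro conjI ballI)
    show "Q \<subseteq> topspace (realization K)"
      using that g DK unfolding P_def by blast
    fix \<sigma> assume \<sigma>: "\<sigma> \<in> K"
    have "Q \<inter> closed_simplex \<sigma> \<subseteq> g ` Pow \<sigma>"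
    proof
      fix q assume q: "q \<in> Q \<inter> closed_simplex \<sigma>"
      then obtain f where f: "f \<in> D" "q = g (supp f)"
        using \<open>Q \<subseteq> P\<close> unfolding P_def by blast
      then have "supp f = supp q"
        using g by auto
      then show "q \<in> g ` Pow \<sigma>"
        using f q closed_simplex_supp by blast
    qed
    then have "finite (Q \<inter> closed_simplex \<sigma>)"
      using \<sigma> K by (meson abstract_complex_def finite_Pow_iff finite_imageI finite_subset)
    then show "closed (Q \<inter> closed_simplex \<sigma>)"
      by (rule closed_finite_function_set)
  qed
  have "finite P"
  proof -
    have "P \<subseteq> D"
      using g unfolding P_def by blast
    then have cP: "compactin (realization K) P"
      using D closed by (metis closed_compactin order_refl)
    \<comment> \<open>For \<open>x\<close> in \<open>P\<close> this open set contains no other point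
      of \<open>P\<close>, so a finite subcover leaves \<open>P\<close> finite.\<close>
    have "openin (realization K) (topspace (realization K) - (P - {x}))" for x
      using closed[of "P - {x}"] by blast
    moreover have "P \<subseteq> (\<Union>x\<in>P. topspace (realization K) - (P - {x}))"
      using \<open>P \<subseteq> D\<close> DK by blast
    ultimately obtain \<F> where \<F>: "finite \<F>" "\<F> \<subseteq> (\<lambda>x. topspace (realization K) - (P - {x})) ` P" "P \<subseteq> \<Union>\<F>"
      using cP unfolding compactin_def by (metis (no_types, lifting) imageE)
    then obtain F where F: "finite F" "F \<subseteq> P" "\<F> = (\<lambda>x. topspace (realization K) - (P - {x})) ` F"
      by (meson finite_subset_image)
    have "P \<subseteq> F"
      using \<F>(3) unfolding F(3) by blast
    then show ?thesis
      using F finite_subset by blast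
  qed
  moreover have "(\<Union>f\<in>D. supp f) \<subseteq> (\<Union>f\<in>P. supp f)"
    using g unfolding P_def by fastforce
  moreover have "finite (supp f)" if "f \<in> P" for f
  proof -
    have "f \<in> topspace (realization K)"
      using that g DK unfolding P_def by blast
    then show ?thesis
      using K in_realization_iff by (metis abstract_complex_def)
  qed
  ultimately show ?thesis
    by (meson finite_UN_I finite_subset)
qed

lemma pathin_realization_finite_support:
  assumes "abstract_complex K" "pathin (realization K) p"
  obtains A where "finite A" "\<And>t. 0 \<le> t \<Longrightarrow> t \<le> 1 \<Longrightarrow> supp (p t) \<subseteq> A"
proof
  show "finite (\<Union>f\<in>p ` {0..1}. supp f)"
  proof (rule compactin_realization_finite_support[OF assms(1)])
    show "compactin (realization K) (p ` {0..1})"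
      using assms(2) unfolding pathin_def
      by (rule image_compactin[rotated]) (simp add: compactin_subtopology)
  qed
qed auto

lemma pathin_realization_coordinate:
  assumes "pathin (realization K) p"
  shows "continuous_on {0..1} (\<lambda>t. p t v)"
  using continuous_map_compose[OF assms[unfolded pathin_def] continuous_map_realization_coordinate[of K v]]
  by (simp add: comp_def)

lemma pathin_realizationI:
  assumes "abstract_complex K" "finite A"
    and "\<And>v. v \<in> A \<Longrightarrow> continuous_on {0..1} (\<lambda>t. p t v)"
    and "\<And>t. 0 \<le> t \<Longrightarrow> t \<le> 1 \<Longrightarrow> p t \<in> topspace (realization K) \<and> supp (p t) \<subseteq> A"
  shows "pathin (realization K) p"
  unfolding pathin_def by (rule continuous_map_into_realization[OF assms(1,2)]) (use assms(3,4) in auto)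

text \<open>A simplex containing both \<open>p t\<close> and \<open>q t\<close>, which may vary with
  \<open>t\<close>, contains the segment between them. Both paths have finite total support, so the
  linear homotopy involves finitely many vertices and is continuous for the weak topology.\<close>

lemma path_homotopic_linear:
  assumes K: "abstract_complex K" and p: "pathin (realization K) p" and q: "pathin (realization K) q"
    and e: "p 0 = q 0" "p 1 = q 1"
    and \<sigma>: "\<And>t. 0 \<le> t \<Longrightarrow> t \<le> 1 \<Longrightarrow> \<exists>\<sigma>\<in>K. p t \<in> closed_simplex \<sigma> \<and> q t \<in> closed_simplex \<sigma>"
  shows "path_homotopic (realization K) p q"
proof -
  obtain A where A: "finite A" "\<And>t. 0 \<le> t \<Longrightarrow> t \<le> 1 \<Longrightarrow> supp (p t) \<subseteq> A"
    using pathin_realization_finite_support[OF K p] by metis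
  obtain B where B: "finite B" "\<And>t. 0 \<le> t \<Longrightarrow> t \<le> 1 \<Longrightarrow> supp (q t) \<subseteq> B"
    using pathin_realization_finite_support[OF K q] by metis
  let ?h = "\<lambda>(s, t) v. (1 - s) * p t v + s * q t v"
  have "continuous_map (top_of_set ({0..1} \<times> {0..1})) (realization K) ?h"
  proof (rule continuous_map_into_realization[OF K, of "A \<union> B"])
    fix v
    have "continuous_on ({0..1} \<times> {0..1}) (\<lambda>z. (1 - fst z) * p (snd z) v + fst z * q (snd z) v)"
      by (intro continuous_intros continuous_on_compose2[OF pathin_realization_coordinate[OF p]]
          continuous_on_compose2[OF pathin_realization_coordinate[OF q]]) auto
    then show "continuous_map (top_of_set ({0..1} \<times> {0..1})) euclideanreal (\<lambda>z. ?h z v)"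
      by (simp add: case_prod_unfold)
  next
    fix z :: "real \<times> real" assume "z \<in> topspace (top_of_set ({0..1} \<times> {0..1}))"
    then obtain s t where z: "z = (s, t)" and st: "0 \<le> s" "s \<le> 1" "0 \<le> t" "t \<le> 1"
      by auto
    obtain \<rho> where \<rho>: "\<rho> \<in> K" "p t \<in> closed_simplex \<rho>" "q t \<in> closed_simplex \<rho>"
      using \<sigma> st by blast
    then have "?h z \<in> closed_simplex \<rho>"
      using closed_simplex_convex st z by simp
    moreover have "v \<in> supp (p t) \<union> supp (q t)" if "v \<in> supp (?h z)" for v
      using that z by auto
    then have "supp (?h z) \<subseteq> A \<union> B"
      using A(2) B(2) st by blast
    ultimately show "?h z \<in> topspace (realization K) \<and> supp (?h z) \<subseteq> A \<union> B"
      using \<rho> K closed_simplex_iff_realization by blast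
  qed (use A B in auto)
  then show ?thesis
    by (intro path_homotopic_homotopyI[where h = ?h]) (auto simp: e algebra_simps)
qed

text \<open>A loop in the star of \<open>a\<close> is slowed down so that it rests at its endpoint during the first
  and the last third; it can then be pushed linearly to the path running from the endpoint straight
  to the vertex \<open>a\<close> and back.\<close>

lemma path_homotopic_const_open_star:
  assumes K: "abstract_complex K" and p: "pathin (realization K) p" and e: "p 1 = p 0"
    and star: "\<And>t. 0 \<le> t \<Longrightarrow> t \<le> 1 \<Longrightarrow> p t \<in> open_star K a"
  shows "path_homotopic (realization K) p (\<lambda>_. p 0)"
proof -
  \<comment> \<open>The parameter \<open>\<tau>\<close> moves only in the middle third, and
    \<open>m\<close>, the weight given to the vertex \<open>a\<close>, is 1 there; \<open>m\<close>
    rises from 0 in the first third and falls back to 0 in the last.\<close>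
  define \<tau> m where "\<tau> t = max 0 (min 1 (3 * t - 1))" and "m t = min 1 (min (3 * t) (3 - 3 * t))" for t :: real
  have \<tau>: "continuous_on {0..1} \<tau>" "\<tau> ` {0..1} \<subseteq> {0..1}" "\<tau> 0 = 0" "\<tau> 1 = 1"
    unfolding \<tau>_def by (auto intro!: continuous_intros)
  have m: "continuous_on {0..1} m" "m 0 = 0" "m 1 = 0" "\<And>t. 0 \<le> t \<Longrightarrow> t \<le> 1 \<Longrightarrow> 0 \<le> m t \<and> m t \<le> 1"
    unfolding m_def by (auto intro!: continuous_intros)
  define q where "q t = (\<lambda>v. (1 - m t) * (p \<circ> \<tau>) t v + m t * vertex_point a v)" for t
  have \<tau>t: "0 \<le> \<tau> t \<and> \<tau> t \<le> 1" if "0 \<le> t" "t \<le> 1" for t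
    using \<tau>(2) that by (simp add: image_subset_iff)
  have star': "f \<in> topspace (realization K)" "supp f \<in> K" "f \<in> closed_simplex (supp f)"
    "vertex_point a \<in> closed_simplex (supp f)" if "f \<in> open_star K a" for f
  proof -
    have f: "f \<in> topspace (realization K)" "a \<in> supp f"
      using that by (auto simp: open_star_def)
    then have "supp f \<in> K" "finite (supp f)"
      using K in_realization_iff unfolding abstract_complex_def by blast+
    then show "supp f \<in> K" "vertex_point a \<in> closed_simplex (supp f)"
      using vertex_point_in_closed_simplex[OF _ f(2)] by auto
    show "f \<in> topspace (realization K)" "f \<in> closed_simplex (supp f)"
      by (fact f(1)) (fact in_closed_simplex_supp[OF K f(1)])
  qed
  have qs: "q t \<in> closed_simplex (supp ((p \<circ> \<tau>) t))" if "0 \<le> t" "t \<le> 1" for t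
    unfolding q_def using star'[OF star] \<tau>t[OF that] m(4)[OF that]
    by (intro closed_simplex_convex) auto
  have pp: "path_homotopic (realization K) p (p \<circ> \<tau>)"
    using path_homotopic_reparametrize_id[OF p \<tau>] path_homotopic_sym by blast
  then have p\<tau>: "pathin (realization K) (p \<circ> \<tau>)"
    using path_homotopic_imp_pathin by blast
  obtain A where A: "finite A" "\<And>t. 0 \<le> t \<Longrightarrow> t \<le> 1 \<Longrightarrow> supp ((p \<circ> \<tau>) t) \<subseteq> A"
    using pathin_realization_finite_support[OF K p\<tau>] by metis
  have q: "pathin (realization K) q"
  proof (rule pathin_realizationI[OF K A(1)])
    show "continuous_on {0..1} (\<lambda>t. q t v)" for v
      unfolding q_def
      by (intro continuous_intros m pathin_realization_coordinate[OF p\<tau>])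
    show "q t \<in> topspace (realization K) \<and> supp (q t) \<subseteq> A" if "0 \<le> t" "t \<le> 1" for t
      using closed_simplex_supp[OF qs[OF that]] A(2)[OF that] qs[OF that] star'(2)[OF star] \<tau>t[OF that]
        closed_simplex_iff_realization[OF K] by (metis comp_apply subset_trans)
  qed
  have "path_homotopic (realization K) (p \<circ> \<tau>) q"
  proof (rule path_homotopic_linear[OF K p\<tau> q])
    show "\<exists>\<sigma>\<in>K. (p \<circ> \<tau>) t \<in> closed_simplex \<sigma> \<and> q t \<in> closed_simplex \<sigma>" if "0 \<le> t" "t \<le> 1" for t
      using qs[OF that] star'(2,3)[OF star] \<tau>t[OF that] by (intro bexI[of _ "supp ((p \<circ> \<tau>) t)"]) auto
  qed (auto simp: q_def m)
  also have "path_homotopic (realization K) q (\<lambda>_. p 0)"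
  proof (rule path_homotopic_linear[OF K q])
    show "pathin (realization K) (\<lambda>_. p 0)"
      using star'(1)[OF star] by simp
    show "\<exists>\<sigma>\<in>K. q t \<in> closed_simplex \<sigma> \<and> p 0 \<in> closed_simplex \<sigma>" if "0 \<le> t" "t \<le> 1" for t
    proof (intro bexI[of _ "supp (p 0)"] conjI)
      \<comment> \<open>Off the middle third the slowed path rests at \<open>p 0\<close> or at
        \<open>p 1\<close>, which are equal; on it, its weight in \<open>q t\<close> is zero. So
        \<open>q\<close> runs along the segment from \<open>p 0\<close> to \<open>a\<close> and
        back, inside a single simplex.\<close>
      have "m t = 1 \<or> p (\<tau> t) = p 0"
        using e unfolding m_def \<tau>_def by (auto simp: min_def max_def)
      then have "q t = (\<lambda>v. (1 - m t) * p 0 v + m t * vertex_point a v)"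
        by (auto simp: q_def)
      then show "q t \<in> closed_simplex (supp (p 0))"
        using closed_simplex_convex[OF star'(3,4)] star[of 0] m(4)[OF that] by auto
    qed (use star'[OF star] in auto)
  qed (auto simp: q_def m \<tau> e)
  finally show ?thesis
    using pp path_homotopic_trans by blast
qed

section \<open>Open stars of a complex and of its barycentric subdivision\<close>

lemma openin_open_star: "openin (realization K) (open_star K v)"
proof -
  have "openin euclideanreal (- {0})"
    by auto
  from openin_continuous_map_preimage[OF continuous_map_realization_coordinate this] show ?thesis
    by (simp add: open_star_def)
qed

text \<open>The open star, in the barycentric subdivision, of the barycenter of \<open>\<sigma>\<close>.\<close>

definition barycentric_star :: "'v set set \<Rightarrow> 'v set \<Rightarrow> ('v \<Rightarrow> real) set" where
  "barycentric_star K \<sigma> =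
     {f \<in> topspace (realization K). \<forall>v\<in>\<sigma>. 0 < f v \<and> (\<forall>w. w \<notin> \<sigma> \<longrightarrow> f w < f v)}"

lemma openin_barycentric_star:
  assumes K: "abstract_complex K" and "\<sigma> \<in> K"
  shows "openin (realization K) (barycentric_star K \<sigma>)"
  unfolding openin_realization
proof (intro conjI ballI)
  fix \<rho> assume \<rho>: "\<rho> \<in> K"
  \<comment> \<open>On \<open>closed_simplex \<rho>\<close> a coordinate outside
    \<open>\<rho>\<close> is 0, hence below every positive \<open>f v\<close>. Only the finitely
    many inequalities with \<open>w\<close> in \<open>\<rho>\<close> remain, so their solution set
    is open.\<close>
  let ?O = "\<Inter>v\<in>\<sigma>. {f. 0 < f v} \<inter> (\<Inter>w\<in>\<rho> - \<sigma>. {f :: 'a \<Rightarrow> real. f w < f v})"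
  have "finite \<rho>" "finite \<sigma>"
    using \<rho> assms abstract_complexD(1) by blast+
  then have "open ?O"
    by (intro open_INT open_Int ballI open_Collect_less continuous_intros) auto
  moreover have "barycentric_star K \<sigma> \<inter> closed_simplex \<rho> = closed_simplex \<rho> \<inter> ?O"
  proof (intro equalityI subsetI)
    fix f assume f: "f \<in> closed_simplex \<rho> \<inter> ?O"
    have "f w < f v" if "v \<in> \<sigma>" "w \<notin> \<sigma>" for v w
      using f that by (cases "w \<in> \<rho>") (auto simp: closed_simplex_def)
    then show "f \<in> barycentric_star K \<sigma> \<inter> closed_simplex \<rho>"
      using f \<rho> by (auto simp: barycentric_star_def topspace_realization)
  qed (auto simp: barycentric_star_def)
  ultimately show "openin (top_of_set (closed_simplex \<rho>)) (barycentric_star K \<sigma> \<inter> closed_simplex \<rho>)"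
    by (simp add: openin_open_Int)
qed (auto simp: barycentric_star_def topspace_realization)

text \<open>The vertices at which the barycentric coordinates of \<open>f\<close> are maximal span a
  face of \<open>supp f\<close>, and \<open>f\<close> lies in the star of that face.\<close>

lemma realization_covered_by_barycentric_stars:
  assumes K: "abstract_complex K" and f: "f \<in> topspace (realization K)"
  obtains \<sigma> where "\<sigma> \<in> K" "f \<in> barycentric_star K \<sigma>"
proof -
  have s: "supp f \<in> K" "\<And>v. 0 \<le> f v"
    using f K by (auto simp: in_realization_iff)
  then have fin: "finite (supp f)" "supp f \<noteq> {}"
    using K unfolding abstract_complex_def by blast+
  define M where "M = Max (f ` supp f)"
  have M: "f v \<le> M" for v
    using fin s(2) unfolding M_def
    by (metis (mono_tags, lifting) Max_ge ex_in_conv finite_imageI image_eqI mem_Collect_eq order_trans)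
  have "M \<in> f ` supp f"
    unfolding M_def using fin by (intro Max_in) auto
  then obtain v0 where v0: "f v0 = M" "0 < M"
    using s(2) by (auto simp: less_le)
  show thesis
  proof
    have "{v. f v = M} \<subseteq> supp f" "{v. f v = M} \<noteq> {}"
      using v0 by auto
    then show "{v. f v = M} \<in> K"
      using s(1) K unfolding abstract_complex_def by blast
    show "f \<in> barycentric_star K {v. f v = M}"
      using f v0 M by (auto simp: barycentric_star_def less_le)
  qed
qed

text \<open>At a common point a vertex in \<open>\<sigma>\<close> only and a vertex in
  \<open>\<tau>\<close> only would each have the larger coordinate. So the simplices are nested, and
  every vertex of the smaller one has positive coordinate throughout both stars.\<close>

lemma barycentric_stars_subset_open_star:
  assumes K: "abstract_complex K" and "\<sigma> \<in> K" "\<tau> \<in> K"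
    and "f \<in> barycentric_star K \<sigma>" "f \<in> barycentric_star K \<tau>"
  obtains v where "barycentric_star K \<sigma> \<subseteq> open_star K v" "barycentric_star K \<tau> \<subseteq> open_star K v"
proof -
  have "\<sigma> \<subseteq> \<tau> \<or> \<tau> \<subseteq> \<sigma>"
  proof (rule ccontr)
    assume "\<not> ?thesis"
    then obtain a b where "a \<in> \<sigma>" "a \<notin> \<tau>" "b \<in> \<tau>" "b \<notin> \<sigma>"
      by blast
    then have "f a < f b" "f b < f a"
      using assms(4,5) by (auto simp: barycentric_star_def)
    then show False by simp
  qed
  moreover have "\<sigma> \<noteq> {}" "\<tau> \<noteq> {}"
    using assms abstract_complexD(2) by blast+
  ultimately obtain v where "v \<in> \<sigma>" "v \<in> \<tau>"
    by blast
  then show thesis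
    by (intro that[of v]) (auto simp: barycentric_star_def open_star_def)
qed

text \<open>The index set in the definition of \<open>realization_map\<close> varies with
  \<open>f\<close>. On one simplex it may be replaced by a fixed finite set, which makes continuity
  in \<open>f\<close> evident.\<close>

lemma realization_map_closed_simplex:
  assumes "finite \<sigma>" "f \<in> closed_simplex \<sigma>"
  shows "realization_map \<tau> f = (\<lambda>w. \<Sum>v | v \<in> \<sigma> \<and> \<tau> v = w. f v)"
    and "realization_map \<tau> f \<in> closed_simplex (\<tau> ` \<sigma>)"
proof -
  show eq: "realization_map \<tau> f = (\<lambda>w. \<Sum>v | v \<in> \<sigma> \<and> \<tau> v = w. f v)"
    unfolding realization_map_def using assms closed_simplex_supp[OF assms(2)]
    by (intro ext sum.mono_neutral_left) auto
  have "(\<Sum>w\<in>\<tau> ` \<sigma>. \<Sum>v | v \<in> \<sigma> \<and> \<tau> v = w. f v) = sum f \<sigma>"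
    using sum.image_gen[OF assms(1), of f \<tau>] by simp
  moreover have "(\<Sum>v | v \<in> \<sigma> \<and> \<tau> v = w. f v) = 0" if "w \<notin> \<tau> ` \<sigma>" for w
    using that by (intro sum.neutral) auto
  ultimately show "realization_map \<tau> f \<in> closed_simplex (\<tau> ` \<sigma>)"
    unfolding eq using assms by (auto simp: closed_simplex_def intro!: sum_nonneg)
qed

lemma continuous_map_realization_map:
  assumes K: "abstract_complex K" and L: "abstract_complex L"
    and \<tau>: "\<And>\<sigma>. \<sigma> \<in> K \<Longrightarrow> \<tau> ` \<sigma> \<in> L"
  shows "continuous_map (realization K) (realization L) (realization_map \<tau>)"
proof (rule continuous_map_from_realization)
  fix \<sigma> assume \<sigma>: "\<sigma> \<in> K"
  then have fin: "finite \<sigma>"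
    using K abstract_complexD(1) by blast
  show "continuous_map (top_of_set (closed_simplex \<sigma>)) (realization L) (realization_map \<tau>)"
  proof (rule continuous_map_into_realization[OF L, of "\<tau> ` \<sigma>"])
    fix w
    have "continuous_on (closed_simplex \<sigma>) (\<lambda>f. \<Sum>v | v \<in> \<sigma> \<and> \<tau> v = w. f v)"
      by (intro continuous_intros)
    then show "continuous_map (top_of_set (closed_simplex \<sigma>)) euclideanreal (\<lambda>f. realization_map \<tau> f w)"
      by (simp add: realization_map_closed_simplex(1)[OF fin] cong: continuous_on_cong)
  next
    fix f assume "f \<in> topspace (top_of_set (closed_simplex \<sigma>))"
    then have "realization_map \<tau> f \<in> closed_simplex (\<tau> ` \<sigma>)"
      using realization_map_closed_simplex(2)[OF fin] by simp
    then show "realization_map \<tau> f \<in> topspace (realization L) \<and> supp (realization_map \<tau> f) \<subseteq> \<tau> ` \<sigma>"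
      using closed_simplex_iff_realization[OF L \<tau>[OF \<sigma>]] by simp
  qed (use fin in simp)
qed

section \<open>Partitions of unity on paracompact Hausdorff spaces\<close>

text \<open>The common core of regularity and normality: for a locally finite family the closure of
  the union is the union of the closures, so local separations from \<open>B\<close> add up to a
  global one. It is used with \<open>B\<close> a point and then with \<open>B\<close> a closed
  set.\<close>

lemma paracompact_space_separation:
  assumes pc: "paracompact_space X" and C: "closedin X C"
    and sep: "\<And>c. c \<in> C \<Longrightarrow> \<exists>A. openin X A \<and> c \<in> A \<and> X closure_of A \<inter> B = {}"
  obtains D where "openin X D" "C \<subseteq> D" "X closure_of D \<inter> B = {}"
proof -
  \<comment> \<open>The complement of \<open>C\<close> completes the cover. A member of the
    refinement that meets \<open>C\<close> is not contained in it and so lies in one of the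
    separating sets.\<close>
  let ?\<U> = "insert (topspace X - C) {A. openin X A \<and> X closure_of A \<inter> B = {}}"
  have "open_cover X ?\<U>"
    unfolding open_cover_def
  proof (intro conjI ballI equalityI subsetI)
    fix x assume x: "x \<in> topspace X"
    then show "x \<in> \<Union>?\<U>"
      using sep[of x] by (cases "x \<in> C") auto
  qed (use C openin_subset in \<open>auto simp: closedin_def dest: openin_subset\<close>)
  then obtain \<V> where \<V>: "open_cover X \<V>" "refines \<V> ?\<U>" "locally_finite_in X \<V>"
    using pc unfolding paracompact_space_def by blast
  let ?\<D> = "{V \<in> \<V>. V \<inter> C \<noteq> {}}"
  have "X closure_of V \<inter> B = {}" if V: "V \<in> ?\<D>" for V
  proof -
    obtain U where U: "U \<in> ?\<U>" "V \<subseteq> U"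
      using V \<V>(2) unfolding refines_def by (metis (no_types, lifting) mem_Collect_eq)
    moreover have "U \<noteq> topspace X - C"
      using U(2) V by blast
    ultimately have "X closure_of U \<inter> B = {}"
      by simp
    then show ?thesis
      using closure_of_mono[OF U(2), of X] by blast
  qed
  moreover have "X closure_of \<Union>?\<D> = \<Union>((closure_of) X ` ?\<D>)"
    using locally_finite_in_subset[OF \<V>(3)] by (intro closure_of_locally_finite_Union) auto
  ultimately have "X closure_of \<Union>?\<D> \<inter> B = {}"
    by auto
  moreover have "C \<subseteq> \<Union>?\<D>"
    using \<V>(1) closedin_subset[OF C] unfolding open_cover_def by blast
  moreover have "openin X (\<Union>?\<D>)"
    using \<V>(1) by (intro openin_Union) (auto simp: open_cover_def)
  ultimately show thesis
    using that by blast
qed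

lemma paracompact_Hausdorff_imp_regular_space:
  assumes "paracompact_space X" "Hausdorff_space X"
  shows "regular_space X"
  unfolding regular_space_def
proof (intro allI impI, elim conjE)
  fix C a assume C: "closedin X C" and a: "a \<in> topspace X - C"
  have "\<exists>A. openin X A \<and> c \<in> A \<and> X closure_of A \<inter> {a} = {}" if c: "c \<in> C" for c
  proof -
    have "c \<in> topspace X" "c \<noteq> a"
      using closedin_subset[OF C] a c by auto
    then obtain U V where UV: "openin X U" "openin X V" "c \<in> U" "a \<in> V" "disjnt U V"
      using assms(2) a unfolding Hausdorff_space_def by blast
    then have "V \<inter> X closure_of U = {}"
      by (simp add: openin_Int_closure_of_eq_empty disjnt_def Int_commute)
    then show ?thesis
      using UV by blast
  qed
  then obtain D where D: "openin X D" "C \<subseteq> D" "X closure_of D \<inter> {a} = {}"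
    using paracompact_space_separation[OF assms(1) C, of "{a}"] by metis
  show "\<exists>U V. openin X U \<and> openin X V \<and> a \<in> U \<and> C \<subseteq> V \<and> disjnt U V"
  proof (intro exI conjI)
    show "disjnt (topspace X - X closure_of D) D"
      using closure_of_subset[OF openin_subset[OF D(1)]] by (auto simp: disjnt_def)
  qed (use a D in auto)
qed

lemma paracompact_Hausdorff_imp_normal_space:
  assumes "paracompact_space X" "Hausdorff_space X"
  shows "normal_space X"
  unfolding normal_space_def
proof (intro allI impI, elim conjE)
  fix S T assume S: "closedin X S" and T: "closedin X T" and "disjnt S T"
  have "\<exists>A. openin X A \<and> c \<in> A \<and> X closure_of A \<inter> T = {}" if c: "c \<in> S" for c
  proof -
    have "c \<in> topspace X - T"
      using closedin_subset[OF S] c \<open>disjnt S T\<close> by (auto simp: disjnt_def)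
    then obtain U V where UV: "openin X U" "openin X V" "c \<in> U" "T \<subseteq> V" "disjnt U V"
      using paracompact_Hausdorff_imp_regular_space[OF assms] T unfolding regular_space_def by metis
    then have "V \<inter> X closure_of U = {}"
      by (simp add: openin_Int_closure_of_eq_empty disjnt_def Int_commute)
    then show ?thesis
      using UV by blast
  qed
  then obtain D where D: "openin X D" "S \<subseteq> D" "X closure_of D \<inter> T = {}"
    using paracompact_space_separation[OF assms(1) S, of T] by metis
  show "\<exists>U V. openin X U \<and> openin X V \<and> S \<subseteq> U \<and> T \<subseteq> V \<and> disjnt U V"
  proof (intro exI conjI)
    show "disjnt D (topspace X - X closure_of D)"
      using closure_of_subset[OF openin_subset[OF D(1)]] by (auto simp: disjnt_def)
  qed (use closedin_subset[OF T] D in auto)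
qed

lemma regular_space_closure_subset:
  assumes "regular_space X" "openin X U" "x \<in> U"
  obtains N where "openin X N" "x \<in> N" "X closure_of N \<subseteq> U"
proof -
  have "closedin X (topspace X - U)" "x \<in> topspace X - (topspace X - U)"
    using assms openin_subset by auto
  then obtain N V where NV: "openin X N" "openin X V" "x \<in> N" "topspace X - U \<subseteq> V" "disjnt N V"
    using assms(1) unfolding regular_space_def by metis
  then have "V \<inter> X closure_of N = {}"
    by (simp add: openin_Int_closure_of_eq_empty disjnt_def Int_commute)
  then have "X closure_of N \<subseteq> U"
    using NV closure_of_subset_topspace[of X N] by blast
  then show thesis
    by (rule that[OF NV(1,3)])
qed

lemma paracompact_shrinking_refinement:
  assumes pc: "paracompact_space X" and reg: "regular_space X" and \<U>: "open_cover X \<U>"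
  obtains \<W> where "open_cover X \<W>" "locally_finite_in X \<W>" "\<And>W. W \<in> \<W> \<Longrightarrow> \<exists>U\<in>\<U>. X closure_of W \<subseteq> U"
proof -
  let ?\<N> = "{N. openin X N \<and> (\<exists>U\<in>\<U>. X closure_of N \<subseteq> U)}"
  have "open_cover X ?\<N>"
    unfolding open_cover_def
  proof (intro conjI ballI equalityI subsetI)
    fix x assume x: "x \<in> topspace X"
    then obtain U where U: "U \<in> \<U>" "openin X U" "x \<in> U"
      using \<U> unfolding open_cover_def by blast
    obtain N where "openin X N" "x \<in> N" "X closure_of N \<subseteq> U"
      by (rule regular_space_closure_subset[OF reg U(2,3)])
    then show "x \<in> \<Union>?\<N>"
      using U(1) by blast
  qed (auto dest: openin_subset)
  then obtain \<W> where \<W>: "open_cover X \<W>" "refines \<W> ?\<N>" "locally_finite_in X \<W>"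
    using pc unfolding paracompact_space_def by blast
  show thesis
  proof (rule that[OF \<W>(1,3)])
    fix W assume "W \<in> \<W>"
    then obtain N U where "W \<subseteq> N" "U \<in> \<U>" "X closure_of N \<subseteq> U"
      using \<W>(2) unfolding refines_def by blast
    then show "\<exists>U\<in>\<U>. X closure_of W \<subseteq> U"
      using closure_of_mono by (metis order_trans)
  qed
qed

text \<open>Each \<open>f W\<close> vanishes off \<open>W\<close>, so on an open set meeting
  finitely many members the sum may run over just those members. The resulting finite sums are
  continuous and agree on overlaps.\<close>

lemma continuous_map_locally_finite_sum:
  assumes lf: "locally_finite_in X \<W>"
    and c: "\<And>W. W \<in> \<W> \<Longrightarrow> continuous_map X euclideanreal (f W)"
    and z: "\<And>W x. W \<in> \<W> \<Longrightarrow> x \<in> topspace X - W \<Longrightarrow> f W x = 0"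
  shows "continuous_map X euclideanreal (\<lambda>x. \<Sum>W | W \<in> \<W> \<and> x \<in> W. f W x)"
proof -
  define I where "I = {N. openin X N \<and> finite {W \<in> \<W>. W \<inter> N \<noteq> {}}}"
  have eq: "(\<Sum>W | W \<in> \<W> \<and> x \<in> W. f W x) = (\<Sum>W | W \<in> \<W> \<and> W \<inter> N \<noteq> {}. f W x)"
    if "N \<in> I" "x \<in> topspace X \<inter> N" for N x
    using that z unfolding I_def by (intro sum.mono_neutral_left) auto
  show ?thesis
  proof (rule pasting_lemma[of I X "\<lambda>N. N" euclideanreal "\<lambda>N x. \<Sum>W | W \<in> \<W> \<and> W \<inter> N \<noteq> {}. f W x"])
    show "continuous_map (subtopology X N) euclideanreal (\<lambda>x. \<Sum>W | W \<in> \<W> \<and> W \<inter> N \<noteq> {}. f W x)"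
      if "N \<in> I" for N
      using that c unfolding I_def by (intro continuous_map_sum continuous_map_from_subtopology) auto
    show "\<exists>j. j \<in> I \<and> x \<in> j \<and>
        (\<Sum>W | W \<in> \<W> \<and> x \<in> W. f W x) = (\<Sum>W | W \<in> \<W> \<and> W \<inter> j \<noteq> {}. f W x)" if "x \<in> topspace X" for x
    proof -
      obtain N where "N \<in> I" "x \<in> N"
        using lf \<open>x \<in> topspace X\<close> unfolding locally_finite_in_def I_def by blast
      then show ?thesis
        using eq[of N x] that by auto
    qed
    show "(\<Sum>W | W \<in> \<W> \<and> W \<inter> i \<noteq> {}. f W x) = (\<Sum>W | W \<in> \<W> \<and> W \<inter> j \<noteq> {}. f W x)"
      if "i \<in> I" "j \<in> I" "x \<in> topspace X \<inter> i \<inter> j" for i j x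
      using eq[of i x] eq[of j x] that by simp
  qed (simp add: I_def)
qed

text \<open>The cover is shrunk twice. The inner cover \<open>\<W>'\<close> provides closed sets on
  which Urysohn functions are 1, so their sum is positive everywhere; the outer cover
  \<open>\<W>\<close> contains the places where they are nonzero and has closures inside members of
  \<open>\<U>\<close>. Dividing by the sum normalizes the family.\<close>

lemma paracompact_Hausdorff_partition_of_unity:
  assumes pc: "paracompact_space X" and H: "Hausdorff_space X" and \<U>: "open_cover X \<U>"
  obtains \<phi> where "subordinated_partition_of_unity X \<U> \<phi>"
proof -
  note reg = paracompact_Hausdorff_imp_regular_space[OF pc H]
  obtain \<W> where \<W>: "open_cover X \<W>" "locally_finite_in X \<W>" "\<And>W. W \<in> \<W> \<Longrightarrow> \<exists>U\<in>\<U>. X closure_of W \<subseteq> U"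
    using paracompact_shrinking_refinement[OF pc reg \<U>] by metis
  then obtain u where u: "\<And>W. W \<in> \<W> \<Longrightarrow> u W \<in> \<U> \<and> X closure_of W \<subseteq> u W"
    by metis
  obtain \<W>' where \<W>': "open_cover X \<W>'" "locally_finite_in X \<W>'"
    "\<And>W. W \<in> \<W>' \<Longrightarrow> \<exists>U\<in>\<W>. X closure_of W \<subseteq> U"
    using paracompact_shrinking_refinement[OF pc reg \<W>(1)] by metis
  then obtain w where w: "\<And>W. W \<in> \<W>' \<Longrightarrow> w W \<in> \<W> \<and> X closure_of W \<subseteq> w W"
    by metis
  \<comment> \<open>The part of \<open>W\<close> where its Urysohn function will be 1. Local
    finiteness of \<open>\<W>'\<close> makes it closed, and the choice of \<open>w\<close> puts it
    inside \<open>W\<close>.\<close>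
  define F where "F W = \<Union>((closure_of) X ` {W' \<in> \<W>'. w W' = W})" for W
  have "\<exists>f. continuous_map X (top_of_set {0..1::real}) f \<and> f ` (topspace X - W) \<subseteq> {0} \<and> f ` F W \<subseteq> {1}"
    if W: "W \<in> \<W>" for W
  proof -
    have "closedin X (F W)"
      unfolding F_def using locally_finite_in_subset[OF \<W>'(2)]
      by (intro closedin_Union_locally_finite_closure) auto
    moreover have "closedin X (topspace X - W)"
      using \<W>(1) W by (auto simp: open_cover_def)
    moreover have "disjnt (topspace X - W) (F W)"
      using w unfolding F_def disjnt_def by blast
    ultimately show ?thesis
      using Urysohn_lemma[OF paracompact_Hausdorff_imp_normal_space[OF pc H], of "topspace X - W" "F W" 0 1]
      by (metis zero_le_one)
  qed
  then obtain f where f: "\<And>W. W \<in> \<W> \<Longrightarrow>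
      continuous_map X (top_of_set {0..1::real}) (f W) \<and> f W ` (topspace X - W) \<subseteq> {0} \<and> f W ` F W \<subseteq> {1}"
    by metis
  have f0: "f W x = 0" if "W \<in> \<W>" "x \<in> topspace X - W" for W x
    using f that by blast
  have f_nn: "0 \<le> f W x" if "W \<in> \<W>" "x \<in> topspace X" for W x
    using f[OF that(1)] that(2) by (auto simp: continuous_map_in_subtopology)
  have f_cont: "continuous_map X euclideanreal (f W)" if "W \<in> \<W>" for W
    using f[OF that] by (auto simp: continuous_map_in_subtopology)
  have fin: "finite {W \<in> \<W>. x \<in> W}" if x: "x \<in> topspace X" for x
  proof -
    obtain V where "x \<in> V" and V: "finite {U \<in> \<W>. U \<inter> V \<noteq> {}}"
      using \<W>(2) x unfolding locally_finite_in_def by blast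
    then show ?thesis
      by (intro finite_subset[OF _ V]) auto
  qed
  define s where "s x = (\<Sum>W | W \<in> \<W> \<and> x \<in> W. f W x)" for x
  \<comment> \<open>The map \<open>u\<close> need not be injective or onto. Summing over its fibres
    gives a family indexed by \<open>\<U>\<close> itself, with the zero function at members that
    \<open>u\<close> misses.\<close>
  define g where "g U x = (\<Sum>W | W \<in> {W \<in> \<W>. u W = U} \<and> x \<in> W. f W x)" for U x
  have s_cont: "continuous_map X euclideanreal s"
    unfolding s_def using f0 by (intro continuous_map_locally_finite_sum \<W> f_cont) auto
  have g_cont: "continuous_map X euclideanreal (g U)" for U
    unfolding g_def using f0
    by (intro continuous_map_locally_finite_sum locally_finite_in_subset[OF \<W>(2)] f_cont) auto
  have s_pos: "0 < s x" if x: "x \<in> topspace X" for x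
  proof -
    obtain W' where W': "W' \<in> \<W>'" "x \<in> W'" "openin X W'"
      using x \<W>'(1) unfolding open_cover_def by blast
    then have xF: "x \<in> X closure_of W'"
      using closure_of_subset openin_subset by (metis subsetD)
    then have "f (w W') x = 1"
      using f[of "w W'"] w[OF W'(1)] W' unfolding F_def by blast
    moreover have "f (w W') x \<le> s x"
      unfolding s_def using w[OF W'(1)] xF fin[OF x] f_nn x by (intro member_le_sum) auto
    ultimately show ?thesis by simp
  qed
  have g_sum: "(\<Sum>U\<in>u ` {W \<in> \<W>. x \<in> W}. g U x) = s x" if x: "x \<in> topspace X" for x
  proof -
    have "{W. W \<in> {W \<in> \<W>. u W = U} \<and> x \<in> W} = {W \<in> {W \<in> \<W>. x \<in> W}. u W = U}" for U
      by auto
    then show ?thesis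
      unfolding s_def g_def using sum.image_gen[OF fin[OF x], of "\<lambda>W. f W x" u] by simp
  qed
  have g_nn: "0 \<le> g U x" if "x \<in> topspace X" for U x
    unfolding g_def using f_nn that by (intro sum_nonneg) auto
  have g_le: "g U x \<le> s x" if x: "x \<in> topspace X" for U x
    unfolding g_def s_def using f_nn x fin[OF x] by (intro sum_mono2) auto
  have g_supp: "\<exists>W\<in>\<W>. x \<in> W \<and> u W = U" if "g U x \<noteq> 0" for U x
    using that unfolding g_def by (metis (mono_tags, lifting) mem_Collect_eq sum.neutral)
  define \<phi> where "\<phi> U x = g U x / s x" for U x
  have supp: "{x \<in> topspace X. \<phi> U x \<noteq> 0} \<subseteq> \<Union>{W \<in> \<W>. u W = U}" for U
    using g_supp unfolding \<phi>_def by fastforce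
  have "subordinated_partition_of_unity X \<U> \<phi>"
    unfolding subordinated_partition_of_unity_def
  proof (intro conjI ballI)
    fix U assume U: "U \<in> \<U>"
    have "continuous_map X euclideanreal (\<phi> U)"
      unfolding \<phi>_def using s_pos by (intro continuous_map_real_divide g_cont s_cont) force
    moreover have "0 \<le> \<phi> U x \<and> \<phi> U x \<le> 1" if "x \<in> topspace X" for x
      using g_nn[OF that] g_le[OF that] s_pos[OF that] by (simp add: \<phi>_def)
    ultimately show "continuous_map X (top_of_set {0..1}) (\<phi> U)"
      by (auto simp: continuous_map_in_subtopology)
    have "X closure_of {x \<in> topspace X. \<phi> U x \<noteq> 0} \<subseteq> X closure_of \<Union>{W \<in> \<W>. u W = U}"
      by (intro closure_of_mono supp)
    also have "\<dots> = \<Union>((closure_of) X ` {W \<in> \<W>. u W = U})"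
      by (intro closure_of_locally_finite_Union locally_finite_in_subset[OF \<W>(2)]) auto
    also have "\<dots> \<subseteq> U"
      using u by blast
    finally show "X closure_of {x \<in> topspace X. \<phi> U x \<noteq> 0} \<subseteq> U" .
  next
    fix x assume x: "x \<in> topspace X"
    obtain V where V: "openin X V" "x \<in> V" "finite {W \<in> \<W>. W \<inter> V \<noteq> {}}"
      using \<W>(2) x unfolding locally_finite_in_def by blast
    have "{U \<in> \<U>. V \<inter> X closure_of {y \<in> topspace X. \<phi> U y \<noteq> 0} \<noteq> {}} \<subseteq> u ` {W \<in> \<W>. W \<inter> V \<noteq> {}}"
    proof
      fix U assume "U \<in> {U \<in> \<U>. V \<inter> X closure_of {y \<in> topspace X. \<phi> U y \<noteq> 0} \<noteq> {}}"
      then have "V \<inter> {y \<in> topspace X. \<phi> U y \<noteq> 0} \<noteq> {}"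
        using openin_Int_closure_of_eq_empty[OF V(1)] by blast
      then show "U \<in> u ` {W \<in> \<W>. W \<inter> V \<noteq> {}}"
        using supp[of U] by blast
    qed
    then show "\<exists>W. openin X W \<and> x \<in> W \<and>
        finite {U \<in> \<U>. W \<inter> X closure_of {y \<in> topspace X. \<phi> U y \<noteq> 0} \<noteq> {}}"
      using V by (meson finite_imageI finite_subset)
    have "(\<Sum>U | U \<in> \<U> \<and> \<phi> U x \<noteq> 0. \<phi> U x) = (\<Sum>U\<in>u ` {W \<in> \<W>. x \<in> W}. \<phi> U x)"
    proof (rule sum.mono_neutral_left)
      show "{U. U \<in> \<U> \<and> \<phi> U x \<noteq> 0} \<subseteq> u ` {W \<in> \<W>. x \<in> W}"
        using supp x by blast
    qed (use fin[OF x] u in auto)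
    also have "\<dots> = 1"
      unfolding \<phi>_def sum_divide_distrib[symmetric] g_sum[OF x] using s_pos[OF x] by simp
    finally show "(\<Sum>U | U \<in> \<U> \<and> \<phi> U x \<noteq> 0. \<phi> U x) = 1" .
  qed
  then show thesis
    by (rule that)
qed

text \<open>The index set also asks for the value 1 at \<open>x0\<close>. A bump function
  \<open>g\<close> with \<open>g x0 = 1\<close> concentrates the partition there: \<open>g\<close>
  is added to the function of \<open>U0\<close> after all functions have been scaled by
  \<open>1 - g\<close>, so the total stays 1.\<close>

lemma paracompact_Hausdorff_shape_index:
  assumes pc: "paracompact_space X" and H: "Hausdorff_space X" and \<U>: "open_cover X \<U>"
    and U0: "U0 \<in> \<U>" "x0 \<in> U0"
  shows "(\<U>, U0) \<in> shape_index X x0"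
proof -
  obtain \<phi> where \<phi>: "subordinated_partition_of_unity X \<U> \<phi>"
    using paracompact_Hausdorff_partition_of_unity[OF pc H \<U>] .
  have \<phi>_cont: "continuous_map X euclideanreal (\<phi> U)" and \<phi>_range: "\<And>x. x \<in> topspace X \<Longrightarrow> 0 \<le> \<phi> U x \<and> \<phi> U x \<le> 1"
    and \<phi>_clos: "X closure_of {x \<in> topspace X. \<phi> U x \<noteq> 0} \<subseteq> U" if "U \<in> \<U>" for U
    using \<phi> that unfolding subordinated_partition_of_unity_def continuous_map_in_subtopology
    by (force simp: Pi_iff)+
  have oU0: "openin X U0" and x0: "x0 \<in> topspace X"
    using \<U> U0 openin_subset unfolding open_cover_def by auto
  \<comment> \<open>Vanishing off \<open>U0\<close> would not be enough for \<open>g\<close>: the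
    closure of the set where it is nonzero must lie in \<open>U0\<close>. Hence the smaller
    \<open>N\<close>.\<close>
  then obtain N where NX: "openin X N" "x0 \<in> N" and N: "X closure_of N \<subseteq> U0"
    using regular_space_closure_subset[OF paracompact_Hausdorff_imp_regular_space[OF pc H] _ U0(2)] by metis
  have "closedin X {x0}"
    using H x0 by (simp add: closedin_Hausdorff_singleton)
  then obtain g where g: "continuous_map X (top_of_set {0..1::real}) g" "g ` (topspace X - N) \<subseteq> {0}" "g ` {x0} \<subseteq> {1}"
    using Urysohn_lemma[OF paracompact_Hausdorff_imp_normal_space[OF pc H], of "topspace X - N" "{x0}" 0 1] NX
    by (auto simp: disjnt_def)
  then have g_cont: "continuous_map X euclideanreal g" and g_range: "\<And>x. x \<in> topspace X \<Longrightarrow> 0 \<le> g x \<and> g x \<le> 1"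
    by (auto simp: continuous_map_in_subtopology)
  define \<psi> where "\<psi> U x = (if U = U0 then g x else 0) + (1 - g x) * \<phi> U x" for U x
  have supp: "{x \<in> topspace X. \<psi> U x \<noteq> 0} \<subseteq> (if U = U0 then N else {}) \<union> {x \<in> topspace X. \<phi> U x \<noteq> 0}" for U
    using g(2) by (auto simp: \<psi>_def)
  have "subordinated_partition_of_unity X \<U> \<psi>"
    unfolding subordinated_partition_of_unity_def
  proof (intro conjI ballI)
    fix U assume U: "U \<in> \<U>"
    have "continuous_map X euclideanreal (\<psi> U)"
      unfolding \<psi>_def using g_cont \<phi>_cont[OF U]
      by (cases "U = U0") (auto intro!: continuous_map_add continuous_map_real_mult continuous_map_diff)
    moreover have "0 \<le> \<psi> U x \<and> \<psi> U x \<le> 1" if x: "x \<in> topspace X" for x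
    proof -
      have "(1 - g x) * \<phi> U x \<le> (1 - g x) * 1"
        using g_range[OF x] \<phi>_range[OF U x] by (intro mult_left_mono) auto
      then show ?thesis
        using g_range[OF x] \<phi>_range[OF U x] by (auto simp: \<psi>_def)
    qed
    ultimately show "continuous_map X (top_of_set {0..1}) (\<psi> U)"
      by (auto simp: continuous_map_in_subtopology)
    have "X closure_of {x \<in> topspace X. \<psi> U x \<noteq> 0}
        \<subseteq> X closure_of ((if U = U0 then N else {}) \<union> {x \<in> topspace X. \<phi> U x \<noteq> 0})"
      by (intro closure_of_mono supp)
    also have "\<dots> \<subseteq> U"
      using N \<phi>_clos[OF U] by (auto simp: closure_of_Un)
    finally show "X closure_of {x \<in> topspace X. \<psi> U x \<noteq> 0} \<subseteq> U" .
  next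
    fix x assume x: "x \<in> topspace X"
    obtain W where W: "openin X W" "x \<in> W"
      "finite {U \<in> \<U>. W \<inter> X closure_of {y \<in> topspace X. \<phi> U y \<noteq> 0} \<noteq> {}}"
      using \<phi> x unfolding subordinated_partition_of_unity_def by blast
    have "X closure_of {y \<in> topspace X. \<psi> U y \<noteq> 0} \<subseteq> X closure_of {y \<in> topspace X. \<phi> U y \<noteq> 0}"
      if "U \<noteq> U0" for U
      using supp[of U] that by (intro closure_of_mono) auto
    then have "{U \<in> \<U>. W \<inter> X closure_of {y \<in> topspace X. \<psi> U y \<noteq> 0} \<noteq> {}}
        \<subseteq> insert U0 {U \<in> \<U>. W \<inter> X closure_of {y \<in> topspace X. \<phi> U y \<noteq> 0} \<noteq> {}}"
      by blast
    then show "\<exists>W. openin X W \<and> x \<in> W \<and>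
        finite {U \<in> \<U>. W \<inter> X closure_of {y \<in> topspace X. \<psi> U y \<noteq> 0} \<noteq> {}}"
      using W by (meson finite_insert finite_subset)
    have sum1: "(\<Sum>U | U \<in> \<U> \<and> \<phi> U x \<noteq> 0. \<phi> U x) = 1"
      using \<phi> x unfolding subordinated_partition_of_unity_def by blast
    then have fin: "finite {U. U \<in> \<U> \<and> \<phi> U x \<noteq> 0}"
      by (metis sum.infinite zero_neq_one)
    \<comment> \<open>The new function of \<open>U0\<close> can be nonzero where the old one
      vanishes, so \<open>U0\<close> has to be in the range of summation.\<close>
    let ?F = "insert U0 {U. U \<in> \<U> \<and> \<phi> U x \<noteq> 0}"
    have "(\<Sum>U | U \<in> \<U> \<and> \<psi> U x \<noteq> 0. \<psi> U x) = (\<Sum>U\<in>?F. \<psi> U x)"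
      using fin U0 by (intro sum.mono_neutral_left) (auto simp: \<psi>_def split: if_splits)
    also have "\<dots> = (\<Sum>U\<in>?F. if U = U0 then g x else 0) + (1 - g x) * (\<Sum>U\<in>?F. \<phi> U x)"
      by (simp only: \<psi>_def sum.distrib sum_distrib_left)
    also have "(\<Sum>U\<in>?F. if U = U0 then g x else 0) = g x"
      using fin by (subst sum.delta) auto
    also have "(\<Sum>U\<in>?F. \<phi> U x) = (\<Sum>U | U \<in> \<U> \<and> \<phi> U x \<noteq> 0. \<phi> U x)"
      using fin U0 by (intro sum.mono_neutral_right) auto
    finally show "(\<Sum>U | U \<in> \<U> \<and> \<psi> U x \<noteq> 0. \<psi> U x) = 1"
      using sum1 by simp
  qed
  moreover have "\<psi> U0 x0 = 1"
    using g(3) by (simp add: \<psi>_def)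
  ultimately show ?thesis
    using \<U> U0 by (auto simp: shape_index_def)
qed

lemma locally_path_connected_refinement:
  assumes "locally_path_connected_space X" "open_cover X \<U>"
  obtains \<V> where "open_cover X \<V>" "refines \<V> \<U>" "\<And>V. V \<in> \<V> \<Longrightarrow> path_connectedin X V"
proof
  let ?\<V> = "{V. openin X V \<and> path_connectedin X V \<and> (\<exists>U\<in>\<U>. V \<subseteq> U)}"
  show "open_cover X ?\<V>"
    unfolding open_cover_def
  proof (intro conjI ballI equalityI subsetI)
    fix x assume "x \<in> topspace X"
    then obtain U where "U \<in> \<U>" "openin X U" "x \<in> U"
      using assms(2) unfolding open_cover_def by blast
    then show "x \<in> \<Union>?\<V>"
      using assms(1) unfolding locally_path_connected_space by blast
  qed (auto dest: openin_subset)
qed (auto simp: refines_def)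

section \<open>Canonical maps and kernels of the shape topology\<close>

lemma shape_indexD:
  assumes "i \<in> shape_index X x0"
  shows "open_cover X (fst i)" "snd i \<in> fst i" "x0 \<in> snd i"
    "\<exists>\<phi>. subordinated_partition_of_unity X (fst i) \<phi> \<and> \<phi> (snd i) x0 = 1"
  using assms by (auto simp: shape_index_def)

lemma shape_index_imp_topspace:
  assumes "i \<in> shape_index X x0" shows "x0 \<in> topspace X"
  using shape_indexD[OF assms] by (auto simp: open_cover_def)

text \<open>The functions of the partition serve as barycentric coordinates of \<open>p x\<close>.
  The members with nonzero coordinate contain \<open>x\<close>, so they span a simplex of the nerve,
  and local finiteness confines the supports near a point to a finite set of vertices.\<close>

lemma canonical_map_exists:
  assumes i: "i \<in> shape_index X x0"
  shows "\<exists>p. canonical_map X x0 i p"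
proof -
  let ?\<U> = "fst i"
  obtain \<phi> where \<phi>: "subordinated_partition_of_unity X ?\<U> \<phi>" and \<phi>1: "\<phi> (snd i) x0 = 1"
    using shape_indexD(4)[OF i] by blast
  have \<phi>_cont: "continuous_map X euclideanreal (\<phi> U)" and \<phi>_nn: "\<And>x. x \<in> topspace X \<Longrightarrow> 0 \<le> \<phi> U x"
    and \<phi>_clos: "X closure_of {x \<in> topspace X. \<phi> U x \<noteq> 0} \<subseteq> U" if "U \<in> ?\<U>" for U
    using \<phi> that unfolding subordinated_partition_of_unity_def continuous_map_in_subtopology
    by (force simp: Pi_iff)+
  have \<phi>_sum: "(\<Sum>U | U \<in> ?\<U> \<and> \<phi> U x \<noteq> 0. \<phi> U x) = 1" if "x \<in> topspace X" for x
    using \<phi> that unfolding subordinated_partition_of_unity_def by blast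
  define p where "p x = (\<lambda>U. if U \<in> ?\<U> then \<phi> U x else 0)" for x
  have supp: "supp (p x) = {U. U \<in> ?\<U> \<and> \<phi> U x \<noteq> 0}" for x
    by (auto simp: p_def)
  have p_sum: "sum (p x) (supp (p x)) = 1" if "x \<in> topspace X" for x
    using \<phi>_sum[OF that] unfolding supp by (simp add: p_def)
  have nerve: "supp (p x) \<in> nerve ?\<U>" and inter: "\<And>U. U \<in> supp (p x) \<Longrightarrow> x \<in> U" if x: "x \<in> topspace X" for x
  proof -
    show *: "x \<in> U" if "U \<in> supp (p x)" for U
    proof -
      have "U \<in> ?\<U>" "x \<in> {x \<in> topspace X. \<phi> U x \<noteq> 0}"
        using that x unfolding supp by auto
      then show ?thesis
        using \<phi>_clos[of U] closure_of_subset[of "{x \<in> topspace X. \<phi> U x \<noteq> 0}" X] by blast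
    qed
    have "finite (supp (p x))" "supp (p x) \<noteq> {}"
      using p_sum[OF x] by (metis sum.infinite zero_neq_one, metis sum.empty zero_neq_one)
    moreover have "supp (p x) \<subseteq> ?\<U>" "x \<in> \<Inter>(supp (p x))"
      using * by (blast intro: supp[THEN equalityD1, THEN subsetD, THEN CollectD, THEN conjunct1])+
    ultimately show "supp (p x) \<in> nerve ?\<U>"
      unfolding nerve_def by blast
  qed
  have p_top: "p x \<in> topspace (nerve_space i)" if "x \<in> topspace X" for x
    unfolding nerve_space_def in_realization_iff[OF abstract_complex_nerve]
    using nerve[OF that] p_sum[OF that] \<phi>_nn that by (simp add: p_def)
  have "continuous_map X (nerve_space i) p"
  proof (rule pasting_lemma[of "{N. openin X N \<and> finite {U \<in> ?\<U>. N \<inter> X closure_of {y \<in> topspace X. \<phi> U y \<noteq> 0} \<noteq> {}}}"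
        X "\<lambda>N. N" _ "\<lambda>_. p"])
    fix N assume N: "N \<in> {N. openin X N \<and> finite {U \<in> ?\<U>. N \<inter> X closure_of {y \<in> topspace X. \<phi> U y \<noteq> 0} \<noteq> {}}}"
    show "continuous_map (subtopology X N) (nerve_space i) p"
      unfolding nerve_space_def
    proof (rule continuous_map_into_realization[OF abstract_complex_nerve,
          of "{U \<in> ?\<U>. N \<inter> X closure_of {y \<in> topspace X. \<phi> U y \<noteq> 0} \<noteq> {}}"])
      show "continuous_map (subtopology X N) euclideanreal (\<lambda>z. p z U)"
        if "U \<in> {U \<in> ?\<U>. N \<inter> X closure_of {y \<in> topspace X. \<phi> U y \<noteq> 0} \<noteq> {}}" for U
        using that \<phi>_cont by (simp add: p_def continuous_map_from_subtopology)
      show "p z \<in> topspace (realization (nerve ?\<U>)) \<and>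
          supp (p z) \<subseteq> {U \<in> ?\<U>. N \<inter> X closure_of {y \<in> topspace X. \<phi> U y \<noteq> 0} \<noteq> {}}"
        if z: "z \<in> topspace (subtopology X N)" for z
      proof
        show "p z \<in> topspace (realization (nerve ?\<U>))"
          using p_top z by (simp add: nerve_space_def)
        show "supp (p z) \<subseteq> {U \<in> ?\<U>. N \<inter> X closure_of {y \<in> topspace X. \<phi> U y \<noteq> 0} \<noteq> {}}"
        proof
          fix U assume U: "U \<in> supp (p z)"
          then have "z \<in> {y \<in> topspace X. \<phi> U y \<noteq> 0}"
            using z unfolding supp by simp
          then have "z \<in> X closure_of {y \<in> topspace X. \<phi> U y \<noteq> 0}"
            using closure_of_subset[of "{y \<in> topspace X. \<phi> U y \<noteq> 0}" X] by blast
          then show "U \<in> {U \<in> ?\<U>. N \<inter> X closure_of {y \<in> topspace X. \<phi> U y \<noteq> 0} \<noteq> {}}"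
            using U z unfolding supp by auto
        qed
      qed
    qed (use N in simp)
  next
    show "\<exists>j. j \<in> {N. openin X N \<and> finite {U \<in> ?\<U>. N \<inter> X closure_of {y \<in> topspace X. \<phi> U y \<noteq> 0} \<noteq> {}}} \<and>
        x \<in> j \<and> p x = p x" if "x \<in> topspace X" for x
      using \<phi> that unfolding subordinated_partition_of_unity_def by blast
  qed auto
  moreover have "p x0 = vertex_point (snd i)"
  proof -
    note x0 = shape_index_imp_topspace[OF i]
    have U0: "snd i \<in> supp (p x0)" "p x0 (snd i) = 1"
      using shape_indexD(2)[OF i] \<phi>1 by (auto simp: p_def)
    have nn: "0 \<le> p x0 U" for U
      using \<phi>_nn[OF _ x0] by (simp add: p_def)
    have fin: "finite (supp (p x0))"
      using abstract_complexD(1)[OF abstract_complex_nerve nerve[OF x0]] .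
    have "sum (p x0) (supp (p x0) - {snd i}) = 0"
      using p_sum[OF x0] U0 fin by (simp add: sum_diff1)
    then have "p x0 U = 0" if "U \<noteq> snd i" for U
      using that nn fin by (subst (asm) sum_nonneg_eq_0_iff) auto
    then show ?thesis
      using U0(2) by (auto simp: vertex_point_def)
  qed
  moreover have "{x \<in> topspace X. p x \<in> open_star (nerve ?\<U>) U} \<subseteq> U" for U
    using inter by (auto simp: open_star_def)
  ultimately show ?thesis
    unfolding canonical_map_def by blast
qed

lemma canonical_mapD:
  assumes p: "canonical_map X x0 i p" and x: "x \<in> topspace X"
  shows "p x \<in> topspace (nerve_space i)" "supp (p x) \<in> nerve (fst i)" "\<And>U. U \<in> supp (p x) \<Longrightarrow> x \<in> U"
proof -
  show px: "p x \<in> topspace (nerve_space i)"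
    using p x unfolding canonical_map_def continuous_map_def by blast
  then show N: "supp (p x) \<in> nerve (fst i)"
    unfolding nerve_space_def in_realization_iff[OF abstract_complex_nerve] by blast
  fix U assume U: "U \<in> supp (p x)"
  then have "U \<in> fst i"
    using N unfolding nerve_def by blast
  moreover have "p x \<in> open_star (nerve (fst i)) U"
    using px U by (simp add: open_star_def nerve_space_def)
  ultimately show "x \<in> U"
    using p x unfolding canonical_map_def by blast
qed

definition canonical :: "'a topology \<Rightarrow> 'a \<Rightarrow> 'a pointed_cover \<Rightarrow> 'a \<Rightarrow> 'a set \<Rightarrow> real" where
  "canonical X x0 i = (SOME p. canonical_map X x0 i p)"

lemma canonical_map_canonical: "i \<in> shape_index X x0 \<Longrightarrow> canonical_map X x0 i (canonical X x0 i)"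
  unfolding canonical_def by (rule someI_ex[OF canonical_map_exists])

lemma continuous_map_canonical:
  "i \<in> shape_index X x0 \<Longrightarrow> continuous_map X (nerve_space i) (canonical X x0 i)"
  by (drule canonical_map_canonical) (simp only: canonical_map_def)

lemma canonical_basepoint:
  "i \<in> shape_index X x0 \<Longrightarrow> canonical X x0 i x0 = vertex_point (snd i)"
  by (drule canonical_map_canonical) (simp only: canonical_map_def)

lemma shape_hom_eq:
  "i \<in> shape_index X x0 \<Longrightarrow>
    shape_hom X x0 c i = induced_hom (nerve_space i) (canonical X x0 i) c"
  by (simp add: shape_hom_def canonical_def)

lemma shape_hom_path_class:
  assumes "i \<in> shape_index X x0" "pathin X p"
  shows "shape_hom X x0 (path_class X p) i = path_class (nerve_space i) (canonical X x0 i \<circ> p)"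
  unfolding shape_hom_eq[OF assms(1)]
  by (rule induced_hom_path_class[OF continuous_map_canonical[OF assms(1)] assms(2)])

lemma shape_hom_component_hom:
  assumes "i \<in> shape_index X x0"
  shows "(\<lambda>c. shape_hom X x0 c i) \<in> hom (fundamental_group X x0) (nerve_group i)"
  unfolding shape_hom_eq[OF assms] nerve_group_def
  using induced_hom_hom[OF continuous_map_canonical[OF assms], of x0] by (simp add: canonical_basepoint[OF assms])

lemma group_hom_shape_hom_component:
  assumes "i \<in> shape_index X x0"
  shows "group_hom (fundamental_group X x0) (nerve_group i) (\<lambda>c. shape_hom X x0 c i)"
proof -
  note x0 = shape_index_imp_topspace[OF assms]
  have "vertex_point (snd i) \<in> topspace (nerve_space i)"
    using canonical_mapD(1)[OF canonical_map_canonical[OF assms] x0] canonical_basepoint[OF assms] by simp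
  then show ?thesis
    unfolding group_hom_def group_hom_axioms_def nerve_group_def
    using group_fundamental_group[OF x0] group_fundamental_group shape_hom_component_hom[OF assms]
    by (simp add: nerve_group_def)
qed

lemma vertex_assignment_exists:
  assumes "pointed_refines j i" "i \<in> shape_index X x0"
  shows "\<exists>\<tau>. vertex_assignment i j \<tau>"
proof -
  obtain f where f: "\<And>V. V \<in> fst j \<Longrightarrow> f V \<in> fst i \<and> V \<subseteq> f V"
    using assms(1) unfolding pointed_refines_def refines_def by metis
  then have "vertex_assignment i j (f(snd j := snd i))"
    using assms shape_indexD(2)[OF assms(2)] unfolding vertex_assignment_def pointed_refines_def by auto
  then show ?thesis by blast
qed

text \<open>For each point \<open>x\<close> on the loop, the support of the coarse canonical map at
  \<open>x\<close> and the \<open>\<tau>\<close>-image of the support of the fine one consist of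
  members containing \<open>x\<close>. Together they span a simplex, so the two images of the loop
  are linearly homotopic, whatever canonical maps and vertex assignment were chosen.\<close>

lemma bonding_hom_shape_hom:
  assumes i: "i \<in> shape_index X x0" and j: "j \<in> shape_index X x0" and r: "pointed_refines j i"
    and c: "c \<in> carrier (fundamental_group X x0)"
  shows "bonding_hom i j (shape_hom X x0 c j) = shape_hom X x0 c i"
proof -
  obtain p where p: "loop_at X x0 p" "c = path_class X p"
    using c by (rule fundamental_group_cases)
  then have p': "pathin X p" "p 0 = x0" "p 1 = x0"
    by (auto simp: loop_at_def)
  define \<tau> where "\<tau> = (SOME \<tau>. vertex_assignment i j \<tau>)"
  have \<tau>: "\<And>V. V \<in> fst j \<Longrightarrow> \<tau> V \<in> fst i \<and> V \<subseteq> \<tau> V" "\<tau> (snd j) = snd i"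
    using someI_ex[OF vertex_assignment_exists[OF r i]] unfolding \<tau>_def vertex_assignment_def by auto
  have simplicial: "\<tau> ` \<sigma> \<in> nerve (fst i)" if "\<sigma> \<in> nerve (fst j)" for \<sigma>
  proof -
    have "\<Inter>\<sigma> \<subseteq> \<Inter>(\<tau> ` \<sigma>)"
      using that \<tau>(1) unfolding nerve_def by blast
    then show ?thesis
      using that \<tau>(1) unfolding nerve_def by blast
  qed
  let ?p = "canonical X x0 i" and ?q = "canonical X x0 j" and ?r = "realization_map \<tau>"
  have r_cont: "continuous_map (nerve_space j) (nerve_space i) ?r"
    unfolding nerve_space_def by (intro continuous_map_realization_map abstract_complex_nerve simplicial)
  have qp: "pathin (nerve_space j) (?q \<circ> p)" and pp: "pathin (nerve_space i) (?p \<circ> p)"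
    using p'(1) continuous_map_canonical[OF i] continuous_map_canonical[OF j] by (auto intro: pathin_compose)
  have rqp: "pathin (nerve_space i) (?r \<circ> (?q \<circ> p))"
    using pathin_compose[OF qp r_cont] .
  have base: "?r (vertex_point (snd j)) = vertex_point (snd i)"
  proof
    have *: "{V. vertex_point (snd j) V \<noteq> 0 \<and> \<tau> V = U} = (if U = snd i then {snd j} else {})" for U
      using \<tau>(2) by (auto simp: vertex_point_def)
    show "?r (vertex_point (snd j)) U = vertex_point (snd i) U" for U
      unfolding realization_map_def * by (simp add: vertex_point_def)
  qed
  have "path_homotopic (nerve_space i) (?r \<circ> (?q \<circ> p)) (?p \<circ> p)"
    unfolding nerve_space_def
  proof (rule path_homotopic_linear[OF abstract_complex_nerve])
    show "\<exists>\<sigma>\<in>nerve (fst i). (?r \<circ> (?q \<circ> p)) t \<in> closed_simplex \<sigma> \<and> (?p \<circ> p) t \<in> closed_simplex \<sigma>"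
      if "0 \<le> t" "t \<le> 1" for t
    proof -
      let ?x = "p t"
      have x: "?x \<in> topspace X"
        using pathin_imp_topspace[OF p'(1)] that .
      note P = canonical_mapD[OF canonical_map_canonical[OF i] x]
      note Q = canonical_mapD[OF canonical_map_canonical[OF j] x]
      let ?\<sigma> = "\<tau> ` supp (?q ?x) \<union> supp (?p ?x)"
      have sub: "\<tau> ` supp (?q ?x) \<in> nerve (fst i)"
        using simplicial[OF Q(2)] .
      have "?x \<in> U" if "U \<in> ?\<sigma>" for U
        using that P(3) Q(3) \<tau>(1) Q(2) unfolding nerve_def by blast
      then have \<sigma>: "?\<sigma> \<in> nerve (fst i)"
        using sub P(2) unfolding nerve_def by blast
      have "?r (?q ?x) \<in> closed_simplex (\<tau> ` supp (?q ?x))"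
        using realization_map_closed_simplex(2) abstract_complexD(1)[OF abstract_complex_nerve Q(2)]
          in_closed_simplex_supp[OF abstract_complex_nerve] Q(1) unfolding nerve_space_def by blast
      moreover have "?p ?x \<in> closed_simplex (supp (?p ?x))"
        using in_closed_simplex_supp[OF abstract_complex_nerve] P(1) unfolding nerve_space_def by blast
      ultimately have "?r (?q ?x) \<in> closed_simplex ?\<sigma>" "?p ?x \<in> closed_simplex ?\<sigma>"
        using closed_simplex_iff_realization[OF abstract_complex_nerve] sub P(2) \<sigma> by blast+
      then show ?thesis
        using \<sigma> by (intro bexI[of _ ?\<sigma>]) auto
    qed
  qed (use rqp pp p' base canonical_basepoint[OF i] canonical_basepoint[OF j] in \<open>auto simp: nerve_space_def\<close>)
  then have "path_class (nerve_space i) (?r \<circ> (?q \<circ> p)) = path_class (nerve_space i) (?p \<circ> p)"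
    by (rule path_homotopic_imp_class_eq)
  then show ?thesis
    unfolding bonding_hom_def p(2) shape_hom_path_class[OF i p'(1)] shape_hom_path_class[OF j p'(1)]
      \<tau>_def[symmetric] induced_hom_path_class[OF r_cont qp] .
qed

lemma carrier_shape_group:
  "carrier (shape_group X x0) = {c \<in> (\<Pi>\<^sub>E i\<in>shape_index X x0. carrier (nerve_group i)).
     \<forall>i\<in>shape_index X x0. \<forall>j\<in>shape_index X x0.
       pointed_refines j i \<longrightarrow> bonding_hom i j (c j) = c i}"
  by (simp add: shape_group_def)

section \<open>The shape topology near the identity\<close>

lemma topspace_shape_group_topology: "topspace (shape_group_topology X x0) = carrier (shape_group X x0)"
  by (auto simp: shape_group_topology_def carrier_shape_group)

lemma shape_hom_in_shape_group:
  assumes c: "c \<in> carrier (fundamental_group X x0)"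
  shows "shape_hom X x0 c \<in> carrier (shape_group X x0)"
  unfolding carrier_shape_group
proof (intro CollectI conjI ballI impI)
  have "shape_hom X x0 c i \<in> carrier (nerve_group i)" if "i \<in> shape_index X x0" for i
    using shape_hom_component_hom[OF that] c by (auto simp: hom_def)
  moreover have "shape_hom X x0 c \<in> extensional (shape_index X x0)"
    by (simp add: shape_hom_def)
  ultimately show "shape_hom X x0 c \<in> (\<Pi>\<^sub>E i\<in>shape_index X x0. carrier (nerve_group i))"
    by (simp add: PiE_def Pi_def)
qed (rule bonding_hom_shape_hom, use c in auto)

text \<open>A pullback topology lives on the preimage of its target. This is the whole fundamental
  group because \<open>shape_hom\<close> takes values in the inverse limit.\<close>

lemma topspace_shape_topology: "topspace (shape_topology X x0) = carrier (fundamental_group X x0)"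
  using shape_hom_in_shape_group[of _ X x0]
  by (auto simp: shape_topology_def topspace_pullback_topology topspace_shape_group_topology)

text \<open>Kernels of single coordinates of \<open>shape_hom\<close>. They are open and their
  finite intersections form a neighborhood base at the identity, so only they have to be compared
  with thick Spanier groups.\<close>

definition shape_kernel :: "'a topology \<Rightarrow> 'a \<Rightarrow> 'a pointed_cover \<Rightarrow> (real \<Rightarrow> 'a) set set" where
  "shape_kernel X x0 i = kernel (fundamental_group X x0) (nerve_group i) (\<lambda>c. shape_hom X x0 c i)"

lemma openin_shape_kernel:
  assumes i: "i \<in> shape_index X x0"
  shows "openin (shape_topology X x0) (shape_kernel X x0 i)"
proof -
  interpret group_hom "fundamental_group X x0" "nerve_group i" "\<lambda>c. shape_hom X x0 c i"
    using group_hom_shape_hom_component[OF i] .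
  let ?P = "product_topology (\<lambda>i. discrete_topology (carrier (nerve_group i))) (shape_index X x0)"
  have "openin ?P {c \<in> topspace ?P. c i \<in> {\<one>\<^bsub>nerve_group i\<^esub>}}"
    by (rule openin_continuous_map_preimage[OF continuous_map_product_projection[OF i]]) simp
  then have "openin (shape_group_topology X x0)
      ({c \<in> topspace ?P. c i \<in> {\<one>\<^bsub>nerve_group i\<^esub>}} \<inter> carrier (shape_group X x0))"
    unfolding shape_group_topology_def by (rule openin_subtopology_Int)
  moreover have "shape_kernel X x0 i =
      shape_hom X x0 -` ({c \<in> topspace ?P. c i \<in> {\<one>\<^bsub>nerve_group i\<^esub>}} \<inter> carrier (shape_group X x0))
      \<inter> carrier (fundamental_group X x0)"
    using shape_hom_in_shape_group[of _ X x0]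
    by (auto simp: shape_kernel_def kernel_def carrier_shape_group)
  ultimately show ?thesis
    unfolding shape_topology_def openin_pullback_topology by blast
qed

text \<open>A basic open set of the product restricts finitely many coordinates only, and a class in
  the kernels of these coordinates has the same values there as the identity.\<close>

lemma shape_topology_basic_neighborhood:
  assumes W: "openin (shape_topology X x0) W" "\<one>\<^bsub>fundamental_group X x0\<^esub> \<in> W"
  obtains F where "finite F" "F \<subseteq> shape_index X x0"
    "\<And>c. c \<in> carrier (fundamental_group X x0) \<Longrightarrow> (\<And>i. i \<in> F \<Longrightarrow> c \<in> shape_kernel X x0 i) \<Longrightarrow> c \<in> W"
proof -
  let ?G = "fundamental_group X x0" and ?I = "shape_index X x0"
  let ?P = "product_topology (\<lambda>i. discrete_topology (carrier (nerve_group i))) ?I"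
  obtain S' where S': "openin (shape_group_topology X x0) S'" "W = shape_hom X x0 -` S' \<inter> carrier ?G"
    using W(1) unfolding shape_topology_def openin_pullback_topology by blast
  then obtain S where S: "openin ?P S" "W = shape_hom X x0 -` (S \<inter> carrier (shape_group X x0)) \<inter> carrier ?G"
    unfolding shape_group_topology_def openin_subtopology by blast
  then have "shape_hom X x0 \<one>\<^bsub>?G\<^esub> \<in> S"
    using W(2) by blast
  with S(1)[unfolded openin_product_topology_alt] have "\<exists>U. finite {i \<in> ?I. U i \<noteq> topspace (discrete_topology (carrier (nerve_group i)))} \<and>
      (\<forall>i\<in>?I. openin (discrete_topology (carrier (nerve_group i))) (U i)) \<and>
      shape_hom X x0 \<one>\<^bsub>?G\<^esub> \<in> Pi\<^sub>E ?I U \<and> Pi\<^sub>E ?I U \<subseteq> S"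
    by (rule bspec)
  then obtain U where fin: "finite {i \<in> ?I. U i \<noteq> topspace (discrete_topology (carrier (nerve_group i)))}"
    and 1: "shape_hom X x0 \<one>\<^bsub>?G\<^esub> \<in> Pi\<^sub>E ?I U" and sub: "Pi\<^sub>E ?I U \<subseteq> S"
    by blast
  show thesis
  proof
    show "c \<in> W" if c: "c \<in> carrier ?G"
      and ker: "\<And>i. i \<in> {i \<in> ?I. U i \<noteq> topspace (discrete_topology (carrier (nerve_group i)))} \<Longrightarrow> c \<in> shape_kernel X x0 i"
      for c
    proof -
      have "shape_hom X x0 c i \<in> U i" if i: "i \<in> ?I" for i
      proof (cases "U i = carrier (nerve_group i)")
        case True
        then show ?thesis
          using shape_hom_in_shape_group[OF c] i unfolding carrier_shape_group by auto
      next
        case False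
        interpret group_hom ?G "nerve_group i" "\<lambda>c. shape_hom X x0 c i"
          using group_hom_shape_hom_component[OF i] .
        have "shape_hom X x0 c i = shape_hom X x0 \<one>\<^bsub>?G\<^esub> i"
          using ker[of i] False i hom_one unfolding shape_kernel_def kernel_def by auto
        then show ?thesis
          using PiE_mem[OF 1 i] by simp
      qed
      moreover have "shape_hom X x0 c \<in> extensional ?I"
        by (simp add: shape_hom_def)
      ultimately have "shape_hom X x0 c \<in> Pi\<^sub>E ?I U"
        by (simp add: PiE_def Pi_def)
      then show "c \<in> W"
        using subsetD[OF sub] shape_hom_in_shape_group[OF c] c by (simp add: S(2))
    qed
  qed (use fin in auto)
qed

section \<open>Thick Spanier groups and sheets\<close>

lemma thick_spanier_generators_subset:
  "thick_spanier_generators X \<U> x0 \<subseteq> carrier (fundamental_group X x0)"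
proof
  fix c assume "c \<in> thick_spanier_generators X \<U> x0"
  then obtain \<alpha> \<gamma>1 \<gamma>2 where c: "c = path_class X (\<alpha> \<star> \<gamma>1 \<star> \<gamma>2 \<star> path_reverse \<alpha>)"
    and p: "pathin X \<alpha>" "\<alpha> 0 = x0" "pathin X \<gamma>1" "pathin X \<gamma>2"
      "\<gamma>1 0 = \<alpha> 1" "\<gamma>2 1 = \<alpha> 1" "\<gamma>1 1 = \<gamma>2 0"
    unfolding thick_spanier_generators_def pathin_subtopology_iff by blast
  have "pathin X (\<alpha> \<star> \<gamma>1 \<star> \<gamma>2 \<star> path_reverse \<alpha>)"
    using p by (intro pathin_join pathin_reverse) auto
  then show "c \<in> carrier (fundamental_group X x0)"
    unfolding c using p by (intro path_class_in_fundamental_group) (simp add: loop_at_def)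
qed

lemma subgroup_thick_spanier_group:
  assumes "x0 \<in> topspace X"
  shows "subgroup (thick_spanier_group X \<U> x0) (fundamental_group X x0)"
proof -
  interpret group "fundamental_group X x0"
    using group_fundamental_group[OF assms] .
  show ?thesis
    unfolding thick_spanier_group_def by (rule generate_is_subgroup[OF thick_spanier_generators_subset])
qed

lemma thick_spanier_group_mono:
  assumes x0: "x0 \<in> topspace X" and ref: "refines \<V> \<U>"
  shows "thick_spanier_group X \<V> x0 \<subseteq> thick_spanier_group X \<U> x0"
proof -
  interpret group "fundamental_group X x0"
    using group_fundamental_group[OF x0] .
  have "\<exists>U\<in>\<U>. pathin (subtopology X U) p" if "V \<in> \<V>" "pathin (subtopology X V) p" for V p
    using that ref unfolding refines_def pathin_subtopology_iff by (meson order_trans)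
  then have "thick_spanier_generators X \<V> x0 \<subseteq> thick_spanier_generators X \<U> x0"
    unfolding thick_spanier_generators_def by blast
  then show ?thesis
    unfolding thick_spanier_group_def by (rule mono_generate)
qed

text \<open>Two paths from the basepoint are related if they define the same point of the covering space
  belonging to the thick Spanier group.\<close>

definition spanier_rel ::
  "'a topology \<Rightarrow> 'a set set \<Rightarrow> 'a \<Rightarrow> (real \<Rightarrow> 'a) \<Rightarrow> (real \<Rightarrow> 'a) \<Rightarrow> bool" where
  "spanier_rel X \<V> x0 p q \<longleftrightarrow> pathin X p \<and> pathin X q \<and> p 0 = x0 \<and> q 0 = x0 \<and> p 1 = q 1 \<and>
     path_class X (p \<star> path_reverse q) \<in> thick_spanier_group X \<V> x0"

lemma spanier_relD:
  assumes "spanier_rel X \<V> x0 p q"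
  shows "pathin X p" "pathin X q" "p 0 = x0" "q 0 = x0" "p 1 = q 1"
    "path_class X (p \<star> path_reverse q) \<in> thick_spanier_group X \<V> x0"
    "subgroup (thick_spanier_group X \<V> x0) (fundamental_group X x0)"
proof -
  show *: "pathin X p" "pathin X q" "p 0 = x0" "q 0 = x0" "p 1 = q 1"
    "path_class X (p \<star> path_reverse q) \<in> thick_spanier_group X \<V> x0"
    using assms by (auto simp: spanier_rel_def)
  show "subgroup (thick_spanier_group X \<V> x0) (fundamental_group X x0)"
    using pathin_imp_topspace[OF *(1), of 0] *(3) by (intro subgroup_thick_spanier_group) auto
qed

lemma spanier_rel_homotopic:
  assumes h: "path_homotopic X p q" and p0: "p 0 = x0"
  shows "spanier_rel X \<V> x0 p q"
proof -
  have pq: "pathin X p" "pathin X q" "q 0 = x0" "q 1 = p 1"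
    using path_homotopic_imp_pathin[OF h] path_homotopic_imp_endpoints[OF h] p0 by auto
  then have x0: "x0 \<in> topspace X"
    using pathin_imp_topspace[of X q 0] by auto
  have "path_homotopic X (p \<star> path_reverse q) (q \<star> path_reverse q)"
    using pq h by (intro path_homotopic_join) (auto simp: pathin_reverse)
  also have "path_homotopic X \<dots> (\<lambda>_. x0)"
    using path_homotopic_join_reverse[OF pq(2)] pq by simp
  finally have "path_class X (p \<star> path_reverse q) = \<one>\<^bsub>fundamental_group X x0\<^esub>"
    unfolding one_fundamental_group by (rule path_homotopic_imp_class_eq)
  then show ?thesis
    using pq p0 subgroup.one_closed[OF subgroup_thick_spanier_group[OF x0]] by (simp add: spanier_rel_def)
qed

lemma spanier_rel_sym:
  assumes r: "spanier_rel X \<V> x0 p q"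
  shows "spanier_rel X \<V> x0 q p"
proof -
  note D = spanier_relD[OF r]
  have "loop_at X x0 (p \<star> path_reverse q)"
    using D by (auto simp: loop_at_def intro!: pathin_join pathin_reverse)
  then have "inv\<^bsub>fundamental_group X x0\<^esub> path_class X (p \<star> path_reverse q) = path_class X (q \<star> path_reverse p)"
    using D by (simp add: inv_fundamental_group path_reverse_join)
  then have "path_class X (q \<star> path_reverse p) \<in> thick_spanier_group X \<V> x0"
    using subgroup.m_inv_closed[OF D(7,6)] by simp
  then show ?thesis
    using D by (simp add: spanier_rel_def)
qed

lemma spanier_rel_trans [trans]:
  assumes "spanier_rel X \<V> x0 p q" "spanier_rel X \<V> x0 q r"
  shows "spanier_rel X \<V> x0 p r"
proof -
  note D = spanier_relD[OF assms(1)] and E = spanier_relD[OF assms(2)]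
  note rev = pathin_reverse[OF D(2)] pathin_reverse[OF E(2)]
  have "path_homotopic X ((p \<star> path_reverse q) \<star> (q \<star> path_reverse r))
      (p \<star> (path_reverse q \<star> (q \<star> path_reverse r)))"
    by (rule path_homotopic_assoc) (use D E rev in \<open>auto intro!: pathin_join\<close>)
  also have "path_homotopic X \<dots> (p \<star> path_reverse r)"
    by (rule path_homotopic_join) (use D E rev path_homotopic_cancel(2)[of X q "path_reverse r"] in auto)
  finally have "path_class X (p \<star> path_reverse q) \<otimes>\<^bsub>fundamental_group X x0\<^esub> path_class X (q \<star> path_reverse r)
      = path_class X (p \<star> path_reverse r)"
    using D E rev by (simp add: mult_fundamental_group pathin_join path_homotopic_imp_class_eq)
  then have "path_class X (p \<star> path_reverse r) \<in> thick_spanier_group X \<V> x0"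
    using subgroup.m_closed[OF D(7,6) E(6)] by simp
  then show ?thesis
    using D E by (simp add: spanier_rel_def)
qed

text \<open>The appended path cancels against its reverse. In the covering space this says that the
  end of a lift depends only on the point where the lift starts.\<close>

lemma spanier_rel_join:
  assumes r: "spanier_rel X \<V> x0 p q" and \<gamma>: "pathin X \<gamma>" "\<gamma> 0 = p 1"
  shows "spanier_rel X \<V> x0 (p \<star> \<gamma>) (q \<star> \<gamma>)"
proof -
  note D = spanier_relD[OF r]
  note rev = pathin_reverse[OF D(2)] pathin_reverse[OF \<gamma>(1)]
  have p\<gamma>: "pathin X (p \<star> \<gamma>)" and q\<gamma>: "pathin X (q \<star> \<gamma>)"
    using D \<gamma> by (auto intro: pathin_join)
  have "path_homotopic X ((p \<star> \<gamma>) \<star> path_reverse (q \<star> \<gamma>)) (((p \<star> \<gamma>) \<star> path_reverse \<gamma>) \<star> path_reverse q)"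
    using D \<gamma> rev p\<gamma> path_homotopic_sym[OF path_homotopic_assoc[OF p\<gamma> rev(2,1)]]
    by (simp add: path_reverse_join)
  also have "path_homotopic X \<dots> (p \<star> path_reverse q)"
    by (rule path_homotopic_join) (use D \<gamma> rev path_homotopic_cancel(1)[of X p \<gamma>] in auto)
  finally have "path_class X ((p \<star> \<gamma>) \<star> path_reverse (q \<star> \<gamma>)) = path_class X (p \<star> path_reverse q)"
    by (rule path_homotopic_imp_class_eq)
  then show ?thesis
    using D \<gamma> p\<gamma> q\<gamma> by (simp add: spanier_rel_def)
qed

text \<open>Reversing \<open>\<gamma>2\<close> turns the two paths into the loop of a generator with
  tail \<open>p\<close>: two routes between the same points, each inside one member of the cover,
  lead to the same point of the covering space.\<close>

lemma spanier_rel_generator: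
  assumes p: "pathin X p" "p 0 = x0" and U: "U1 \<in> \<V>" "U2 \<in> \<V>"
    and \<gamma>1: "pathin (subtopology X U1) \<gamma>1" "\<gamma>1 0 = p 1"
    and \<gamma>2: "pathin (subtopology X U2) \<gamma>2" "\<gamma>2 0 = p 1" and e: "\<gamma>1 1 = \<gamma>2 1"
  shows "spanier_rel X \<V> x0 (p \<star> \<gamma>1) (p \<star> \<gamma>2)"
proof -
  have \<gamma>: "pathin X \<gamma>1" "pathin X \<gamma>2"
    using \<gamma>1 \<gamma>2 by (auto simp: pathin_subtopology_iff)
  note rev = pathin_reverse[OF p(1)] pathin_reverse[OF \<gamma>(2)]
  have "pathin (subtopology X U2) (path_reverse \<gamma>2)"
    using pathin_reverse[OF \<gamma>2(1)] .
  then have gen: "path_class X (p \<star> \<gamma>1 \<star> path_reverse \<gamma>2 \<star> path_reverse p) \<in> thick_spanier_generators X \<V> x0"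
    using assms unfolding thick_spanier_generators_def mem_Collect_eq
    by (intro exI[of _ p] exI[of _ \<gamma>1] exI[of _ "path_reverse \<gamma>2"]) auto
  have "path_homotopic X ((p \<star> \<gamma>1) \<star> path_reverse (p \<star> \<gamma>2)) (p \<star> \<gamma>1 \<star> path_reverse \<gamma>2 \<star> path_reverse p)"
    unfolding path_reverse_join[where p = p and q = \<gamma>2, OF \<gamma>2(2)[symmetric]]
    by (rule path_homotopic_assoc) (use p \<gamma> \<gamma>1 \<gamma>2 e rev in \<open>auto intro: pathin_join\<close>)
  then have "path_class X ((p \<star> \<gamma>1) \<star> path_reverse (p \<star> \<gamma>2)) \<in> thick_spanier_group X \<V> x0"
    using gen path_homotopic_imp_class_eq unfolding thick_spanier_group_def by (metis generate.incl)
  then show ?thesis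
    using p \<gamma> \<gamma>1 \<gamma>2 e by (simp add: spanier_rel_def pathin_join)
qed

text \<open>A path \<open>p\<close> ending in \<open>V\<close> determines a sheet of the covering space over \<open>V\<close>; the next relation
  says that the sheet of \<open>p\<close> over \<open>V\<close> and that of \<open>q\<close> over \<open>V'\<close> intersect.\<close>

definition linked ::
  "'a topology \<Rightarrow> 'a set set \<Rightarrow> 'a \<Rightarrow> 'a set \<Rightarrow> (real \<Rightarrow> 'a) \<Rightarrow> 'a set \<Rightarrow> (real \<Rightarrow> 'a) \<Rightarrow> bool" where
  "linked X \<V> x0 V p V' q \<longleftrightarrow> pathin X p \<and> p 0 = x0 \<and>
     (\<exists>\<delta> \<delta>'. pathin (subtopology X V) \<delta> \<and> pathin (subtopology X V') \<delta>' \<and>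
        \<delta> 0 = p 1 \<and> \<delta> 1 = \<delta>' 0 \<and> \<delta>' 1 = q 1 \<and> spanier_rel X \<V> x0 ((p \<star> \<delta>) \<star> \<delta>') q)"

lemma linkedE:
  assumes "linked X \<V> x0 V p V' q"
  obtains \<delta> \<delta>' where "pathin (subtopology X V) \<delta>" "pathin (subtopology X V') \<delta>'"
    "\<delta> 0 = p 1" "\<delta> 1 = \<delta>' 0" "\<delta>' 1 = q 1" "spanier_rel X \<V> x0 ((p \<star> \<delta>) \<star> \<delta>') q"
    "pathin X p" "p 0 = x0" "p 1 \<in> V" "pathin X q" "q 0 = x0" "q 1 \<in> V'" "pathin X \<delta>" "pathin X \<delta>'"
proof -
  obtain \<delta> \<delta>' where d: "pathin (subtopology X V) \<delta>" "pathin (subtopology X V') \<delta>'"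
    "\<delta> 0 = p 1" "\<delta> 1 = \<delta>' 0" "\<delta>' 1 = q 1" "spanier_rel X \<V> x0 ((p \<star> \<delta>) \<star> \<delta>') q"
    and p: "pathin X p" "p 0 = x0"
    using assms unfolding linked_def by blast
  have "\<delta> 0 \<in> V" "\<delta>' 1 \<in> V'"
    using d(1,2) by (auto simp: pathin_subtopology_iff image_subset_iff)
  then show thesis
    using that[OF d p] d spanier_relD[OF d(6)] by (simp add: pathin_subtopology_iff)
qed

text \<open>A link supplies some pair of connecting paths; here it is shown that every pair serves.
  The given crossing point \<open>a 1\<close> and that of the witnesses may lie in different path
  components of \<open>V \<inter> V'\<close>, and a thick generator is what bridges them.\<close>

lemma linked_imp_spanier_rel:
  assumes l: "linked X \<V> x0 V p V' q" and V: "V \<in> \<V>" "V' \<in> \<V>"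
    and a: "pathin (subtopology X V) a" "a 0 = p 1"
    and b: "pathin (subtopology X V') b" "b 0 = a 1" "b 1 = q 1"
  shows "spanier_rel X \<V> x0 ((p \<star> a) \<star> b) q"
proof -
  from l obtain \<delta> \<delta>' where d: "pathin (subtopology X V) \<delta>" "pathin (subtopology X V') \<delta>'"
    "\<delta> 0 = p 1" "\<delta> 1 = \<delta>' 0" "\<delta>' 1 = q 1" "spanier_rel X \<V> x0 ((p \<star> \<delta>) \<star> \<delta>') q"
    "pathin X p" "p 0 = x0" "pathin X \<delta>" "pathin X \<delta>'"
    by (rule linkedE)
  have ab: "pathin X a" "pathin X b"
    using a b by (auto simp: pathin_subtopology_iff)
  note rev = pathin_reverse[OF ab(2)] pathin_reverse[OF d(9)]
  have p\<delta>: "pathin X (p \<star> \<delta>)"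
    using d by (intro pathin_join) auto
  \<comment> \<open>Both connecting paths lead from \<open>\<delta> 1\<close> to \<open>a 1\<close>,
    the first inside \<open>V'\<close> and the second inside \<open>V\<close>.\<close>
  have 1: "spanier_rel X \<V> x0 ((p \<star> \<delta>) \<star> (\<delta>' \<star> path_reverse b)) ((p \<star> \<delta>) \<star> (path_reverse \<delta> \<star> a))"
    by (rule spanier_rel_generator[OF p\<delta> _ V(2,1)])
       (use d a b in \<open>auto intro!: pathin_join pathin_reverse\<close>)
  have "path_homotopic X ((p \<star> \<delta>) \<star> (path_reverse \<delta> \<star> a)) (((p \<star> \<delta>) \<star> path_reverse \<delta>) \<star> a)"
    by (rule path_homotopic_sym, rule path_homotopic_assoc) (use p\<delta> rev ab a d in auto)
  also have "path_homotopic X \<dots> (p \<star> a)"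
    by (rule path_homotopic_join) (use path_homotopic_cancel(1)[of X p \<delta>] ab a d in auto)
  finally have "spanier_rel X \<V> x0 ((p \<star> \<delta>) \<star> (path_reverse \<delta> \<star> a)) (p \<star> a)"
    using d by (intro spanier_rel_homotopic) auto
  with 1 have "spanier_rel X \<V> x0 ((p \<star> \<delta>) \<star> (\<delta>' \<star> path_reverse b)) (p \<star> a)"
    by (rule spanier_rel_trans)
  then have 2: "spanier_rel X \<V> x0 (((p \<star> \<delta>) \<star> (\<delta>' \<star> path_reverse b)) \<star> b) ((p \<star> a) \<star> b)"
    using ab b by (intro spanier_rel_join) auto
  have "path_homotopic X (((p \<star> \<delta>) \<star> (\<delta>' \<star> path_reverse b)) \<star> b) ((((p \<star> \<delta>) \<star> \<delta>') \<star> path_reverse b) \<star> b)"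
    by (rule path_homotopic_join, rule path_homotopic_sym, rule path_homotopic_assoc)
       (use p\<delta> rev ab b d in auto)
  also have "path_homotopic X \<dots> ((p \<star> \<delta>) \<star> \<delta>')"
    using path_homotopic_cancel(1)[of X "(p \<star> \<delta>) \<star> \<delta>'" "path_reverse b"] p\<delta> rev ab b d
    by (simp add: pathin_join)
  finally have "spanier_rel X \<V> x0 (((p \<star> \<delta>) \<star> (\<delta>' \<star> path_reverse b)) \<star> b) ((p \<star> \<delta>) \<star> \<delta>')"
    using d by (intro spanier_rel_homotopic) auto
  then show ?thesis
    using 2 d(6) spanier_rel_sym spanier_rel_trans by metis
qed

lemma linked_sym:
  assumes "linked X \<V> x0 V p V' q"
  shows "linked X \<V> x0 V' q V p"
proof -
  from assms obtain \<delta> \<delta>' where d: "pathin (subtopology X V) \<delta>" "pathin (subtopology X V') \<delta>'"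
    "\<delta> 0 = p 1" "\<delta> 1 = \<delta>' 0" "\<delta>' 1 = q 1" "spanier_rel X \<V> x0 ((p \<star> \<delta>) \<star> \<delta>') q"
    "pathin X p" "p 0 = x0" "pathin X q" "q 0 = x0" "pathin X \<delta>" "pathin X \<delta>'"
    by (rule linkedE)
  let ?r = "(p \<star> \<delta>) \<star> \<delta>'"
  note rev = pathin_reverse[OF d(11)] pathin_reverse[OF d(12)]
  have p\<delta>: "pathin X (p \<star> \<delta>)"
    using d by (intro pathin_join) auto
  have "spanier_rel X \<V> x0 ((?r \<star> path_reverse \<delta>') \<star> path_reverse \<delta>) ((q \<star> path_reverse \<delta>') \<star> path_reverse \<delta>)"
    using d rev by (intro spanier_rel_join) auto
  moreover have "path_homotopic X ((?r \<star> path_reverse \<delta>') \<star> path_reverse \<delta>) ((p \<star> \<delta>) \<star> path_reverse \<delta>)"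
    by (rule path_homotopic_join) (use d rev p\<delta> path_homotopic_cancel(1)[of X "p \<star> \<delta>" \<delta>'] in auto)
  then have "path_homotopic X ((?r \<star> path_reverse \<delta>') \<star> path_reverse \<delta>) p"
    using path_homotopic_cancel(1)[of X p \<delta>] d path_homotopic_trans by metis
  then have "spanier_rel X \<V> x0 ((?r \<star> path_reverse \<delta>') \<star> path_reverse \<delta>) p"
    using d by (intro spanier_rel_homotopic) auto
  ultimately have "spanier_rel X \<V> x0 ((q \<star> path_reverse \<delta>') \<star> path_reverse \<delta>) p"
    using spanier_rel_sym spanier_rel_trans by metis
  then show ?thesis
    unfolding linked_def using d pathin_reverse[OF d(1)] pathin_reverse[OF d(2)]
    by (intro conjI exI[of _ "path_reverse \<delta>'"] exI[of _ "path_reverse \<delta>"]) auto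
qed

lemma path_connectedin_obtain_path:
  assumes "path_connectedin X V" "x \<in> V" "y \<in> V"
  obtains a where "pathin (subtopology X V) a" "a 0 = x" "a 1 = y"
  using assms unfolding path_connectedin pathin_subtopology_iff by (metis image_subset_iff_funcset)

text \<open>Over a point common to all three sets, the sheet over \<open>V'\<close> met by a given sheet over \<open>V\<close> is
  unique. This is where pairs of members of the cover in the generators are used.\<close>

lemma linked_trans:
  assumes pq: "linked X \<V> x0 V p V' q" and qr: "linked X \<V> x0 V' q V'' r"
    and V: "V \<in> \<V>" "V' \<in> \<V>" "V'' \<in> \<V>" and z: "z \<in> V" "z \<in> V'" "z \<in> V''"
    and pc: "\<And>V. V \<in> \<V> \<Longrightarrow> path_connectedin X V"
  shows "linked X \<V> x0 V p V'' r"
proof -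
  from pq have p: "pathin X p" "p 0 = x0" "p 1 \<in> V" and q: "pathin X q" "q 1 \<in> V'"
    by (auto elim: linkedE)
  from qr have r: "r 1 \<in> V''"
    by (auto elim: linkedE)
  \<comment> \<open>Since the connecting paths of a link may be exchanged, both links are made to
    cross at \<open>z\<close>; the detour to the end of \<open>q\<close> and back then
    cancels.\<close>
  obtain a where a: "pathin (subtopology X V) a" "a 0 = p 1" "a 1 = z"
    using path_connectedin_obtain_path[OF pc[OF V(1)] p(3) z(1)] .
  obtain b where b: "pathin (subtopology X V') b" "b 0 = z" "b 1 = q 1"
    using path_connectedin_obtain_path[OF pc[OF V(2)] z(2) q(2)] .
  obtain c where c: "pathin (subtopology X V'') c" "c 0 = z" "c 1 = r 1"
    using path_connectedin_obtain_path[OF pc[OF V(3)] z(3) r] .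
  have abc: "pathin X a" "pathin X b" "pathin X c"
    using a b c by (auto simp: pathin_subtopology_iff)
  note rev = pathin_reverse[OF abc(2)]
  have 1: "spanier_rel X \<V> x0 ((p \<star> a) \<star> b) q"
    using linked_imp_spanier_rel[OF pq V(1,2) a(1,2) b(1)] a b by simp
  have 2: "spanier_rel X \<V> x0 ((q \<star> path_reverse b) \<star> c) r"
    using linked_imp_spanier_rel[OF qr V(2,3) pathin_reverse[OF b(1)] _ c(1)] b c by simp
  have 3: "spanier_rel X \<V> x0 ((((p \<star> a) \<star> b) \<star> path_reverse b) \<star> c) ((q \<star> path_reverse b) \<star> c)"
    using 1 rev abc b c by (intro spanier_rel_join) auto
  have "path_homotopic X ((((p \<star> a) \<star> b) \<star> path_reverse b) \<star> c) ((p \<star> a) \<star> c)"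
    by (rule path_homotopic_join)
      (use path_homotopic_cancel(1)[OF pathin_join[OF p(1) abc(1)] abc(2)] abc a b c in auto)
  then have "spanier_rel X \<V> x0 ((((p \<star> a) \<star> b) \<star> path_reverse b) \<star> c) ((p \<star> a) \<star> c)"
    using p by (intro spanier_rel_homotopic) auto
  then have "spanier_rel X \<V> x0 ((p \<star> a) \<star> c) r"
    using 2 3 spanier_rel_sym spanier_rel_trans by metis
  then show ?thesis
    unfolding linked_def using p a c by (intro conjI exI[of _ a] exI[of _ c]) auto
qed

text \<open>The crossing into \<open>V'\<close> happens at the very end of \<open>\<delta>\<close>,
  so the second connecting path is constant.\<close>

lemma linked_step:
  assumes p: "pathin X p" "p 0 = x0" and \<delta>: "pathin (subtopology X V) \<delta>" "\<delta> 0 = p 1" "\<delta> 1 \<in> V'"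
    and q: "path_homotopic X (p \<star> \<delta>) q"
  shows "linked X \<V> x0 V p V' q"
proof -
  have \<delta>X: "pathin X \<delta>"
    using \<delta> by (simp add: pathin_subtopology_iff)
  have "path_homotopic X ((p \<star> \<delta>) \<star> (\<lambda>_. \<delta> 1)) (p \<star> \<delta>)"
    using path_homotopic_join_const(1)[of X "p \<star> \<delta>"] p \<delta>X \<delta> by (simp add: pathin_join)
  then have "path_homotopic X ((p \<star> \<delta>) \<star> (\<lambda>_. \<delta> 1)) q"
    using q by (rule path_homotopic_trans)
  then have "spanier_rel X \<V> x0 ((p \<star> \<delta>) \<star> (\<lambda>_. \<delta> 1)) q"
    using p by (intro spanier_rel_homotopic) auto
  moreover have "pathin (subtopology X V') (\<lambda>_. \<delta> 1)"
    using \<delta> pathin_imp_topspace[OF \<delta>X, of 1] by simp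
  moreover have "q 1 = \<delta> 1"
    using path_homotopic_imp_endpoints[OF q] by simp
  ultimately show ?thesis
    unfolding linked_def using p \<delta> by (intro conjI exI[of _ \<delta>] exI[of _ "\<lambda>_. \<delta> 1"]) auto
qed

lemma linked_exists:
  assumes p: "pathin X p" "p 0 = x0" "p 1 \<in> V" and V: "path_connectedin X V" and z: "z \<in> V" "z \<in> V'"
  obtains q where "linked X \<V> x0 V p V' q"
proof -
  obtain a where a: "pathin (subtopology X V) a" "a 0 = p 1" "a 1 = z"
    using path_connectedin_obtain_path[OF V p(3) z(1)] .
  then have "pathin X (p \<star> a)"
    using p by (intro pathin_join) (auto simp: pathin_subtopology_iff)
  then show thesis
    using that[OF linked_step[OF p(1,2) a(1,2)], of "p \<star> a"] a z by simp
qed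

text \<open>With constant connecting paths, which are as good as any others, a link from the
  constant path to \<open>\<alpha>\<close> over \<open>V0\<close> says that both define the same
  point of the covering space.\<close>

lemma linked_const_imp_thick_spanier_group:
  assumes l: "linked X \<V> x0 V (\<lambda>_. x0) V \<alpha>" and V: "V \<in> \<V>" and \<alpha>: "loop_at X x0 \<alpha>"
  shows "path_class X \<alpha> \<in> thick_spanier_group X \<V> x0"
proof -
  have x0: "x0 \<in> V" "x0 \<in> topspace X"
    using l pathin_imp_topspace[of X "\<lambda>_. x0" 0] by (auto elim: linkedE)
  have \<alpha>': "pathin X \<alpha>" "\<alpha> 0 = x0" "\<alpha> 1 = x0"
    using \<alpha> by (auto simp: loop_at_def)
  have "spanier_rel X \<V> x0 (((\<lambda>_. x0) \<star> (\<lambda>_. x0)) \<star> (\<lambda>_. x0)) \<alpha>"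
    using x0 \<alpha>' by (intro linked_imp_spanier_rel[OF l V V]) auto
  moreover have "((\<lambda>_. x0) \<star> (\<lambda>_. x0)) \<star> (\<lambda>_. x0) = (\<lambda>_. x0)"
    by (auto simp: path_join_def)
  ultimately have "spanier_rel X \<V> x0 \<alpha> (\<lambda>_. x0)"
    using spanier_rel_sym by metis
  then have "path_class X (\<alpha> \<star> (\<lambda>_. x0)) \<in> thick_spanier_group X \<V> x0"
    using spanier_relD(6) by (fastforce simp: path_reverse_def)
  moreover have "path_class X (\<alpha> \<star> (\<lambda>_. x0)) = path_class X \<alpha>"
    using path_homotopic_join_const(1)[OF \<alpha>'(1)] \<alpha>' by (simp add: path_homotopic_imp_class_eq)
  ultimately show ?thesis
    by simp
qed

text \<open>The cells of a square grid carry members of the cover, constantly \<open>V0\<close> along three sides.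
  Choosing linked paths upwards column by column, a chain of linked paths along the bottom row is
  moved to the top row, where it is trivial.\<close>

lemma linked_grid:
  assumes pc: "\<And>V. V \<in> \<V> \<Longrightarrow> path_connectedin X V"
    and V: "\<And>a b. a \<le> M \<Longrightarrow> b \<le> M \<Longrightarrow> V a b \<in> \<V>" and V0: "V0 \<in> \<V>" "x0 \<in> V0"
    and left: "\<And>b. b \<le> M \<Longrightarrow> V 0 b = V0" and right: "\<And>b. b \<le> M \<Longrightarrow> V M b = V0"
    and top: "\<And>a. a \<le> M \<Longrightarrow> V a M = V0"
    and corner: "\<And>a b. a < M \<Longrightarrow> b < M \<Longrightarrow>
      V a b \<inter> V (Suc a) b \<inter> V a (Suc b) \<inter> V (Suc a) (Suc b) \<noteq> {}"
    and r: "\<And>a. a < M \<Longrightarrow> linked X \<V> x0 (V a 0) (r a) (V (Suc a) 0) (r (Suc a))"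
    and r0: "linked X \<V> x0 V0 p V0 (r 0)" and rM: "linked X \<V> x0 V0 (r M) V0 q"
  shows "linked X \<V> x0 V0 p V0 q"
proof -
  have trans0: "linked X \<V> x0 V0 p1 V0 p3"
    if "linked X \<V> x0 V0 p1 V0 p2" "linked X \<V> x0 V0 p2 V0 p3" for p1 p2 p3
    using linked_trans[OF that V0(1,1,1) V0(2,2,2) pc] .
  have row: "\<exists>r. (\<forall>a<M. linked X \<V> x0 (V a b) (r a) (V (Suc a) b) (r (Suc a))) \<and>
      linked X \<V> x0 V0 p V0 (r 0) \<and> linked X \<V> x0 V0 (r M) V0 q" if "b \<le> M" for b
    using that
  proof (induction b)
    case 0
    then show ?case
      using r r0 rM by blast
  next
    case (Suc b)
    then have b: "b < M" "b \<le> M"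
      by auto
    obtain s where s: "\<And>a. a < M \<Longrightarrow> linked X \<V> x0 (V a b) (s a) (V (Suc a) b) (s (Suc a))"
      and s0: "linked X \<V> x0 V0 p V0 (s 0)" and sM: "linked X \<V> x0 V0 (s M) V0 q"
      using Suc.IH[OF b(2)] by blast
    have "\<exists>q. linked X \<V> x0 (V a b) (s a) (V a (Suc b)) q" if a: "a \<le> M" for a
    \<comment> \<open>The last column has no corner to its right, but there both members are
      \<open>V0\<close> and share \<open>x0\<close>.\<close>
    proof (cases "a = M")
      case True
      have "pathin X (s M)" "s M 0 = x0" "s M 1 \<in> V0"
        using sM by (auto elim: linkedE)
      then show ?thesis
        using linked_exists[of X "s M" x0 V0 x0 V0 \<V>] pc V0 right b Suc.prems True by metis
    next
      case False
      then have "a < M"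
        using a by simp
      then have "pathin X (s a)" "s a 0 = x0" "s a 1 \<in> V a b"
        using s[of a] by (auto elim: linkedE)
      moreover obtain z where "z \<in> V a b" "z \<in> V a (Suc b)"
        using corner[OF \<open>a < M\<close> b(1)] by blast
      ultimately show ?thesis
        using linked_exists pc V a b by metis
    qed
    then obtain t where t: "\<And>a. a \<le> M \<Longrightarrow> linked X \<V> x0 (V a b) (s a) (V a (Suc b)) (t a)"
      by metis
    have "linked X \<V> x0 (V a (Suc b)) (t a) (V (Suc a) (Suc b)) (t (Suc a))" if a: "a < M" for a
    proof -
      obtain z where z: "z \<in> V a b" "z \<in> V (Suc a) b" "z \<in> V a (Suc b)" "z \<in> V (Suc a) (Suc b)"
        using corner[OF a b(1)] by blast
      have W: "V a b \<in> \<V>" "V (Suc a) b \<in> \<V>" "V a (Suc b) \<in> \<V>" "V (Suc a) (Suc b) \<in> \<V>"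
        using V a b by auto
      \<comment> \<open>Around one square: right along the old row and up give the diagonal link;
        preceded by the link down from \<open>t a\<close>, it becomes a link in the new row. Each
        composition uses the point \<open>z\<close> common to all four members.\<close>
      have "linked X \<V> x0 (V a b) (s a) (V (Suc a) (Suc b)) (t (Suc a))"
        using a by (intro linked_trans[OF s t W(1,2,4) z(1,2,4) pc]) auto
      with linked_sym[OF t] a show ?thesis
        by (intro linked_trans[OF _ _ W(3,1,4) z(3,1,4) pc]) auto
    qed
    moreover have "linked X \<V> x0 V0 (s 0) V0 (t 0)" "linked X \<V> x0 V0 (t M) V0 (s M)"
      using t[of 0] linked_sym[OF t[of M]] left right b Suc.prems by auto
    then have "linked X \<V> x0 V0 p V0 (t 0)" "linked X \<V> x0 V0 (t M) V0 q"
      using s0 sM trans0 by blast+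
    ultimately show ?case
      by blast
  qed
  obtain s where s: "\<And>a. a < M \<Longrightarrow> linked X \<V> x0 V0 (s a) V0 (s (Suc a))"
    and s0: "linked X \<V> x0 V0 p V0 (s 0)" and sM: "linked X \<V> x0 V0 (s M) V0 q"
    using row[of M] top by (metis Suc_leI less_imp_le order_refl)
  have "linked X \<V> x0 V0 p V0 (s a)" if "a \<le> M" for a
    using that by (induction a) (use s s0 trans0 in \<open>auto dest: Suc_leD\<close>)
  then show ?thesis
    using sM trans0 by blast
qed

section \<open>Kernels versus thick Spanier groups\<close>

definition subpath_of :: "real \<Rightarrow> real \<Rightarrow> (real \<Rightarrow> 'a) \<Rightarrow> real \<Rightarrow> 'a" where
  "subpath_of u v p = (\<lambda>t. p ((1 - t) * u + t * v))"

lemma subpath_of_endpoints [simp]: "subpath_of u v p 0 = p u" "subpath_of u v p 1 = p v"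
  by (auto simp: subpath_of_def)

lemma subpath_of_in:
  fixes u v t :: real
  assumes "u \<le> v" "0 \<le> t" "t \<le> 1"
  shows "u \<le> (1 - t) * u + t * v" "(1 - t) * u + t * v \<le> v"
  using convex_bound_le[of u v v "1 - t" t] convex_bound_le[of "- u" "- u" "- v" "1 - t" t] assms
  by (auto simp: algebra_simps)

lemma
  fixes u v w :: real
  assumes p: "pathin X p" and uvw: "0 \<le> u" "u \<le> v" "v \<le> w" "w \<le> 1"
  shows pathin_subpath_of: "pathin X (subpath_of u v p)"
    and path_homotopic_subpath_of_join:
      "path_homotopic X (subpath_of u v p \<star> subpath_of v w p) (subpath_of u w p)"
proof -
  define l where "l u v t = (1 - t) * u + t * v" for u v t :: real
  have l: "continuous_on {0..1} (l u v)" for u v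
    unfolding l_def by (intro continuous_intros)
  have l01: "l u v ` {0..1} \<subseteq> {0..1}" if "0 \<le> u" "u \<le> v" "v \<le> 1" for u v
  proof
    fix x assume "x \<in> l u v ` {0..1}"
    then obtain t where "x = l u v t" "0 \<le> t" "t \<le> 1"
      by auto
    then have "u \<le> x" "x \<le> v"
      using subpath_of_in[OF that(2), of t] unfolding l_def by simp_all
    then show "x \<in> {0..1}"
      using that by simp
  qed
  have sub: "subpath_of u v p = p \<circ> l u v" for u v
    by (auto simp: subpath_of_def l_def)
  show "pathin X (subpath_of u v p)"
    unfolding sub using uvw by (intro pathin_reparametrize p l l01) auto
  show "path_homotopic X (subpath_of u v p \<star> subpath_of v w p) (subpath_of u w p)"
    unfolding sub comp_path_join[symmetric]
    using uvw by (intro path_homotopic_reparametrize p continuous_on_path_join path_join_image l l01)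
      (auto simp: l_def)
qed

lemma shape_kernel_path_class_iff:
  assumes j: "j \<in> shape_index X x0" and \<alpha>: "loop_at X x0 \<alpha>"
  shows "path_class X \<alpha> \<in> shape_kernel X x0 j \<longleftrightarrow>
    path_homotopic (nerve_space j) (canonical X x0 j \<circ> \<alpha>) (\<lambda>_. vertex_point (snd j))"
proof -
  have "pathin X \<alpha>"
    using \<alpha> by (simp add: loop_at_def)
  then show ?thesis
    using path_class_in_fundamental_group[OF \<alpha>] pathin_compose[OF \<open>pathin X \<alpha>\<close> continuous_map_canonical[OF j]]
    by (simp add: shape_kernel_def kernel_def shape_hom_path_class[OF j] nerve_group_def
        one_fundamental_group path_class_eq_iff)
qed

text \<open>The Lebesgue number lemma for the square. \<open>M\<close> is the index of the last cell
  in each direction, so the mesh is \<open>1 / (1 + real M)\<close>; the bound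
  \<open>2 / \<delta>\<close> for \<open>M\<close> comes from estimating the diameter of a cell by
  the sum of its sides. Cells are closed, so neighbours share their corners.\<close>

lemma unit_square_grid_cover:
  fixes T :: "'i \<Rightarrow> (real \<times> real) set"
  assumes op: "\<And>i. i \<in> I \<Longrightarrow> open (T i)" and cov: "{0..1} \<times> {0..1} \<subseteq> (\<Union>i\<in>I. T i)"
  obtains M :: nat where "\<And>a b :: nat. a \<le> M \<Longrightarrow> b \<le> M \<Longrightarrow> \<exists>i\<in>I.
    {real b / (1 + real M)..(1 + real b) / (1 + real M)} \<times>
    {real a / (1 + real M)..(1 + real a) / (1 + real M)} \<subseteq> T i"
proof -
  have "T ` I \<noteq> {}"
    using cov by force
  then obtain \<delta> where \<delta>: "0 < \<delta>"
    "\<And>C. C \<subseteq> {0..1} \<times> {0..1} \<Longrightarrow> diameter C < \<delta> \<Longrightarrow> \<exists>B\<in>T ` I. C \<subseteq> B"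
    using Lebesgue_number_lemma[of "{0..1} \<times> {0..1}" "T ` I"] op cov compact_Times[of "{0..1::real}" "{0..1::real}"]
    by (metis (no_types, lifting) compact_Icc image_iff)
  obtain M where M: "2 / \<delta> < real M"
    using reals_Archimedean2 by blast
  let ?N = "1 + real M"
  have N: "2 / ?N < \<delta>"
    using M \<delta>(1) by (simp add: field_simps)
  show thesis
  proof (rule that)
    fix a b :: nat assume ab: "a \<le> M" "b \<le> M"
    let ?C = "{real b / ?N..(1 + real b) / ?N} \<times> {real a / ?N..(1 + real a) / ?N}"
    have "?C \<subseteq> {0..1} \<times> {0..1}"
    proof (intro Sigma_mono)
      have "{real c / ?N..(1 + real c) / ?N} \<subseteq> {0..1}" if "c \<le> M" for c
        using that by (auto simp: field_simps intro: order_trans)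
      then show "{real b / ?N..(1 + real b) / ?N} \<subseteq> {0..1}" "{real a / ?N..(1 + real a) / ?N} \<subseteq> {0..1}"
        using ab by auto
    qed
    moreover have "diameter ?C \<le> 2 / ?N"
    proof (rule diameter_le)
      fix x y assume x: "x \<in> ?C" and y: "y \<in> ?C"
      have gap: "\<bar>s - t\<bar> \<le> 1 / ?N" if "s \<in> {c / ?N..(1 + c) / ?N}" "t \<in> {c / ?N..(1 + c) / ?N}" for s t c :: real
        using that by (auto simp: abs_le_iff add_divide_distrib)
      have "norm (x - y) \<le> norm (fst x - fst y) + norm (snd x - snd y)"
        using norm_Pair_le[of "fst x - fst y" "snd x - snd y"] by (simp add: minus_prod_def)
      also have "\<dots> \<le> 1 / ?N + 1 / ?N"
        using x y gap unfolding real_norm_def by (intro add_mono) (auto simp: mem_Times_iff)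
      finally show "norm (x - y) \<le> 2 / ?N"
        by simp
    qed auto
    ultimately have "\<exists>B\<in>T ` I. ?C \<subseteq> B"
      using \<delta>(2) N by simp
    then show "\<exists>i\<in>I. ?C \<subseteq> T i"
      by blast
  qed
qed

lemma shape_kernel_subset_thick_spanier_group:
  fixes X :: "'a topology"
  assumes j: "(\<V>, V0) \<in> shape_index X x0"
    and pc: "\<And>V. V \<in> \<V> \<Longrightarrow> path_connectedin X V"
  shows "shape_kernel X x0 (\<V>, V0) \<subseteq> thick_spanier_group X \<V> x0"
proof
  fix c assume c: "c \<in> shape_kernel X x0 (\<V>, V0)"
  then have "c \<in> carrier (fundamental_group X x0)"
    by (simp add: shape_kernel_def kernel_def)
  then obtain \<alpha> where \<alpha>: "loop_at X x0 \<alpha>" and c\<alpha>: "c = path_class X \<alpha>"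
    by (rule fundamental_group_cases)
  then have \<alpha>': "pathin X \<alpha>" "\<alpha> 0 = x0" "\<alpha> 1 = x0"
    by (auto simp: loop_at_def)
  let ?K = "nerve \<V>" and ?p = "canonical X x0 (\<V>, V0)" and ?S = "{0..1::real} \<times> {0..1::real}"
  have K: "abstract_complex ?K"
    by (rule abstract_complex_nerve)
  have V0: "V0 \<in> \<V>" "x0 \<in> V0"
    using shape_indexD[OF j] by auto
  note p = canonical_mapD[OF canonical_map_canonical[OF j]]
  have null: "path_homotopic (realization ?K) (?p \<circ> \<alpha>) (\<lambda>_. vertex_point V0)"
    using c shape_kernel_path_class_iff[OF j \<alpha>] unfolding c\<alpha> nerve_space_def by simp
  obtain h :: "real \<times> real \<Rightarrow> 'a set \<Rightarrow> real" where "continuous_map (prod_topology (top_of_set {0..1}) (top_of_set {0..1})) (realization ?K) h"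
    and h0: "\<And>t. h (0, t) = (?p \<circ> \<alpha>) t" and h1: "\<And>t. h (1, t) = vertex_point V0"
    and "\<And>s. 0 \<le> s \<Longrightarrow> s \<le> 1 \<Longrightarrow> h (s, 0) = (?p \<circ> \<alpha>) 0 \<and> h (s, 1) = (?p \<circ> \<alpha>) 1"
    using path_homotopic_homotopyE[OF null] by metis
  then have h: "continuous_map (top_of_set ?S) (realization ?K) h"
    and hs: "\<And>s. 0 \<le> s \<Longrightarrow> s \<le> 1 \<Longrightarrow> h (s, 0) = vertex_point V0 \<and> h (s, 1) = vertex_point V0"
    using \<alpha>' canonical_basepoint[OF j] by simp_all
  have h_top: "h z \<in> topspace (realization ?K)" if "z \<in> ?S" for z
    using h that unfolding continuous_map_def by auto
  \<comment> \<open>The Lebesgue number lemma needs sets open in the plane, so the relatively open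
    preimages of the stars are extended beyond the square.\<close>
  have "\<exists>T. open T \<and> {z \<in> ?S. h z \<in> open_star ?K V} = ?S \<inter> T" for V
    using openin_continuous_map_preimage[OF h openin_open_star[of ?K V]]
    by (simp add: openin_open)
  then obtain T where T: "\<And>V. open (T V)" "\<And>V. {z \<in> ?S. h z \<in> open_star ?K V} = ?S \<inter> T V"
    by metis
  have "?S \<subseteq> (\<Union>V\<in>\<V>. T V)"
  proof
    fix z assume z: "z \<in> ?S"
    then have "supp (h z) \<in> ?K"
      using h_top in_realization_iff[OF K] by blast
    then obtain V where "V \<in> \<V>" "h z V \<noteq> 0"
      unfolding nerve_def by blast
    then have "h z \<in> open_star ?K V"
      using h_top[OF z] by (simp add: open_star_def)
    then show "z \<in> (\<Union>V\<in>\<V>. T V)"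
      using T(2)[of V] z \<open>V \<in> \<V>\<close> by blast
  qed
  then obtain M :: nat where M: "\<And>a b :: nat. a \<le> M \<Longrightarrow> b \<le> M \<Longrightarrow> \<exists>V\<in>\<V>.
      {real b / (1 + real M)..(1 + real b) / (1 + real M)} \<times>
      {real a / (1 + real M)..(1 + real a) / (1 + real M)} \<subseteq> T V"
    using unit_square_grid_cover[of \<V> T] T(1) by metis
  define N where "N = 1 + real M"
  \<comment> \<open>The first coordinate is the homotopy parameter: \<open>b\<close> counts rows
    from the loop towards the constant path, and \<open>a\<close> counts along the time of the
    path.\<close>
  define cell where "cell a b = {real b / N..(1 + real b) / N} \<times> {real a / N..(1 + real a) / N}" for a b
  have N: "0 < N"
    by (simp add: N_def)
  obtain V where V: "\<And>a b. a \<le> M \<Longrightarrow> b \<le> M \<Longrightarrow> V a b \<in> \<V> \<and> cell a b \<subseteq> T (V a b)"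
    using M unfolding cell_def N_def by metis
  have grid: "0 \<le> real c / N" "real c / N \<le> 1" if "c \<le> Suc M" for c
    using that N by (auto simp: N_def)
  have cell_star: "h z \<in> open_star ?K (V a b)" if "a \<le> M" "b \<le> M" "z \<in> cell a b" "z \<in> ?S" for a b z
    using V[OF that(1,2)] that(3,4) T(2)[of "V a b"] by blast
  have in_cell: "(real d / N, real c / N) \<in> cell a b"
    if "d = b \<or> d = Suc b" "c = a \<or> c = Suc a" for a b c d
    using that N by (auto simp: cell_def divide_right_mono)
  \<comment> \<open>A vertex lies in no open star but its own. Hence the cells touching the three
    sides on which \<open>h\<close> is constant carry \<open>V0\<close>.\<close>
  have vertex: "V a b = V0" if "a \<le> M" "b \<le> M" "z \<in> cell a b" "z \<in> ?S" "h z = vertex_point V0" for a b z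
    using cell_star[OF that(1-4)] that(5) by (auto simp: open_star_def vertex_point_def split: if_splits)
  \<comment> \<open>On the side where \<open>h\<close> is \<open>?p \<circ> \<alpha>\<close>, the
    defining property of a canonical map turns membership in an open star into membership in the
    member of the cover. Here the homotopy in the nerve gives information about \<open>X\<close>
    itself.\<close>
  have edge: "V a 0 \<in> \<V>" "\<alpha> t \<in> V a 0" if "a \<le> M" "real a / N \<le> t" "t \<le> (1 + real a) / N" for a t
  proof -
    show "V a 0 \<in> \<V>"
      using V that by simp
    have t: "0 \<le> t" "t \<le> 1"
      using that grid[of a] grid[of "Suc a"] by auto
    have "h (0, t) \<in> open_star ?K (V a 0)"
      using that t N by (intro cell_star) (auto simp: cell_def)
    then have "V a 0 \<in> supp (?p (\<alpha> t))"
      by (simp add: open_star_def h0)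
    then show "\<alpha> t \<in> V a 0"
      using p(3)[OF pathin_imp_topspace[OF \<alpha>'(1) t]] by blast
  qed
  \<comment> \<open>The part of \<open>\<alpha>\<close> before column \<open>a\<close>; it ends in
    \<open>V a 0\<close> when \<open>a \<le> M\<close> and is all of \<open>\<alpha>\<close> when
    \<open>a\<close> is \<open>Suc M\<close>.\<close>
  define r where "r a = subpath_of 0 (real a / N) \<alpha>" for a
  have r: "pathin X (r a)" "r a 0 = x0" "r a 1 = \<alpha> (real a / N)" if "a \<le> Suc M" for a
    unfolding r_def using \<alpha>' grid[OF that] by (auto intro: pathin_subpath_of)
  have \<delta>: "pathin (subtopology X (V a 0)) (subpath_of (real a / N) ((1 + real a) / N) \<alpha>)" if a: "a \<le> M" for a
    unfolding pathin_subtopology_iff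
  proof
    have le: "real a / N \<le> (1 + real a) / N"
      using N by (simp add: divide_right_mono)
    then show "pathin X (subpath_of (real a / N) ((1 + real a) / N) \<alpha>)"
      using \<alpha>' grid[of a] grid[of "Suc a"] a by (intro pathin_subpath_of) auto
    show "subpath_of (real a / N) ((1 + real a) / N) \<alpha> ` {0..1} \<subseteq> V a 0"
      using edge(2)[OF a] subpath_of_in[OF le] by (auto simp: subpath_of_def)
  qed
  have join: "path_homotopic X (r a \<star> subpath_of (real a / N) ((1 + real a) / N) \<alpha>) (r (Suc a))" if a: "a \<le> M" for a
    using path_homotopic_subpath_of_join[OF \<alpha>'(1), of 0 "real a / N" "real (Suc a) / N"]
      grid[of a] grid[of "Suc a"] a N unfolding r_def by (simp add: divide_right_mono)
  have left: "V 0 b = V0" if "b \<le> M" for b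
    using that in_cell[of b b 0 0] grid[of b] hs by (intro vertex[of 0 b "(real b / N, 0)"]) auto
  have right: "V M b = V0" if "b \<le> M" for b
    using that in_cell[of b b "Suc M" M] grid[of b] hs N
    by (intro vertex[of M b "(real b / N, 1)"]) (auto simp: N_def)
  have top: "V a M = V0" if "a \<le> M" for a
    using that in_cell[of "Suc M" M a a] grid[of a] h1 N
    by (intro vertex[of a M "(1, real a / N)"]) (auto simp: N_def)
  have "linked X \<V> x0 V0 (\<lambda>_. x0) V0 \<alpha>"
  proof (rule linked_grid[OF pc, where M = M and V = V and r = r])
    \<comment> \<open>The grid point common to the four cells is mapped into all four open stars.
      The four members therefore belong to the support of its image, which is a simplex of the nerve
      and so has nonempty intersection.\<close>
    show "V a b \<inter> V (Suc a) b \<inter> V a (Suc b) \<inter> V (Suc a) (Suc b) \<noteq> {}" if ab: "a < M" "b < M" for a b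
    proof -
      let ?z = "(real (Suc b) / N, real (Suc a) / N)"
      have z: "?z \<in> ?S"
        using grid[of "Suc b"] grid[of "Suc a"] ab by auto
      have "V c d \<in> supp (h ?z)" if "c = a \<or> c = Suc a" "d = b \<or> d = Suc b" for c d
        using cell_star[OF _ _ in_cell[of "Suc b" d "Suc a" c] z] that ab by (auto simp: open_star_def)
      moreover have "\<Inter>(supp (h ?z)) \<noteq> {}"
        using h_top[OF z] in_realization_iff[OF K] unfolding nerve_def by blast
      ultimately show ?thesis
        by blast
    qed
    show "linked X \<V> x0 (V a 0) (r a) (V (Suc a) 0) (r (Suc a))" if "a < M" for a
    proof (rule linked_step[OF _ _ \<delta> _ _ join])
      show "subpath_of (real a / N) ((1 + real a) / N) \<alpha> 1 \<in> V (Suc a) 0"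
        using edge(2)[of "Suc a" "(1 + real a) / N"] that N by (simp add: divide_right_mono)
    qed (use that r[of a] in auto)
    show "linked X \<V> x0 V0 (\<lambda>_. x0) V0 (r 0)"
    proof (rule linked_step)
      have "r 0 = (\<lambda>_. x0)"
        using \<alpha>' by (auto simp: r_def subpath_of_def)
      then show "path_homotopic X ((\<lambda>_. x0) \<star> (\<lambda>_. x0)) (r 0)"
        using r(1)[of 0] path_homotopic_join_const(1)[of X "\<lambda>_. x0"] by simp
    qed (use V0 pathin_imp_topspace[OF \<alpha>'(1), of 0] \<alpha>' in auto)
    have "r (Suc M) = \<alpha>"
      using N by (simp add: r_def subpath_of_def N_def add.commute)
    then show "linked X \<V> x0 V0 (r M) V0 \<alpha>"
      using linked_step[OF r(1,2) \<delta>[of M] _ _ join[of M], of V0] right[of 0] V0 \<alpha>' r(3)[of M] N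
      by (simp add: N_def)
  qed (use V V0 left right top in auto)
  then show "c \<in> thick_spanier_group X \<V> x0"
    unfolding c\<alpha> using V0(1) \<alpha> by (rule linked_const_imp_thick_spanier_group)
qed

lemma shape_kernel_contains_thick_spanier_group:
  assumes i: "i \<in> shape_index X x0"
  obtains \<V> where "open_cover X \<V>" "thick_spanier_group X \<V> x0 \<subseteq> shape_kernel X x0 i"
proof
  let ?p = "canonical X x0 i" and ?K = "nerve (fst i)"
  let ?B = "\<lambda>\<sigma>. {x \<in> topspace X. ?p x \<in> barycentric_star ?K \<sigma>}"
  let ?\<V> = "?B ` ?K"
  have K: "abstract_complex ?K"
    by (rule abstract_complex_nerve)
  have p: "continuous_map X (realization ?K) ?p"
    using continuous_map_canonical[OF i] by (simp add: nerve_space_def)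
  show "open_cover X ?\<V>"
    unfolding open_cover_def
  proof (intro conjI ballI equalityI subsetI)
    fix x assume x: "x \<in> topspace X"
    then have "?p x \<in> topspace (realization ?K)"
      using p unfolding continuous_map_def by blast
    then show "x \<in> \<Union>?\<V>"
      using realization_covered_by_barycentric_stars[OF K] x by blast
  qed (use openin_continuous_map_preimage[OF p openin_barycentric_star[OF K]] in auto)
  interpret group_hom "fundamental_group X x0" "nerve_group i" "\<lambda>c. shape_hom X x0 c i"
    using group_hom_shape_hom_component[OF i] .
  have "thick_spanier_generators X ?\<V> x0 \<subseteq> shape_kernel X x0 i"
  proof
    fix c assume "c \<in> thick_spanier_generators X ?\<V> x0"
    then obtain \<alpha> \<gamma>1 \<gamma>2 \<sigma> \<tau> where c: "c = path_class X (\<alpha> \<star> \<gamma>1 \<star> \<gamma>2 \<star> path_reverse \<alpha>)"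
      and \<alpha>: "pathin X \<alpha>" "\<alpha> 0 = x0" and \<sigma>\<tau>: "\<sigma> \<in> ?K" "\<tau> \<in> ?K"
      and \<gamma>1: "pathin X \<gamma>1" "\<gamma>1 ` {0..1} \<subseteq> ?B \<sigma>" and \<gamma>2: "pathin X \<gamma>2" "\<gamma>2 ` {0..1} \<subseteq> ?B \<tau>"
      and e: "\<gamma>1 0 = \<alpha> 1" "\<gamma>2 1 = \<alpha> 1" "\<gamma>1 1 = \<gamma>2 0"
      unfolding thick_spanier_generators_def pathin_subtopology_iff by blast
    let ?A = "?p \<circ> \<alpha>" and ?\<gamma> = "?p \<circ> (\<gamma>1 \<star> \<gamma>2)"
    \<comment> \<open>The junction of \<open>\<gamma>1\<close> and \<open>\<gamma>2\<close>
      witnesses that the two barycentric stars meet, so one open star of the nerve contains the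
      image of the whole loop.\<close>
    have "\<gamma>1 1 \<in> ?B \<sigma>" "\<gamma>2 0 \<in> ?B \<tau>"
      using subsetD[OF \<gamma>1(2), of "\<gamma>1 1"] subsetD[OF \<gamma>2(2), of "\<gamma>2 0"] by simp_all
    then have "?p (\<gamma>1 1) \<in> barycentric_star ?K \<sigma>" "?p (\<gamma>1 1) \<in> barycentric_star ?K \<tau>"
      using e(3) by auto
    then obtain v where v: "barycentric_star ?K \<sigma> \<subseteq> open_star ?K v" "barycentric_star ?K \<tau> \<subseteq> open_star ?K v"
      using barycentric_stars_subset_open_star[OF K \<sigma>\<tau>] by metis
    have \<gamma>X: "pathin X (\<gamma>1 \<star> \<gamma>2)"
      using \<gamma>1 \<gamma>2 e by (intro pathin_join) auto
    have A: "pathin (realization ?K) ?A" and \<gamma>: "pathin (realization ?K) ?\<gamma>"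
      using pathin_compose[OF _ p] \<alpha> \<gamma>X by auto
    have "(\<gamma>1 \<star> \<gamma>2) ` {0..1} \<subseteq> ?B \<sigma> \<union> ?B \<tau>"
      using \<gamma>1(2) \<gamma>2(2) by (intro path_join_image) auto
    then have star: "?\<gamma> t \<in> open_star ?K v" if "0 \<le> t" "t \<le> 1" for t
      using that v by (force simp: image_subset_iff)
    have null: "path_homotopic (realization ?K) ?\<gamma> (\<lambda>_. ?A 1)"
    proof -
      have "?\<gamma> 0 = ?A 1" "?\<gamma> 1 = ?\<gamma> 0"
        using e by simp_all
      then show ?thesis
        using path_homotopic_const_open_star[OF K \<gamma> _ star] by metis
    qed
    have loop: "loop_at X x0 (\<alpha> \<star> \<gamma>1 \<star> \<gamma>2 \<star> path_reverse \<alpha>)"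
      using \<alpha> \<gamma>1 \<gamma>2 e by (auto simp: loop_at_def intro!: pathin_join pathin_reverse)
    have "path_homotopic X (\<alpha> \<star> \<gamma>1 \<star> \<gamma>2 \<star> path_reverse \<alpha>) (\<alpha> \<star> (\<gamma>1 \<star> \<gamma>2) \<star> path_reverse \<alpha>)"
      using \<alpha> \<gamma>1 \<gamma>2 e
      by (intro path_homotopic_join path_homotopic_sym[OF path_homotopic_assoc]) (auto intro: pathin_reverse)
    then have "path_homotopic (realization ?K) (?p \<circ> (\<alpha> \<star> \<gamma>1 \<star> \<gamma>2 \<star> path_reverse \<alpha>))
        (?A \<star> ?\<gamma> \<star> path_reverse ?A)"
      using path_homotopic_compose[OF _ p] by (fastforce simp: comp_path_join comp_path_reverse)
    also have "path_homotopic (realization ?K) \<dots> (?A \<star> (\<lambda>_. ?A 1) \<star> path_reverse ?A)"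
      by (intro path_homotopic_join null) (use A pathin_reverse[OF A] e in auto)
    also have "path_homotopic (realization ?K) \<dots> (?A \<star> path_reverse ?A)"
      by (rule path_homotopic_join)
        (use A path_homotopic_join_const(2)[OF pathin_reverse[OF A]] in auto)
    also have "path_homotopic (realization ?K) \<dots> (\<lambda>_. ?A 0)"
      by (rule path_homotopic_join_reverse[OF A])
    finally show "c \<in> shape_kernel X x0 i"
      unfolding c shape_kernel_path_class_iff[OF i loop]
      using \<alpha> canonical_basepoint[OF i] by (simp add: nerve_space_def)
  qed
  then show "thick_spanier_group X ?\<V> x0 \<subseteq> shape_kernel X x0 i"
    unfolding thick_spanier_group_def shape_kernel_def
    by (rule G.generate_subgroup_incl[OF _ subgroup_kernel])
qed

text \<open>Pairwise intersections of two covers refine both, and thick Spanier groups shrink under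
  refinement.\<close>

lemma finite_shape_kernels_contain_thick_spanier_group:
  assumes x0: "x0 \<in> topspace X" and F: "finite F" "F \<subseteq> shape_index X x0"
  shows "\<exists>\<V>. open_cover X \<V> \<and> (\<forall>i\<in>F. thick_spanier_group X \<V> x0 \<subseteq> shape_kernel X x0 i)"
  using F
proof (induction F rule: finite_induct)
  case empty
  have "open_cover X {topspace X}"
    by (simp add: open_cover_def)
  then show ?case by blast
next
  case (insert i F)
  then obtain \<V> where \<V>: "open_cover X \<V>" "\<forall>i\<in>F. thick_spanier_group X \<V> x0 \<subseteq> shape_kernel X x0 i"
    by blast
  obtain \<W> where \<W>: "open_cover X \<W>" "thick_spanier_group X \<W> x0 \<subseteq> shape_kernel X x0 i"
    using shape_kernel_contains_thick_spanier_group[of i X x0] insert.prems by blast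
  let ?\<R> = "(\<lambda>(V, W). V \<inter> W) ` (\<V> \<times> \<W>)"
  have "open_cover X ?\<R>"
    using \<V>(1) \<W>(1) unfolding open_cover_def by (fastforce intro: openin_Int)
  moreover have "refines ?\<R> \<V>" "refines ?\<R> \<W>"
    by (auto simp: refines_def)
  ultimately have "open_cover X ?\<R>" "thick_spanier_group X ?\<R> x0 \<subseteq> thick_spanier_group X \<V> x0"
    "thick_spanier_group X ?\<R> x0 \<subseteq> thick_spanier_group X \<W> x0"
    using thick_spanier_group_mono[OF x0] by blast+
  then show ?case
    using \<V>(2) \<W>(2) by (intro exI[of _ ?\<R>]) auto
qed

theorem theorem44:
  fixes X :: "'a topology" and x0 :: 'a
  assumes "path_connected_space X"
    and "locally_path_connected_space X"
    and "paracompact_space X"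
    and "Hausdorff_space X"
    and "x0 \<in> topspace X"
  shows "neighborhood_base (shape_topology X x0) \<one>\<^bsub>fundamental_group X x0\<^esub>
           {thick_spanier_group X \<U> x0 | \<U>. open_cover X \<U>}"
  unfolding neighborhood_base_def
proof (intro conjI ballI allI impI)
  fix N assume "N \<in> {thick_spanier_group X \<U> x0 | \<U>. open_cover X \<U>}"
  then obtain \<U> where \<U>: "open_cover X \<U>" and N: "N = thick_spanier_group X \<U> x0"
    by blast
  show "N \<subseteq> topspace (shape_topology X x0)"
    unfolding N topspace_shape_topology
    using subgroup.subset[OF subgroup_thick_spanier_group[OF assms(5)]] .
  \<comment> \<open>Members of \<open>\<U>\<close> may be disconnected, whereas sheets need path
    connected members. Passing to the refinement is harmless, since its thick Spanier group is
    contained in \<open>N\<close>; the open set sought inside \<open>N\<close> is then the kernel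
    belonging to \<open>\<V>\<close>.\<close>
  obtain \<V> where \<V>: "open_cover X \<V>" "refines \<V> \<U>" "\<And>V. V \<in> \<V> \<Longrightarrow> path_connectedin X V"
    using locally_path_connected_refinement[OF assms(2) \<U>] by metis
  then obtain V0 where V0: "V0 \<in> \<V>" "x0 \<in> V0"
    using assms(5) unfolding open_cover_def by blast
  have j: "(\<V>, V0) \<in> shape_index X x0"
    using paracompact_Hausdorff_shape_index[OF assms(3,4) \<V>(1) V0] .
  interpret group_hom "fundamental_group X x0" "nerve_group (\<V>, V0)" "\<lambda>c. shape_hom X x0 c (\<V>, V0)"
    using group_hom_shape_hom_component[OF j] .
  have "shape_kernel X x0 (\<V>, V0) \<subseteq> N"
    using shape_kernel_subset_thick_spanier_group[OF j \<V>(3)] thick_spanier_group_mono[OF assms(5) \<V>(2)]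
    unfolding N by blast
  moreover have "\<one>\<^bsub>fundamental_group X x0\<^esub> \<in> shape_kernel X x0 (\<V>, V0)"
    unfolding shape_kernel_def using subgroup.one_closed[OF subgroup_kernel] .
  ultimately show "\<exists>W. openin (shape_topology X x0) W \<and> \<one>\<^bsub>fundamental_group X x0\<^esub> \<in> W \<and> W \<subseteq> N"
    using openin_shape_kernel[OF j] by blast
next
  fix W assume "openin (shape_topology X x0) W \<and> \<one>\<^bsub>fundamental_group X x0\<^esub> \<in> W"
  then obtain F where F: "finite F" "F \<subseteq> shape_index X x0"
    "\<And>c. c \<in> carrier (fundamental_group X x0) \<Longrightarrow> (\<And>i. i \<in> F \<Longrightarrow> c \<in> shape_kernel X x0 i) \<Longrightarrow> c \<in> W"
    using shape_topology_basic_neighborhood[of X x0 W] by metis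
  obtain \<V> where \<V>: "open_cover X \<V>" "\<forall>i\<in>F. thick_spanier_group X \<V> x0 \<subseteq> shape_kernel X x0 i"
    using finite_shape_kernels_contain_thick_spanier_group[OF assms(5) F(1,2)] by blast
  then have "thick_spanier_group X \<V> x0 \<subseteq> W"
    using F(3) subgroup.subset[OF subgroup_thick_spanier_group[OF assms(5)]] by blast
  then show "\<exists>N\<in>{thick_spanier_group X \<U> x0 | \<U>. open_cover X \<U>}. N \<subseteq> W"
    using \<V>(1) by blast
qed

end
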